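(* Let $\gamma>\gamma_0$. There exist $\kappa_0>0$ and a nondecreasing function $\pi:\mathbb{R}^+\to\mathbb{R}^+$ such that if $0<\kappa<\kappa_0$ and $|u^0|+\|w\|_{L^2(0,\infty;H)}\le\pi(\kappa)$, then the nonlinear system $$\frac{du}{dt}+\mathcal{A}_{\mathcal{R}}u+B(u)=B_2w,\qquad u(0)=u^0,$$ has a unique solution $u\in C([0,\infty];H)\cap L^2(0,\infty;V)$, and the solution belongs to $$\Sigma_\kappa=\{u\in L^\infty(0,\infty;H)\cap L^2(0,\infty;V):\ \|u\|_{L^\infty(0,\infty;H)}\le\kappa,\ \|u\|_{L^2(0,\infty;V)}\le\kappa\}.$$
   Context: $H=\ell^2(\mathbb{C})$ (complex sequences indexed by $n\ge 1$) with $(u,v)=\sum_{n\ge1}u_nv_n^*$ and $|u|=(u,u)^{1/2}$. Fix $\lambda>1$, $k_0>0$, $k_n=k_0\lambda^n$, $\nu>0$, and constants $a,b,c$ with $a+b+c=0$. Let $(\phi_n)$ be the canonical basis of $H$. $A\phi_n=k_n^2\phi_n$, with $D(A)=\{u\in H:|Au|<\infty\}$; $V=D(A^{1/2})$ with norm $\|u\|=|A^{1/2}u|$. The map $B$ is $$B(u,v)=-i\sum_{n=1}^\infty\big(ak_{n+1}v_{n+2}u_{n+1}^*+bk_nv_{n+1}u_{n-1}^*+ak_{n-1}u_{n-1}v_{n-2}+bk_{n-1}v_{n-1}u_{n-2}\big)\phi_n,$$ with $u_0=u_{-1}=v_0=v_{-1}=0$ (in these component formulas $^*$ is complex conjugation),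 and $B(u)=B(u,u)$. $u_e$ is a solution of $\nu Au_e+B(u_e,u_e)=f$. The linearized operator is $\mathcal{A}u=\nu Au+B(u,u_e)+B(u_e,u)$ with $D(\mathcal{A})=D(A)$; $-\mathcal{A}$ generates an analytic $C_0$-semigroup on $H$. $B_1,B_2\in\mathcal{L}(H,H)$, $\gamma>0$. Consider the linear system $\frac{du}{dt}+\mathcal{A}u=B_1U+B_2w$, $u(0)=u^0\in H$, with control $U\in L^2(0,\infty;H)$ and disturbance $w\in L^2(0,\infty;H)$, and $$\mathcal{J}(u,U,w)=\frac12\int_0^\infty|u|^2\,dt+\frac12\int_0^\infty|U|^2\,dt-\frac\gamma2\int_0^\infty|w|^2\,dt.$$ Put $P(u^0,w)=\inf_U\mathcal{J}(u,U,w)$ and $P(u^0)=\sup_{w\in L^2(0,\infty;H)}P(u^0,w)$. $\gamma_0>0$ is the threshold such that for $\gamma>\gamma_0$ the supremum is attained at a unique $\hat w$, while for $\gamma<\gamma_0$ it is $+\infty$. For $\gamma>\gamma_0$ let $\hat u$ be the optimal state for $(u^0,\hat w)$ and let $r_{u^0}$ be the associated solution of $-\frac{dr}{dt}+\mathcal{A}^*r=\hat u$, $r(\infty)=0$; $\mathcal{R}\in\mathcal{L}(H)$ is defined by $\mathcal{R}u^0=r_{u^0}(0)$, so that $P(u^0)=\frac12(u^0,\mathcal{R}u^0)$. $\mathcal{R}$ is symmetric, positive and satisfies $$\mathcal{A}^*\mathcal{R}+\mathcal{R}\mathcal{A}+\mathcal{R}B_1B_1^*\mathcal{R}-\frac1\gamma\mathcal{R}B_2B_2^*\mathcal{R}-I=0.$$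 The closed loop operator is $\mathcal{A}_{\mathcal{R}}u=\mathcal{A}u+B_1B_1^*\mathcal{R}u$ with $D(\mathcal{A}_{\mathcal{R}})=\{u\in H:\mathcal{A}u+B_1B_1^*\mathcal{R}u\in H\}$. *)

theory Defs
  imports "HOL-Probability.Essential_Supremum"
begin

section \<open>The space of square-summable complex sequences\<close>

text \<open>
  Sequences are indexed by \<open>n \<ge> 1\<close>; the value at index \<open>0\<close> is fixed to \<open>0\<close>. Because natural
  subtraction truncates, this also realizes the conventions \<open>u\<^sub>0 = u\<^bsub>-1\<^esub> = 0\<close> of the shell model:
  \<open>n - 1\<close> and \<open>n - 2\<close> evaluate to \<open>0\<close> whenever they should be \<open>\<le> 0\<close>.

  The bilinear term of the model involves complex conjugation, so all operators derived from it
  are only real linear. The space is therefore treated as a real Hilbert space, with inner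
  product the real part of \<open>\<Sum>n. u\<^sub>n v\<^sub>n\<^sup>*\<close>; the norm is the same.
\<close>

definition ell2_seqs :: "(nat \<Rightarrow> complex) set" where
  "ell2_seqs = {x. x 0 = 0 \<and> summable (\<lambda>n. (cmod (x n))\<^sup>2)}"

typedef ell2 = ell2_seqs morphisms coord Abs_ell2
  by (rule exI[of _ "\<lambda>_. 0"]) (simp add: ell2_seqs_def)

setup_lifting type_definition_ell2

lemma ell2_eqI: "(\<And>n. coord x n = coord y n) \<Longrightarrow> x = y"
  by (metis coord_inject ext)

lemma coord_0 [simp]: "coord x 0 = 0"
  using coord[of x] by (simp add: ell2_seqs_def)

lemma summable_coord: "summable (\<lambda>n. (cmod (coord x n))\<^sup>2)"
  using coord[of x] by (simp add: ell2_seqs_def)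

lemma cmod_add_sq_le: "(cmod (x + y))\<^sup>2 \<le> 2 * (cmod x)\<^sup>2 + 2 * (cmod y)\<^sup>2"
proof -
  have "(cmod (x + y))\<^sup>2 \<le> (cmod x + cmod y)\<^sup>2"
    by (intro power_mono norm_triangle_ineq norm_ge_zero)
  also have "\<dots> \<le> 2 * (cmod x)\<^sup>2 + 2 * (cmod y)\<^sup>2"
    using sum_squares_bound[of "cmod x" "cmod y"] by (simp add: power2_sum)
  finally show ?thesis .
qed

lemma ell2_seqs_add:
  assumes "x \<in> ell2_seqs" "y \<in> ell2_seqs"
  shows "(\<lambda>n. x n + y n) \<in> ell2_seqs"
proof -
  have "summable (\<lambda>n. 2 * (cmod (x n))\<^sup>2 + 2 * (cmod (y n))\<^sup>2)"
    using assms by (intro summable_add summable_mult) (auto simp: ell2_seqs_def)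
  then have "summable (\<lambda>n. (cmod (x n + y n))\<^sup>2)"
    by (rule summable_comparison_test[rotated]) (auto intro!: exI[of _ 0] simp: cmod_add_sq_le)
  with assms show ?thesis by (simp add: ell2_seqs_def)
qed

lemma ell2_seqs_scaleR:
  assumes "x \<in> ell2_seqs"
  shows "(\<lambda>n. r *\<^sub>R x n) \<in> ell2_seqs"
  using assms summable_mult[of "\<lambda>n. (cmod (x n))\<^sup>2" "r\<^sup>2"]
  by (simp add: ell2_seqs_def power_mult_distrib)

instantiation ell2 :: real_vector
begin

lift_definition zero_ell2 :: ell2 is "\<lambda>_. 0"
  by (simp add: ell2_seqs_def)
lift_definition plus_ell2 :: "ell2 \<Rightarrow> ell2 \<Rightarrow> ell2" is "\<lambda>x y n. x n + y n"
  by (rule ell2_seqs_add)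
lift_definition uminus_ell2 :: "ell2 \<Rightarrow> ell2" is "\<lambda>x n. - x n"
  by (simp add: ell2_seqs_def)
lift_definition scaleR_ell2 :: "real \<Rightarrow> ell2 \<Rightarrow> ell2" is "\<lambda>r x n. r *\<^sub>R x n"
  by (rule ell2_seqs_scaleR)
definition minus_ell2 :: "ell2 \<Rightarrow> ell2 \<Rightarrow> ell2" where "minus_ell2 x y = x + (- y)"

lemma coord_simps [simp]:
  "coord 0 n = 0" "coord (x + y) n = coord x n + coord y n"
  "coord (- x) n = - coord x n" "coord (x - y) n = coord x n - coord y n"
  "coord (r *\<^sub>R x) n = r *\<^sub>R coord x n"
  by (simp_all only: minus_ell2_def zero_ell2.rep_eq plus_ell2.rep_eq uminus_ell2.rep_eq
      scaleR_ell2.rep_eq add_uminus_conv_diff)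

instance
proof
  fix x y z :: ell2 and r s :: real
  show "x + y + z = x + (y + z)" by (rule ell2_eqI) (simp only: coord_simps add.assoc)
  show "x + y = y + x" by (rule ell2_eqI) (simp only: coord_simps add.commute)
  show "0 + x = x" by (rule ell2_eqI) (simp only: coord_simps add_0_left)
  show "- x + x = 0" by (rule ell2_eqI) (simp only: coord_simps left_minus)
  show "x - y = x + - y" by (fact minus_ell2_def)
  show "r *\<^sub>R (x + y) = r *\<^sub>R x + r *\<^sub>R y"
    by (rule ell2_eqI) (simp only: coord_simps scaleR_add_right)
  show "(r + s) *\<^sub>R x = r *\<^sub>R x + s *\<^sub>R x"
    by (rule ell2_eqI) (simp only: coord_simps scaleR_add_left)
  show "r *\<^sub>R s *\<^sub>R x = (r * s) *\<^sub>R x"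
    by (rule ell2_eqI) (simp only: coord_simps scaleR_scaleR)
  show "1 *\<^sub>R x = x" by (rule ell2_eqI) (simp only: coord_simps scaleR_one)
qed

end

lemma summable_inner_coord: "summable (\<lambda>n. coord x n * cnj (coord y n))"
proof (rule summable_comparison_test[rotated])
  show "summable (\<lambda>n. (cmod (coord x n))\<^sup>2 + (cmod (coord y n))\<^sup>2)"
    by (intro summable_add summable_coord)
  have "p * q \<le> p\<^sup>2 + q\<^sup>2" if "0 \<le> p" "0 \<le> q" for p q :: real
    using sum_squares_bound[of p q] mult_nonneg_nonneg[OF that] by linarith
  then have "norm (coord x n * cnj (coord y n)) \<le> (cmod (coord x n))\<^sup>2 + (cmod (coord y n))\<^sup>2" for n
    by (simp only: norm_mult complex_mod_cnj norm_ge_zero)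
  then show "\<exists>N. \<forall>n\<ge>N. norm (coord x n * cnj (coord y n))
      \<le> (cmod (coord x n))\<^sup>2 + (cmod (coord y n))\<^sup>2"
    by blast
qed

instantiation ell2 :: real_inner
begin

definition inner_ell2 :: "ell2 \<Rightarrow> ell2 \<Rightarrow> real" where
  "inner_ell2 x y = Re (\<Sum>n. coord x n * cnj (coord y n))"
definition norm_ell2 :: "ell2 \<Rightarrow> real" where
  "norm_ell2 x = sqrt (\<Sum>n. (cmod (coord x n))\<^sup>2)"
definition dist_ell2 :: "ell2 \<Rightarrow> ell2 \<Rightarrow> real" where
  "dist_ell2 x y = norm (x - y)"
definition sgn_ell2 :: "ell2 \<Rightarrow> ell2" where
  "sgn_ell2 x = inverse (norm x) *\<^sub>R x"
definition uniformity_ell2 :: "(ell2 \<times> ell2) filter" where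
  "uniformity_ell2 = (INF e\<in>{0 <..}. principal {(x, y). dist x y < e})"
definition open_ell2 :: "ell2 set \<Rightarrow> bool" where
  "open_ell2 U = (\<forall>x\<in>U. eventually (\<lambda>(x', y). x' = x \<longrightarrow> y \<in> U) uniformity)"

lemma inner_ell2_suminf: "inner x y = (\<Sum>n. Re (coord x n * cnj (coord y n)))" for x y :: ell2
  unfolding inner_ell2_def by (rule Re_suminf[OF summable_inner_coord])

lemma summable_Re_inner: "summable (\<lambda>n. Re (coord x n * cnj (coord y n)))"
  by (rule summable_Re[OF summable_inner_coord])

lemma inner_self_ell2: "inner x x = (\<Sum>n. (cmod (coord x n))\<^sup>2)" for x :: ell2
  unfolding inner_ell2_suminf
  by (intro suminf_cong) (simp only: cmod_power2, simp add: power2_eq_square)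

instance
proof
  fix x y z :: ell2 and r :: real
  show "inner x y = inner y x"
    unfolding inner_ell2_suminf by (intro suminf_cong) (simp add: algebra_simps)
  show "inner (x + y) z = inner x z + inner y z"
    unfolding inner_ell2_suminf
    by (subst suminf_add[OF summable_Re_inner summable_Re_inner], intro suminf_cong)
      (simp add: distrib_right)
  show "inner (r *\<^sub>R x) y = r * inner x y"
    unfolding inner_ell2_suminf
    by (subst suminf_mult[OF summable_Re_inner, symmetric], intro suminf_cong)
      (simp add: right_diff_distrib)
  show "0 \<le> inner x x"
    unfolding inner_self_ell2 by (intro suminf_nonneg summable_coord) simp
  show "inner x x = 0 \<longleftrightarrow> x = 0"
  proof
    assume "inner x x = 0"
    then have "(\<Sum>n. (cmod (coord x n))\<^sup>2) = 0" by (simp only: inner_self_ell2)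
    then have "\<forall>n. (cmod (coord x n))\<^sup>2 = 0"
      by (rule iffD1[OF suminf_eq_zero_iff[OF summable_coord zero_le_power2]])
    then show "x = 0" by (intro ell2_eqI) (simp only: coord_simps power_eq_0_iff norm_eq_zero)
  next
    assume "x = 0"
    then show "inner x x = 0" by (simp add: inner_self_ell2)
  qed
  show "norm x = sqrt (inner x x)"
    unfolding norm_ell2_def inner_self_ell2 ..
  show "dist x y = norm (x - y)" by (fact dist_ell2_def)
  show "sgn x = inverse (norm x) *\<^sub>R x" by (fact sgn_ell2_def)
next
  show "uniformity = (INF e\<in>{0 <..}. principal {(x :: ell2, y). dist x y < e})"
    by (fact uniformity_ell2_def)
next
  fix U :: "ell2 set"
  show "open U = (\<forall>x\<in>U. eventually (\<lambda>(x', y). x' = x \<longrightarrow> y \<in> U) uniformity)"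
    by (fact open_ell2_def)
qed

end

lemma norm_ell2_sq: "(norm x)\<^sup>2 = (\<Sum>n. (cmod (coord x n))\<^sup>2)" for x :: ell2
  by (simp add: norm_ell2_def suminf_nonneg summable_coord)

lemma partial_sum_le_norm_ell2: "(\<Sum>n<N. (cmod (coord x n))\<^sup>2) \<le> (norm x)\<^sup>2" for x :: ell2
  unfolding norm_ell2_sq by (intro sum_le_suminf summable_coord) auto

lemma cmod_coord_le: "cmod (coord x n) \<le> norm x"
proof (rule power2_le_imp_le)
  have "(cmod (coord x n))\<^sup>2 \<le> (\<Sum>m<Suc n. (cmod (coord x m))\<^sup>2)"
    by (simp add: sum_nonneg)
  also have "\<dots> \<le> (norm x)\<^sup>2" by (rule partial_sum_le_norm_ell2)
  finally show "(cmod (coord x n))\<^sup>2 \<le> (norm x)\<^sup>2" .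
qed simp

lemma norm_ell2_leI:
  assumes "\<And>N. (\<Sum>n<N. (cmod (coord x n))\<^sup>2) \<le> e\<^sup>2" "0 \<le> e"
  shows "norm x \<le> e"
proof (rule power2_le_imp_le)
  show "(norm x)\<^sup>2 \<le> e\<^sup>2"
    unfolding norm_ell2_sq by (intro suminf_le_const summable_coord assms(1))
qed fact

instance ell2 :: complete_space
proof
  fix X :: "nat \<Rightarrow> ell2"
  assume C: "Cauchy X"
  have "Cauchy (\<lambda>m. coord (X m) n)" for n
  proof (rule metric_CauchyI)
    fix e :: real assume "0 < e"
    then obtain M where "\<forall>m\<ge>M. \<forall>p\<ge>M. dist (X m) (X p) < e"
      using C by (auto simp: Cauchy_def)
    moreover have "dist (coord (X m) n) (coord (X p) n) \<le> dist (X m) (X p)" for m p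
      using cmod_coord_le[of "X m - X p" n] by (simp add: dist_norm)
    ultimately show "\<exists>M. \<forall>m\<ge>M. \<forall>p\<ge>M. dist (coord (X m) n) (coord (X p) n) < e"
      by (meson le_less_trans)
  qed
  then have "\<exists>l. (\<lambda>m. coord (X m) n) \<longlonglongrightarrow> l" for n
    by (simp add: Cauchy_convergent_iff convergent_def)
  then obtain L where L: "\<And>n. (\<lambda>m. coord (X m) n) \<longlonglongrightarrow> L n"
    by metis
  have tail: "\<exists>M. \<forall>m\<ge>M. \<forall>N. (\<Sum>n<N. (cmod (coord (X m) n - L n))\<^sup>2) \<le> e\<^sup>2"
    if e: "0 < e" for e :: real
  proof -
    obtain M where M: "\<And>m p. m \<ge> M \<Longrightarrow> p \<ge> M \<Longrightarrow> norm (X m - X p) < e"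
      using C e unfolding Cauchy_def dist_norm by meson
    show ?thesis
    proof (intro exI[of _ M] allI impI)
      fix m N assume m: "M \<le> m"
      have "(\<lambda>p. \<Sum>n<N. (cmod (coord (X m) n - coord (X p) n))\<^sup>2)
          \<longlonglongrightarrow> (\<Sum>n<N. (cmod (coord (X m) n - L n))\<^sup>2)"
        by (intro tendsto_intros L)
      moreover have "(\<Sum>n<N. (cmod (coord (X m) n - coord (X p) n))\<^sup>2) \<le> e\<^sup>2" if "M \<le> p" for p
      proof -
        have "(\<Sum>n<N. (cmod (coord (X m) n - coord (X p) n))\<^sup>2) \<le> (norm (X m - X p))\<^sup>2"
          using partial_sum_le_norm_ell2[of "X m - X p" N] by simp
        also have "\<dots> \<le> e\<^sup>2"
          using M[OF m that] by (intro power_mono) auto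
        finally show ?thesis .
      qed
      ultimately show "(\<Sum>n<N. (cmod (coord (X m) n - L n))\<^sup>2) \<le> e\<^sup>2"
        by (intro LIMSEQ_le_const2) auto
    qed
  qed
  have "L 0 = 0"
    using L[of 0] by (simp add: LIMSEQ_const_iff)
  obtain M where M: "\<And>N. (\<Sum>n<N. (cmod (coord (X M) n - L n))\<^sup>2) \<le> 1\<^sup>2"
    using tail[of 1] by auto
  have "summable (\<lambda>n. (cmod (coord (X M) n - L n))\<^sup>2)"
    by (rule bounded_imp_summable[of _ "1\<^sup>2"])
      (use M[of "Suc _"] in \<open>auto simp: lessThan_Suc_atMost\<close>)
  then have "(\<lambda>n. coord (X M) n - L n) \<in> ell2_seqs"
    using \<open>L 0 = 0\<close> by (simp add: ell2_seqs_def)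
  from ell2_seqs_add[OF coord[of "X M"] ell2_seqs_scaleR[OF this, of "-1"]]
  have "L \<in> ell2_seqs" by simp
  then have cL: "coord (Abs_ell2 L) = L" by (rule Abs_ell2_inverse)
  have "X \<longlonglongrightarrow> Abs_ell2 L"
  proof (rule LIMSEQ_I)
    fix r :: real assume "0 < r"
    then obtain M where M: "\<And>m N. m \<ge> M \<Longrightarrow> (\<Sum>n<N. (cmod (coord (X m) n - L n))\<^sup>2) \<le> (r/2)\<^sup>2"
      using tail[of "r/2"] by auto
    have "norm (X m - Abs_ell2 L) < r" if "m \<ge> M" for m
    proof -
      have "norm (X m - Abs_ell2 L) \<le> r/2"
        by (rule norm_ell2_leI) (use M[OF that] \<open>0 < r\<close> in \<open>auto simp: cL\<close>)
      with \<open>0 < r\<close> show ?thesis by simp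
    qed
    then show "\<exists>no. \<forall>n\<ge>no. norm (X n - Abs_ell2 L) < r" by blast
  qed
  then show "convergent X" by (rule convergentI)
qed

instance ell2 :: banach ..

lemma dense_sequence_imp_second_countable:
  fixes D :: "'a::metric_space set"
  assumes "countable D" and dense: "\<And>x e. 0 < e \<Longrightarrow> \<exists>d\<in>D. dist x d < e"
  shows "\<exists>B::'a set set. countable B \<and> open = generate_topology B"
proof -
  let ?B = "(\<lambda>(d, n). ball d (1 / real (Suc n))) ` (D \<times> (UNIV :: nat set))"
  have "topological_basis ?B"
  proof (rule topological_basisI)
    fix U :: "'a set" and x assume "open U" "x \<in> U"
    then obtain e where e: "0 < e" "ball x e \<subseteq> U" by (auto simp: open_contains_ball)
    obtain n where n: "1 / real (Suc n) < e / 2"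
      using e(1) nat_approx_posE[of "e/2"] by auto
    obtain d where d: "d \<in> D" "dist x d < 1 / real (Suc n)"
      using dense[of "1 / real (Suc n)" x] by auto
    have "ball d (1 / real (Suc n)) \<subseteq> ball x e"
    proof
      fix y assume "y \<in> ball d (1 / real (Suc n))"
      then have "dist x y < e"
        using d(2) n dist_triangle[of x y d] by simp
      then show "y \<in> ball x e" by simp
    qed
    moreover have "x \<in> ball d (1 / real (Suc n))"
      using d(2) by (simp add: dist_commute)
    ultimately show "\<exists>B'\<in>?B. x \<in> B' \<and> B' \<subseteq> U"
      using d(1) e(2) by force
  qed auto
  moreover have "countable ?B" using assms(1) by simp
  ultimately show ?thesis using topological_basis_imp_subbasis by blast
qed

lemma complex_rational_approx:
  assumes "0 < e"
  shows "\<exists>p q :: rat. cmod (z - Complex (of_rat p) (of_rat q)) < e"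
proof -
  obtain p where p: "Re z - e/2 < of_rat p" "of_rat p < Re z + e/2"
    using of_rat_dense[of "Re z - e/2" "Re z + e/2"] assms by auto
  obtain q where q: "Im z - e/2 < of_rat q" "of_rat q < Im z + e/2"
    using of_rat_dense[of "Im z - e/2" "Im z + e/2"] assms by auto
  have "cmod (z - Complex (of_rat p) (of_rat q)) \<le> \<bar>Re z - of_rat p\<bar> + \<bar>Im z - of_rat q\<bar>"
    using cmod_le[of "z - Complex (of_rat p) (of_rat q)"] by simp
  also have "\<dots> < e" using p q by linarith
  finally show ?thesis by blast
qed

instance ell2 :: second_countable_topology
proof
  define emb :: "(rat \<times> rat) list \<Rightarrow> ell2" where
    "emb l = Abs_ell2 (\<lambda>n. if 0 < n \<and> n < length l
       then Complex (of_rat (fst (l ! n))) (of_rat (snd (l ! n))) else 0)" for l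
  have coord_emb: "coord (emb l) n = (if 0 < n \<and> n < length l
       then Complex (of_rat (fst (l ! n))) (of_rat (snd (l ! n))) else 0)" for l n
  proof -
    have "summable (\<lambda>n. (cmod (if 0 < n \<and> n < length l
       then Complex (of_rat (fst (l ! n))) (of_rat (snd (l ! n))) else 0))\<^sup>2)"
      by (rule summable_finite[of "{..<length l}"]) auto
    then show ?thesis
      unfolding emb_def by (subst Abs_ell2_inverse) (auto simp: ell2_seqs_def)
  qed
  have "\<exists>d\<in>range emb. dist x d < e" if e: "0 < e" for x e
  proof -
    have "(\<lambda>N. \<Sum>n<N. (cmod (coord x n))\<^sup>2) \<longlonglongrightarrow> (norm x)\<^sup>2"
      unfolding norm_ell2_sq by (rule summable_LIMSEQ[OF summable_coord])
    then obtain N where N: "\<And>M. M \<ge> N \<Longrightarrow> \<bar>(\<Sum>n<M. (cmod (coord x n))\<^sup>2) - (norm x)\<^sup>2\<bar> < e\<^sup>2/8"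
      using e unfolding LIMSEQ_iff by (metis divide_pos_pos zero_less_numeral real_norm_def
        zero_less_power)
    define \<delta> where "\<delta> = sqrt (e\<^sup>2 / (8 * real (Suc N)))"
    have \<delta>: "0 < \<delta>" "\<delta>\<^sup>2 = e\<^sup>2 / (8 * real (Suc N))" using e by (auto simp: \<delta>_def)
    obtain p q :: "nat \<Rightarrow> rat"
      where pq: "\<And>n. cmod (coord x n - Complex (of_rat (p n)) (of_rat (q n))) < \<delta>"
    proof -
      have "\<forall>n. \<exists>s :: rat \<times> rat. cmod (coord x n - Complex (of_rat (fst s)) (of_rat (snd s))) < \<delta>"
        using complex_rational_approx[OF \<delta>(1)] by fastforce
      then obtain s :: "nat \<Rightarrow> rat \<times> rat"
        where "\<And>n. cmod (coord x n - Complex (of_rat (fst (s n))) (of_rat (snd (s n)))) < \<delta>"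
        by metis
      then show thesis by (rule that[of "\<lambda>n. fst (s n)" "\<lambda>n. snd (s n)"])
    qed
    define l where "l = map (\<lambda>n. (p n, q n)) [0..<N]"
    have c: "coord (emb l) n = (if 0 < n \<and> n < N then Complex (of_rat (p n)) (of_rat (q n)) else 0)"
      for n by (simp add: coord_emb l_def)
    have "norm (x - emb l) \<le> e / 2"
    proof (rule norm_ell2_leI)
      fix M
      have "(\<Sum>n<M. (cmod (coord (x - emb l) n))\<^sup>2)
          \<le> (\<Sum>n<N + M. (cmod (coord (x - emb l) n))\<^sup>2)"
        by (rule sum_mono2) auto
      also have "\<dots> = (\<Sum>n<N. (cmod (coord (x - emb l) n))\<^sup>2)
          + (\<Sum>n\<in>{N..<N+M}. (cmod (coord (x - emb l) n))\<^sup>2)"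
        by (subst sum.union_disjoint[symmetric]) (auto intro!: sum.cong)
      also have "(\<Sum>n<N. (cmod (coord (x - emb l) n))\<^sup>2) \<le> (\<Sum>n<N. \<delta>\<^sup>2)"
      proof (rule sum_mono)
        fix n assume n: "n \<in> {..<N}"
        have "cmod (coord (x - emb l) n) \<le> \<delta>"
          using n pq[of n] \<delta>(1) by (cases "n = 0") (auto simp: c)
        then show "(cmod (coord (x - emb l) n))\<^sup>2 \<le> \<delta>\<^sup>2" by (intro power_mono) auto
      qed
      also have "(\<Sum>n<N. \<delta>\<^sup>2) \<le> e\<^sup>2 / 8"
        using e by (simp add: \<delta>(2) field_simps)
      also have "(\<Sum>n\<in>{N..<N+M}. (cmod (coord (x - emb l) n))\<^sup>2)
          = (\<Sum>n\<in>{N..<N+M}. (cmod (coord x n))\<^sup>2)"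
        by (intro sum.cong) (auto simp: c)
      also have "\<dots> = (\<Sum>n<N+M. (cmod (coord x n))\<^sup>2) - (\<Sum>n<N. (cmod (coord x n))\<^sup>2)"
        using sum.atLeastLessThan_concat[of 0 N "N + M" "\<lambda>n. (cmod (coord x n))\<^sup>2"]
        by (simp add: lessThan_atLeast0)
      also have "\<dots> \<le> e\<^sup>2 / 8"
        using N[of N] partial_sum_le_norm_ell2[of x "N + M"] by linarith
      finally show "(\<Sum>n<M. (cmod (coord (x - emb l) n))\<^sup>2) \<le> (e / 2)\<^sup>2"
        by (simp add: power_divide)
    qed (use e in simp)
    then have "dist x (emb l) < e" using e by (simp add: dist_norm)
    then show ?thesis by blast
  qed
  then show "\<exists>B::ell2 set set. countable B \<and> open = generate_topology B"
    by (intro dense_sequence_imp_second_countable[of "range emb"]) auto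
qed

instance ell2 :: polish_space ..

definition to_ell2 :: "(nat \<Rightarrow> complex) \<Rightarrow> ell2" where
  "to_ell2 x = (if x \<in> ell2_seqs then Abs_ell2 x else 0)"

lemma coord_to_ell2: "x \<in> ell2_seqs \<Longrightarrow> coord (to_ell2 x) = x"
  by (simp add: to_ell2_def Abs_ell2_inverse)


section \<open>The operators of the shell model\<close>

text \<open>
  The wave numbers enter as a function \<open>k\<close>. Formal expressions are first written as complex
  sequences; an element belongs to the domain of an operator if the sequence is square-summable.
\<close>

definition A_seq :: "(nat \<Rightarrow> real) \<Rightarrow> ell2 \<Rightarrow> nat \<Rightarrow> complex" where
  "A_seq k u n = complex_of_real ((k n)\<^sup>2) * coord u n"

definition dom_A :: "(nat \<Rightarrow> real) \<Rightarrow> ell2 set" where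
  "dom_A k = {u. A_seq k u \<in> ell2_seqs}"

definition A_op :: "(nat \<Rightarrow> real) \<Rightarrow> ell2 \<Rightarrow> ell2" where
  "A_op k u = to_ell2 (A_seq k u)"

text \<open>The square root of \<open>A\<close>: since \<open>A\<close> is diagonal with entries \<open>(k n)\<^sup>2\<close> and \<open>k n > 0\<close>, it is
  diagonal with entries \<open>k n\<close>.\<close>

definition sqrtA_seq :: "(nat \<Rightarrow> real) \<Rightarrow> ell2 \<Rightarrow> nat \<Rightarrow> complex" where
  "sqrtA_seq k u n = complex_of_real (k n) * coord u n"

definition V_space :: "(nat \<Rightarrow> real) \<Rightarrow> ell2 set" where
  "V_space k = {u. sqrtA_seq k u \<in> ell2_seqs}"

definition sqrtA_op :: "(nat \<Rightarrow> real) \<Rightarrow> ell2 \<Rightarrow> ell2" where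
  "sqrtA_op k u = to_ell2 (sqrtA_seq k u)"

definition B_seq :: "(nat \<Rightarrow> real) \<Rightarrow> real \<Rightarrow> real \<Rightarrow> ell2 \<Rightarrow> ell2 \<Rightarrow> nat \<Rightarrow> complex" where
  "B_seq k a b u v n = (if n = 0 then 0 else
     - \<i> * (of_real (a * k (n + 1)) * coord v (n + 2) * cnj (coord u (n + 1))
          + of_real (b * k n) * coord v (n + 1) * cnj (coord u (n - 1))
          + of_real (a * k (n - 1)) * coord u (n - 1) * coord v (n - 2)
          + of_real (b * k (n - 1)) * coord v (n - 1) * coord u (n - 2)))"

text \<open>\<open>B_seq k a b u v\<close> is square-summable as soon as one of \<open>u\<close>, \<open>v\<close> lies in \<open>V_space k\<close>.\<close>

definition B_op :: "(nat \<Rightarrow> real) \<Rightarrow> real \<Rightarrow> real \<Rightarrow> ell2 \<Rightarrow> ell2 \<Rightarrow> ell2" where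
  "B_op k a b u v = to_ell2 (B_seq k a b u v)"

text \<open>The linearization at \<open>ue\<close>, with domain \<open>dom_A k\<close>.\<close>

definition lin_seq ::
  "(nat \<Rightarrow> real) \<Rightarrow> real \<Rightarrow> real \<Rightarrow> real \<Rightarrow> ell2 \<Rightarrow> ell2 \<Rightarrow> nat \<Rightarrow> complex" where
  "lin_seq k \<nu> a b ue u n = of_real \<nu> * A_seq k u n + B_seq k a b u ue n + B_seq k a b ue u n"

definition lin_op ::
  "(nat \<Rightarrow> real) \<Rightarrow> real \<Rightarrow> real \<Rightarrow> real \<Rightarrow> ell2 \<Rightarrow> ell2 \<Rightarrow> ell2" where
  "lin_op k \<nu> a b ue u = to_ell2 (lin_seq k \<nu> a b ue u)"

text \<open>The closed loop operator \<open>u \<mapsto> \<A>u + Ku\<close> for a feedback \<open>K\<close>, with its maximal domain.\<close>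

definition closed_loop_seq ::
  "(nat \<Rightarrow> real) \<Rightarrow> real \<Rightarrow> real \<Rightarrow> real \<Rightarrow> ell2 \<Rightarrow> (ell2 \<Rightarrow> ell2) \<Rightarrow> ell2 \<Rightarrow> nat \<Rightarrow> complex" where
  "closed_loop_seq k \<nu> a b ue K u n = lin_seq k \<nu> a b ue u n + coord (K u) n"

definition closed_loop_dom ::
  "(nat \<Rightarrow> real) \<Rightarrow> real \<Rightarrow> real \<Rightarrow> real \<Rightarrow> ell2 \<Rightarrow> (ell2 \<Rightarrow> ell2) \<Rightarrow> ell2 set" where
  "closed_loop_dom k \<nu> a b ue K = {u. closed_loop_seq k \<nu> a b ue K u \<in> ell2_seqs}"

definition closed_loop_op ::
  "(nat \<Rightarrow> real) \<Rightarrow> real \<Rightarrow> real \<Rightarrow> real \<Rightarrow> ell2 \<Rightarrow> (ell2 \<Rightarrow> ell2) \<Rightarrow> ell2 \<Rightarrow> ell2" where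
  "closed_loop_op k \<nu> a b ue K u = to_ell2 (closed_loop_seq k \<nu> a b ue K u)"


section \<open>Adjoints of densely defined operators and evolution equations\<close>

definition adj_dom :: "'a::real_inner set \<Rightarrow> ('a \<Rightarrow> 'a) \<Rightarrow> 'a set" where
  "adj_dom D T = {v. \<exists>z. \<forall>u\<in>D. inner (T u) v = inner u z}"

definition adj_op :: "'a::real_inner set \<Rightarrow> ('a \<Rightarrow> 'a) \<Rightarrow> 'a \<Rightarrow> 'a" where
  "adj_op D T v = (THE z. \<forall>u\<in>D. inner (T u) v = inner u z)"

text \<open>
  \<open>du/dt + T u = g\<close>, \<open>u(0) = u0\<close> on \<open>[0,\<infinity>)\<close>, where \<open>(D, T)\<close> is closed and densely defined: the
  equation, integrated in time, is tested against the domain of the adjoint. If \<open>-T\<close> generates a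
  \<open>C\<^sub>0\<close>-semigroup, these are exactly the mild solutions given by the variation of constants formula
  (J. M. Ball, 1977).
\<close>

definition evolution_solution ::
  "ell2 set \<Rightarrow> (ell2 \<Rightarrow> ell2) \<Rightarrow> (real \<Rightarrow> ell2) \<Rightarrow> ell2 \<Rightarrow> (real \<Rightarrow> ell2) \<Rightarrow> bool" where
  "evolution_solution D T g u0 u \<longleftrightarrow>
     continuous_on {0..} u \<and> u 0 = u0 \<and>
     (\<forall>t\<ge>0. set_integrable lborel {0..t} g) \<and>
     (\<forall>v\<in>adj_dom D T. \<forall>t\<ge>0.
        inner (u t) v - inner u0 v + (LBINT s:{0..t}. inner (u s) (adj_op D T v))
          = (LBINT s:{0..t}. inner (g s) v))"

text \<open>\<open>-dr/dt + T\<^sup>* r = g\<close>, \<open>r(\<infinity>) = 0\<close>, tested against \<open>D = D(T\<^sup>*\<^sup>*)\<close>.\<close>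

definition adjoint_solution ::
  "ell2 set \<Rightarrow> (ell2 \<Rightarrow> ell2) \<Rightarrow> (real \<Rightarrow> ell2) \<Rightarrow> (real \<Rightarrow> ell2) \<Rightarrow> bool" where
  "adjoint_solution D T g r \<longleftrightarrow>
     continuous_on {0..} r \<and> (r \<longlongrightarrow> 0) at_top \<and>
     (\<forall>t\<ge>0. set_integrable lborel {0..t} g) \<and>
     (\<forall>v\<in>D. \<forall>t\<ge>0.
        inner (r 0) v - inner (r t) v + (LBINT s:{0..t}. inner (r s) (T v))
          = (LBINT s:{0..t}. inner (g s) v))"


section \<open>Function spaces on the half line\<close>

abbreviation half_line :: "real measure" where
  "half_line \<equiv> restrict_space lborel {0..}"

definition L2_H :: "(real \<Rightarrow> ell2) set" where
  "L2_H = {w. w \<in> borel_measurable half_line \<and> integrable half_line (\<lambda>t. (norm (w t))\<^sup>2)}"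

definition L2_norm :: "(real \<Rightarrow> ell2) \<Rightarrow> real" where
  "L2_norm w = sqrt (\<integral>t. (norm (w t))\<^sup>2 \<partial>half_line)"

text \<open>\<open>L\<^sup>2(0,\<infinity>;V)\<close> for \<open>V = D(A\<^bsup>1/2\<^esup>)\<close> normed by \<open>\<parallel>u\<parallel> = |A\<^bsup>1/2\<^esup>u|\<close>. Values outside \<open>V\<close> on a null set
  are harmless since \<open>sqrtA_op\<close> is \<open>0\<close> there.\<close>

definition L2_V :: "(nat \<Rightarrow> real) \<Rightarrow> (real \<Rightarrow> ell2) set" where
  "L2_V k = {u. u \<in> borel_measurable half_line \<and> (AE t in half_line. u t \<in> V_space k) \<and>
     (\<lambda>t. sqrtA_op k (u t)) \<in> L2_H}"

definition L2_V_norm :: "(nat \<Rightarrow> real) \<Rightarrow> (real \<Rightarrow> ell2) \<Rightarrow> real" where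
  "L2_V_norm k u = L2_norm (\<lambda>t. sqrtA_op k (u t))"

definition Linf_norm :: "(real \<Rightarrow> ell2) \<Rightarrow> ereal" where
  "Linf_norm u = esssup half_line (\<lambda>t. ereal (norm (u t)))"

definition Linf_H :: "(real \<Rightarrow> ell2) set" where
  "Linf_H = {u. u \<in> borel_measurable half_line \<and> Linf_norm u < \<infinity>}"

text \<open>Continuity on the compactified half line \<open>[0,\<infinity>]\<close>: the limit at infinity exists.\<close>

definition C_H :: "(real \<Rightarrow> ell2) set" where
  "C_H = {u. continuous_on {0..} u \<and> (\<exists>l. (u \<longlongrightarrow> l) at_top)}"

definition Sigma_set :: "(nat \<Rightarrow> real) \<Rightarrow> real \<Rightarrow> (real \<Rightarrow> ell2) set" where
  "Sigma_set k \<kappa> = {u \<in> Linf_H \<inter> L2_V k. Linf_norm u \<le> ereal \<kappa> \<and> L2_V_norm k u \<le> \<kappa>}"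


section \<open>The linear-quadratic differential game\<close>

text \<open>The dynamics is \<open>du/dt + T u = B1 U + B2 w\<close>, \<open>u(0) = u0\<close>. The cost is \<open>\<infinity>\<close> if the state is not
  square-integrable in time.\<close>

definition energy :: "(real \<Rightarrow> ell2) \<Rightarrow> ereal" where
  "energy u = enn2ereal (\<integral>\<^sup>+ t. ennreal ((norm (u t))\<^sup>2) \<partial>half_line)"

definition cost ::
  "real \<Rightarrow> (real \<Rightarrow> ell2) \<Rightarrow> (real \<Rightarrow> ell2) \<Rightarrow> (real \<Rightarrow> ell2) \<Rightarrow> ereal" where
  "cost \<gamma> u U w =
     ereal (1/2) * energy u + ereal (1/2) * energy U - ereal (\<gamma>/2) * energy w"

definition admissible_pairs ::
  "ell2 set \<Rightarrow> (ell2 \<Rightarrow> ell2) \<Rightarrow> (ell2 \<Rightarrow> ell2) \<Rightarrow> (ell2 \<Rightarrow> ell2) \<Rightarrow> ell2 \<Rightarrow> (real \<Rightarrow> ell2)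
     \<Rightarrow> ((real \<Rightarrow> ell2) \<times> (real \<Rightarrow> ell2)) set" where
  "admissible_pairs D T B1 B2 u0 w =
     {(u, U). U \<in> L2_H \<and> evolution_solution D T (\<lambda>t. B1 (U t) + B2 (w t)) u0 u}"

definition lower_value ::
  "ell2 set \<Rightarrow> (ell2 \<Rightarrow> ell2) \<Rightarrow> (ell2 \<Rightarrow> ell2) \<Rightarrow> (ell2 \<Rightarrow> ell2) \<Rightarrow> real
     \<Rightarrow> ell2 \<Rightarrow> (real \<Rightarrow> ell2) \<Rightarrow> ereal" where
  "lower_value D T B1 B2 \<gamma> u0 w = (INF (u, U)\<in>admissible_pairs D T B1 B2 u0 w. cost \<gamma> u U w)"

definition game_value ::
  "ell2 set \<Rightarrow> (ell2 \<Rightarrow> ell2) \<Rightarrow> (ell2 \<Rightarrow> ell2) \<Rightarrow> (ell2 \<Rightarrow> ell2) \<Rightarrow> real \<Rightarrow> ell2 \<Rightarrow> ereal" where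
  "game_value D T B1 B2 \<gamma> u0 = (SUP w\<in>L2_H. lower_value D T B1 B2 \<gamma> u0 w)"

definition worst_disturbance ::
  "ell2 set \<Rightarrow> (ell2 \<Rightarrow> ell2) \<Rightarrow> (ell2 \<Rightarrow> ell2) \<Rightarrow> (ell2 \<Rightarrow> ell2) \<Rightarrow> real
     \<Rightarrow> ell2 \<Rightarrow> (real \<Rightarrow> ell2) \<Rightarrow> bool" where
  "worst_disturbance D T B1 B2 \<gamma> u0 w \<longleftrightarrow>
     w \<in> L2_H \<and> lower_value D T B1 B2 \<gamma> u0 w = game_value D T B1 B2 \<gamma> u0"

definition optimal_state ::
  "ell2 set \<Rightarrow> (ell2 \<Rightarrow> ell2) \<Rightarrow> (ell2 \<Rightarrow> ell2) \<Rightarrow> (ell2 \<Rightarrow> ell2) \<Rightarrow> real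
     \<Rightarrow> ell2 \<Rightarrow> (real \<Rightarrow> ell2) \<Rightarrow> (real \<Rightarrow> ell2) \<Rightarrow> bool" where
  "optimal_state D T B1 B2 \<gamma> u0 w u \<longleftrightarrow>
     (\<exists>U. (u, U) \<in> admissible_pairs D T B1 B2 u0 w \<and>
          cost \<gamma> u U w = lower_value D T B1 B2 \<gamma> u0 w)"

text \<open>Elements of \<open>L\<^sup>2(0,\<infinity>;H)\<close> are represented by functions, so uniqueness of the maximizer is up
  to null sets.\<close>

definition game_threshold ::
  "ell2 set \<Rightarrow> (ell2 \<Rightarrow> ell2) \<Rightarrow> (ell2 \<Rightarrow> ell2) \<Rightarrow> (ell2 \<Rightarrow> ell2) \<Rightarrow> real \<Rightarrow> bool" where
  "game_threshold D T B1 B2 \<gamma>\<^sub>0 \<longleftrightarrow>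
     0 < \<gamma>\<^sub>0 \<and>
     (\<forall>\<gamma>>\<gamma>\<^sub>0. \<forall>u0. \<exists>w. worst_disturbance D T B1 B2 \<gamma> u0 w \<and>
        (\<forall>w'. worst_disturbance D T B1 B2 \<gamma> u0 w' \<longrightarrow> (AE t in half_line. w' t = w t))) \<and>
     (\<forall>\<gamma>. 0 < \<gamma> \<and> \<gamma> < \<gamma>\<^sub>0 \<longrightarrow> (\<forall>u0. game_value D T B1 B2 \<gamma> u0 = \<infinity>))"

text \<open>
  The feedback operator \<open>R u0 = r(0)\<close> with its standing properties. If \<open>T\<close> has unstable modes, the
  backward equation with \<open>r(\<infinity>) = 0\<close> alone does not determine \<open>r\<close>: solutions of \<open>dr/dt = T\<^sup>* r\<close>
  that decay at infinity may be added. The value identity together with symmetry pins down \<open>R\<close>.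
\<close>

definition riccati_feedback ::
  "ell2 set \<Rightarrow> (ell2 \<Rightarrow> ell2) \<Rightarrow> (ell2 \<Rightarrow> ell2) \<Rightarrow> (ell2 \<Rightarrow> ell2) \<Rightarrow> real
     \<Rightarrow> (ell2 \<Rightarrow> ell2) \<Rightarrow> bool" where
  "riccati_feedback D T B1 B2 \<gamma> R \<longleftrightarrow>
     bounded_linear R \<and>
     (\<forall>u0. \<exists>w u r. worst_disturbance D T B1 B2 \<gamma> u0 w \<and> optimal_state D T B1 B2 \<gamma> u0 w u \<and>
        adjoint_solution D T u r \<and> R u0 = r 0) \<and>
     (\<forall>u0. game_value D T B1 B2 \<gamma> u0 = ereal (1/2 * inner u0 (R u0))) \<and>
     (\<forall>u v. inner (R u) v = inner u (R v)) \<and>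
     (\<forall>u. 0 \<le> inner u (R u)) \<and>
     (\<forall>u\<in>D. R u \<in> adj_dom D T \<and>
        adj_op D T (R u) + R (T u) + R (B1 (adjoint B1 (R u)))
          - (1/\<gamma>) *\<^sub>R R (B2 (adjoint B2 (R u))) - u = 0)"


section \<open>The nonlinear closed loop system\<close>

text \<open>\<open>du/dt + \<A>\<^sub>R u + B(u) = B2 w\<close>, \<open>u(0) = u0\<close>, in the class \<open>C([0,\<infinity>];H) \<inter> L\<^sup>2(0,\<infinity>;V)\<close>, where
  \<open>\<A>\<^sub>R = \<A> + B1 B1\<^sup>* R\<close>.\<close>

definition nonlinear_solution ::
  "(nat \<Rightarrow> real) \<Rightarrow> real \<Rightarrow> real \<Rightarrow> real \<Rightarrow> ell2 \<Rightarrow> (ell2 \<Rightarrow> ell2) \<Rightarrow> (ell2 \<Rightarrow> ell2)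
     \<Rightarrow> (ell2 \<Rightarrow> ell2) \<Rightarrow> ell2 \<Rightarrow> (real \<Rightarrow> ell2) \<Rightarrow> (real \<Rightarrow> ell2) \<Rightarrow> bool" where
  "nonlinear_solution k \<nu> a b ue B1 B2 R u0 w u \<longleftrightarrow>
     u \<in> C_H \<inter> L2_V k \<and>
     (let K = (\<lambda>x. B1 (adjoint B1 (R x)))
      in evolution_solution (closed_loop_dom k \<nu> a b ue K) (closed_loop_op k \<nu> a b ue K)
           (\<lambda>t. B2 (w t) - B_op k a b (u t) (u t)) u0 u)"

end

theory Submission
  imports Defs
begin

text \<open>
  Each component of \<open>B(u,v)\<close> couples indices at distance at most two, and
  \<open>k\<^bsub>n+1\<^esub> / k\<^sub>n\<close> is the constant \<open>lam\<close>. The factor \<open>k\<^sub>n\<close> can therefore be absorbed by either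
  argument: \<open>|B(u,v)|\<close> is at most a constant times \<open>|u| |A\<^bsup>1/2\<^esup>v|\<close>, and also times
  \<open>|A\<^bsup>1/2\<^esup>u| |v|\<close> (\<open>B_op_bound_right\<close>, \<open>B_op_bound_left\<close>). As \<open>u\<^sub>e \<in> D(A)\<close>, the closed loop operator is
  \<open>\<nu>A + M\<close> on \<open>D(A)\<close>, where \<open>Mu = B(u,u\<^sub>e) + B(u\<^sub>e,u) + B\<^sub>1B\<^sub>1\<^sup>*Ru\<close> is bounded on \<open>H\<close>
  (\<open>closed_loop_eq\<close>).

  Stability is contained in the Riccati equation: pairing it with \<open>x \<in> D(A)\<close> gives
  \<open>2 (Rx, (\<nu>A + M)x) = |x|\<^sup>2 + |B\<^sub>1\<^sup>*Rx|\<^sup>2 + |B\<^sub>2\<^sup>*Rx|\<^sup>2 / \<gamma> \<ge> |x|\<^sup>2\<close>, so \<open>(u,Ru)\<close> is a Lyapunov functional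
  (\<open>riccati_imp_lyapunov\<close>). For \<open>u' + (\<nu>A + M)u = g\<close> it bounds \<open>\<integral>|u|\<^sup>2\<close> by \<open>|u\<^sub>0|\<^sup>2 + \<integral>|g|\<^sup>2\<close> up to a
  constant, uniformly in time (\<open>lyapunov_integral\<close>). Since \<open>M\<close> is bounded, the energy identity
  for \<open>|u|\<^sup>2\<close> then bounds \<open>sup |u|\<^sup>2 + \<integral>|A\<^bsup>1/2\<^esup>u|\<^sup>2\<close> in the same way (\<open>linear_estimate\<close>).

  The linear equation is solved by Duhamel's formula for the explicit semigroup of
  \<open>-\<nu>A\<close> and Banach's fixed point theorem in an exponentially weighted supremum norm
  (\<open>linear_existence\<close>). For the nonlinear equation the map sending \<open>u\<close> to the solution with
  \<open>g = B\<^sub>2w - B(u)\<close> is considered on the set where \<open>sup |u|\<close> and the \<open>L\<^sup>2(0,\<infinity>;V)\<close> norm are at most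
  \<open>\<kappa>\<close>. By the two bounds on \<open>B\<close>, \<open>\<integral>|B(u,v)|\<^sup>2\<close> is at most a constant times \<open>sup |u|\<^sup>2 \<integral>|A\<^bsup>1/2\<^esup>v|\<^sup>2\<close>,
  which makes the map a contraction for small \<open>\<kappa>\<close> and data of size proportional to \<open>\<kappa>\<close>
  (\<open>small_data_existence\<close>). The energy identity also shows that \<open>|u(t)|\<^sup>2\<close> has a limit at infinity,
  which is \<open>0\<close> because \<open>|u|\<^sup>2\<close> is integrable (\<open>diffusion_solution_tendsto_0\<close>).

  Uniqueness holds among all solutions, large ones included: the difference \<open>d\<close> of two
  solutions satisfies \<open>|d(t)|\<^sup>2 \<le> \<integral>\<^sub>0\<^sup>t m|d|\<^sup>2\<close> with a locally integrable weight \<open>m\<close>, and Gronwall's lemma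
  applies (\<open>nonlinear_uniqueness\<close>).

  Throughout, a solution is handled through its truncations to finitely many components, which
  solve ordinary differential equations in integrated form
  (\<open>evolution_solution_iff_diffusion\<close>); identities are proved for the truncations and
  passed to the limit by dominated or monotone convergence.
\<close>

section \<open>Bochner integrals over bounded intervals\<close>

lemma set_integrable_bounded_linear:
  assumes "bounded_linear T" "set_integrable M A f"
  shows "set_integrable M A (\<lambda>x. T (f x))"
  using integrable_bounded_linear[OF assms(1) assms(2)[unfolded set_integrable_def]]
  by (simp add: set_integrable_def linear_simps[OF assms(1)])

lemma set_integral_bounded_linear:
  assumes "bounded_linear T" "set_integrable M A f"
  shows "(LINT x:A|M. T (f x)) = T (LINT x:A|M. f x)"
  using integral_bounded_linear[OF assms(1) assms(2)[unfolded set_integrable_def]]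
  by (simp add: set_lebesgue_integral_def linear_simps[OF assms(1)])

lemma set_integrable_bilinear_continuous:
  fixes u :: "real \<Rightarrow> 'a::{banach, second_countable_topology}"
    and h :: "real \<Rightarrow> 'b::{banach, second_countable_topology}"
    and pr :: "'a \<Rightarrow> 'b \<Rightarrow> 'c::{banach, second_countable_topology}"
  assumes pr: "bounded_bilinear pr" and u: "continuous_on {a..b} u"
    and h: "set_integrable lborel {a..b} h"
  shows "set_integrable lborel {a..b} (\<lambda>s. pr (u s) (h s))"
proof -
  interpret bounded_bilinear pr by fact
  obtain K where K: "\<And>x y. norm (pr x y) \<le> norm x * norm y * K" "K \<ge> 0"
    using nonneg_bounded by blast
  obtain C where C: "\<And>s. s \<in> {a..b} \<Longrightarrow> norm (u s) \<le> C"
    using compact_imp_bounded[OF compact_continuous_image[OF u compact_Icc]]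
    unfolding bounded_iff by (metis imageI)
  have mu: "(\<lambda>s. indicator {a..b} s *\<^sub>R u s) \<in> borel_measurable lborel"
    using borel_measurable_continuous_on_indicator[OF _ u] by simp
  have mh: "(\<lambda>s. indicator {a..b} s *\<^sub>R h s) \<in> borel_measurable lborel"
    using h unfolding set_integrable_def by auto
  have "(\<lambda>s. pr (indicator {a..b} s *\<^sub>R u s) (indicator {a..b} s *\<^sub>R h s)) \<in> borel_measurable lborel"
    by (rule borel_measurable_continuous_Pair[OF mu mh])
      (intro continuous_on continuous_intros)
  moreover have "(\<lambda>s. pr (indicator {a..b} s *\<^sub>R u s) (indicator {a..b} s *\<^sub>R h s))
     = (\<lambda>s. indicator {a..b} s *\<^sub>R pr (u s) (h s))"
    by (auto simp: indicator_def zero_left zero_right)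
  ultimately have m: "set_borel_measurable lborel {a..b} (\<lambda>s. pr (u s) (h s))"
    by (simp add: set_borel_measurable_def)
  have hn: "set_integrable lborel {a..b} (\<lambda>s. (\<bar>C\<bar> * K) * norm (h s))"
    using set_integrable_norm[OF h] by simp
  show ?thesis
  proof (rule set_integrable_bound[OF hn m], rule AE_I2, rule impI)
    fix s assume s: "s \<in> {a..b}"
    have "norm (pr (u s) (h s)) \<le> norm (u s) * norm (h s) * K" by (rule K)
    also have "\<dots> \<le> \<bar>C\<bar> * norm (h s) * K"
      using C[OF s] K(2) by (intro mult_right_mono) auto
    finally show "norm (pr (u s) (h s)) \<le> norm (\<bar>C\<bar> * K * norm (h s))"
      using K(2) by (simp add: abs_mult mult_ac)
  qed
qed

lemma tendsto_set_integral_dominated: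
  fixes f :: "nat \<Rightarrow> 'c \<Rightarrow> 'b::{banach, second_countable_topology}"
  assumes "\<And>i. set_integrable M A (f i)" "set_integrable M A g" "set_integrable M A w"
    and lim: "\<And>s. s \<in> A \<Longrightarrow> (\<lambda>i. f i s) \<longlonglongrightarrow> g s"
    and bound: "\<And>i s. s \<in> A \<Longrightarrow> norm (f i s) \<le> w s"
  shows "(\<lambda>i. LINT s:A|M. f i s) \<longlonglongrightarrow> (LINT s:A|M. g s)"
  unfolding set_lebesgue_integral_def
proof (rule integral_dominated_convergence)
  show "(\<lambda>x. indicat_real A x *\<^sub>R g x) \<in> borel_measurable M"
    and "\<And>i. (\<lambda>x. indicat_real A x *\<^sub>R f i x) \<in> borel_measurable M"
    and "integrable M (\<lambda>x. indicat_real A x *\<^sub>R w x)"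
    using assms unfolding set_integrable_def by auto
qed (use lim bound in \<open>auto simp: indicator_def intro!: AE_I2\<close>)

lemma integrable_pair_bilinear:
  fixes a :: "real \<Rightarrow> 'a::{banach, second_countable_topology}"
    and b :: "real \<Rightarrow> 'b::{banach, second_countable_topology}"
    and pr :: "'a \<Rightarrow> 'b \<Rightarrow> 'c::{banach, second_countable_topology}"
  assumes pr: "bounded_bilinear pr" and a: "integrable lborel a" and b: "integrable lborel b"
  shows "integrable (lborel \<Otimes>\<^sub>M lborel) (\<lambda>(s, r). pr (a s) (b r))"
proof -
  interpret bounded_bilinear pr by fact
  obtain K where K: "\<And>x y. norm (pr x y) \<le> norm x * norm y * K" "K \<ge> 0"
    using nonneg_bounded by blast
  have ma: "(\<lambda>p. a (fst p)) \<in> borel_measurable (lborel \<Otimes>\<^sub>M lborel)"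
    and mb: "(\<lambda>p. b (snd p)) \<in> borel_measurable (lborel \<Otimes>\<^sub>M lborel)"
    using a b by (auto intro!: measurable_compose[OF measurable_fst] measurable_compose[OF measurable_snd])
  have m: "(\<lambda>p. pr (a (fst p)) (b (snd p))) \<in> borel_measurable (lborel \<Otimes>\<^sub>M lborel)"
    by (rule borel_measurable_continuous_Pair[OF ma mb])
      (intro continuous_on continuous_intros)
  have "integrable (lborel \<Otimes>\<^sub>M lborel) (\<lambda>(s, r). norm (a s) * norm (b r))"
  proof (rule lborel_pair.Fubini_integrable)
    show "(\<lambda>(s, r). norm (a s) * norm (b r)) \<in> borel_measurable (lborel \<Otimes>\<^sub>M lborel)"
      unfolding split_beta' by (intro borel_measurable_times measurable_compose[OF ma borel_measurable_norm]
          measurable_compose[OF mb borel_measurable_norm])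
    show "integrable lborel (\<lambda>x. LINT y|lborel. norm (case (x, y) of (s, r) \<Rightarrow> norm (a s) * norm (b r)))"
      using a by (simp add: abs_mult)
    show "AE x in lborel. integrable lborel (\<lambda>y. case (x, y) of (s, r) \<Rightarrow> norm (a s) * norm (b r))"
      using b by simp
  qed
  then have "integrable (lborel \<Otimes>\<^sub>M lborel) (\<lambda>p. K * (norm (a (fst p)) * norm (b (snd p))))"
    by (simp add: split_beta')
  then have "integrable (lborel \<Otimes>\<^sub>M lborel) (\<lambda>p. pr (a (fst p)) (b (snd p)))"
    by (rule Bochner_Integration.integrable_bound[OF _ m])
      (use K in \<open>auto intro!: AE_I2 simp: mult_ac abs_mult\<close>)
  then show ?thesis by (simp add: split_beta')
qed

text \<open>
  Primitives of integrable functions need not be differentiable, so the product rule is proved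
  by Fubini's theorem: the square \<open>[0,t]\<^sup>2\<close> on which \<open>pr (f s) (g r)\<close> is integrated splits along the
  diagonal into two triangles, and each of them yields one of the two summands.
\<close>
lemma bilinear_integral_product_rule:
  fixes F f :: "real \<Rightarrow> 'a::{banach, second_countable_topology}"
    and G g :: "real \<Rightarrow> 'b::{banach, second_countable_topology}"
    and pr :: "'a \<Rightarrow> 'b \<Rightarrow> 'c::{banach, second_countable_topology}"
  assumes pr: "bounded_bilinear pr" and t: "0 \<le> t"
    and f: "set_integrable lborel {0..t} f" and g: "set_integrable lborel {0..t} g"
    and F: "\<And>s. 0 \<le> s \<Longrightarrow> s \<le> t \<Longrightarrow> F s = F 0 + (LBINT r:{0..s}. f r)"
    and G: "\<And>s. 0 \<le> s \<Longrightarrow> s \<le> t \<Longrightarrow> G s = G 0 + (LBINT r:{0..s}. g r)"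
  shows "set_integrable lborel {0..t} (\<lambda>s. pr (f s) (G s) + pr (F s) (g s))"
    and "pr (F t) (G t) = pr (F 0) (G 0) + (LBINT s:{0..t}. pr (f s) (G s) + pr (F s) (g s))"
proof -
  interpret bounded_bilinear pr by fact
  define a where "a s = indicator {0..t} s *\<^sub>R f s" for s
  define b where "b s = indicator {0..t} s *\<^sub>R g s" for s
  have ia: "integrable lborel a" and ib: "integrable lborel b"
    using f g unfolding set_integrable_def a_def b_def by auto
  have ia': "integrable lborel (\<lambda>s. indicator A s *\<^sub>R a s)"
    and ib': "integrable lborel (\<lambda>s. indicator A s *\<^sub>R b s)" if "A \<in> sets borel" for A
    using that ia ib by (auto intro: integrable_mult_indicator)
  define a1 where "a1 s = (LINT r|lborel. indicator {..s} r *\<^sub>R a r)" for s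
  define b1 where "b1 s = (LINT r|lborel. indicator {..s} r *\<^sub>R b r)" for s
  have Fa: "F s = F 0 + a1 s" if "0 \<le> s" "s \<le> t" for s
    unfolding F[OF that] a1_def set_lebesgue_integral_def a_def
    using that by (intro arg_cong2[of _ _ _ _ "(+)"] refl Bochner_Integration.integral_cong)
      (auto simp: indicator_def)
  have Gb: "G s = G 0 + b1 s" if "0 \<le> s" "s \<le> t" for s
    unfolding G[OF that] b1_def set_lebesgue_integral_def b_def
    using that by (intro arg_cong2[of _ _ _ _ "(+)"] refl Bochner_Integration.integral_cong)
      (auto simp: indicator_def)
  have at: "a1 t = (LINT r|lborel. a r)" and bt: "b1 t = (LINT r|lborel. b r)"
    unfolding a1_def b1_def
    by (auto intro!: Bochner_Integration.integral_cong simp: a_def b_def indicator_def)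
  let ?P = "\<lambda>s r. pr (a s) (b r)"
  have P: "integrable (lborel \<Otimes>\<^sub>M lborel) (\<lambda>(s, r). ?P s r)"
    by (rule integrable_pair_bilinear[OF pr ia ib])
  have meas: "{p \<in> space (lborel \<Otimes>\<^sub>M lborel). snd p \<le> fst p} \<in> sets (lborel \<Otimes>\<^sub>M (lborel :: real measure))"
      "{p \<in> space (lborel \<Otimes>\<^sub>M lborel). fst p < snd p} \<in> sets (lborel \<Otimes>\<^sub>M (lborel :: real measure))"
    by measurable
  have P1: "integrable (lborel \<Otimes>\<^sub>M lborel) (\<lambda>(s, r). indicator {..s} r *\<^sub>R ?P s r)"
    using integrable_mult_indicator[OF meas(1) P]
    by (rule Bochner_Integration.integrable_cong[THEN iffD1, rotated -1])
      (auto simp: space_pair_measure indicator_def)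
  have P2: "integrable (lborel \<Otimes>\<^sub>M lborel) (\<lambda>(s, r). indicator {..<r} s *\<^sub>R ?P s r)"
    using integrable_mult_indicator[OF meas(2) P]
    by (rule Bochner_Integration.integrable_cong[THEN iffD1, rotated -1])
      (auto simp: space_pair_measure indicator_def)
  have in1: "(LINT r|lborel. indicator {..s} r *\<^sub>R ?P s r) = pr (a s) (b1 s)" for s
    unfolding b1_def using integral_bounded_linear[OF bounded_linear_right ib'[of "{..s}"], of "a s"]
    by (simp add: scaleR_right)
  have in2: "(LINT s|lborel. indicator {..<r} s *\<^sub>R ?P s r) = pr (a1 r) (b r)" for r
  proof -
    have "(LINT s|lborel. indicator {..<r} s *\<^sub>R ?P s r) = pr (LINT s|lborel. indicator {..<r} s *\<^sub>R a s) (b r)"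
      using integral_bounded_linear[OF bounded_linear_left ia'[of "{..<r}"], of "b r"]
      by (simp add: scaleR_left)
    also have "(LINT s|lborel. indicator {..<r} s *\<^sub>R a s) = a1 r"
      unfolding a1_def
    proof (rule integral_cong_AE)
      show "AE s in lborel. indicator {..<r} s *\<^sub>R a s = indicator {..r} s *\<^sub>R a s"
        using AE_lborel_singleton[of r] by eventually_elim (auto simp: indicator_def)
    qed (use ia'[of "{..<r}"] ia'[of "{..r}"] in auto)
    finally show ?thesis .
  qed
  have out1: "integrable lborel (\<lambda>s. pr (a s) (b1 s))"
    using lborel_pair.integrable_fst'[OF P1] by (simp add: in1)
  have out2: "integrable lborel (\<lambda>r. pr (a1 r) (b r))"
    using lborel_pair.integrable_snd[OF P2] by (simp add: in2)
  (* Splitting the inner integral at r = s; Fubini is needed for the triangle s < r only. *)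
  have "pr (a1 t) (b1 t) = (LINT s|lborel. pr (a s) (b1 t))"
    unfolding at using integral_bounded_linear[OF bounded_linear_left ia, of "b1 t"] by simp
  also have "\<dots> = (LINT s|lborel. pr (a s) (b1 s) + (LINT r|lborel. indicator {..<r} s *\<^sub>R ?P s r))"
  proof (rule Bochner_Integration.integral_cong[OF refl])
    fix s
    have "(LINT r|lborel. indicator {..<r} s *\<^sub>R ?P s r) = (LINT r|lborel. pr (a s) (indicator {s<..} r *\<^sub>R b r))"
      by (intro Bochner_Integration.integral_cong) (auto simp: indicator_def zero_right)
    also have "\<dots> = pr (a s) (LINT r|lborel. indicator {s<..} r *\<^sub>R b r)"
      using integral_bounded_linear[OF bounded_linear_right ib'[of "{s<..}"], of "a s"] by simp
    also have "(LINT r|lborel. indicator {s<..} r *\<^sub>R b r) = b1 t - b1 s"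
    proof -
      have "(LINT r|lborel. indicator {s<..} r *\<^sub>R b r)
          = (LINT r|lborel. b r - indicator {..s} r *\<^sub>R b r)"
        by (intro Bochner_Integration.integral_cong) (auto simp: indicator_def)
      then show ?thesis
        unfolding bt b1_def[of s] by (simp add: Bochner_Integration.integral_diff[OF ib ib'[of "{..s}"]])
    qed
    finally show "pr (a s) (b1 t) = pr (a s) (b1 s) + (LINT r|lborel. indicator {..<r} s *\<^sub>R ?P s r)"
      by (simp add: diff_right)
  qed
  also have "\<dots> = (LINT s|lborel. pr (a s) (b1 s)) + (LINT s|lborel. LINT r|lborel. indicator {..<r} s *\<^sub>R ?P s r)"
    using lborel_pair.integrable_fst'[OF P2] by (intro Bochner_Integration.integral_add out1) simp
  also have "(LINT s|lborel. LINT r|lborel. indicator {..<r} s *\<^sub>R ?P s r) = (LINT r|lborel. pr (a1 r) (b r))"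
    using lborel_pair.Fubini_integral[OF P2] by (simp add: in2)
  finally have key: "pr (a1 t) (b1 t) = (LINT s|lborel. pr (a s) (b1 s)) + (LINT r|lborel. pr (a1 r) (b r))" .
  have ab: "a s = 0" "b s = 0" if "s \<notin> {0..t}" for s using that by (auto simp: a_def b_def)
  have eq: "indicator {0..t} s *\<^sub>R (pr (f s) (G s) + pr (F s) (g s))
      = (pr (a s) (G 0) + pr (F 0) (b s)) + (pr (a s) (b1 s) + pr (a1 s) (b s))" for s
    by (cases "s \<in> {0..t}")
      (auto simp: ab zero_left zero_right Fa[of s] Gb[of s] a_def b_def add_left add_right)
  have i3: "integrable lborel (\<lambda>s. pr (a s) (G 0))" "integrable lborel (\<lambda>s. pr (F 0) (b s))"
    using integrable_bounded_linear[OF bounded_linear_left ia]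
      integrable_bounded_linear[OF bounded_linear_right ib] by auto
  show "set_integrable lborel {0..t} (\<lambda>s. pr (f s) (G s) + pr (F s) (g s))"
    unfolding set_integrable_def eq using i3 out1 out2 by auto
  have "(LBINT s:{0..t}. pr (f s) (G s) + pr (F s) (g s))
      = (pr (a1 t) (G 0) + pr (F 0) (b1 t)) + pr (a1 t) (b1 t)"
    unfolding set_lebesgue_integral_def eq key
    using i3 out1 out2 integral_bounded_linear[OF bounded_linear_left ia]
      integral_bounded_linear[OF bounded_linear_right ib] by (simp add: at bt)
  then show "pr (F t) (G t) = pr (F 0) (G 0) + (LBINT s:{0..t}. pr (f s) (G s) + pr (F s) (g s))"
    using Fa[of t] Gb[of t] t by (simp add: add_left add_right)
qed

section \<open>Truncation, duality and measurability in the sequence space\<close>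

lemma bounded_linear_coord: "bounded_linear (\<lambda>x. coord x n)"
  by (rule bounded_linear_intro[where K=1]) (auto simp: cmod_coord_le)

lemma ell2_seqs_dominated:
  assumes "f 0 = 0" "\<And>n. cmod (f n) \<le> C * cmod (coord y n)"
  shows "f \<in> ell2_seqs"
proof -
  have "summable (\<lambda>n. C\<^sup>2 * (cmod (coord y n))\<^sup>2)"
    by (intro summable_mult summable_coord)
  moreover have "norm ((cmod (f n))\<^sup>2) \<le> C\<^sup>2 * (cmod (coord y n))\<^sup>2" for n
    using power_mono[OF assms(2)[of n], of 2] by (simp add: power_mult_distrib)
  ultimately have "summable (\<lambda>n. (cmod (f n))\<^sup>2)"
    by (rule summable_comparison_test'[where N=0])
  with assms(1) show ?thesis by (simp add: ell2_seqs_def)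
qed

lemma norm_ell2_dominated:
  assumes "0 \<le> C" "\<And>n. cmod (coord x n) \<le> C * cmod (coord y n)"
  shows "norm x \<le> C * norm y"
proof (rule norm_ell2_leI)
  fix N
  have "(\<Sum>n<N. (cmod (coord x n))\<^sup>2) \<le> (\<Sum>n<N. C\<^sup>2 * (cmod (coord y n))\<^sup>2)"
    using power_mono[OF assms(2), of _ 2] by (intro sum_mono) (simp add: power_mult_distrib)
  also have "\<dots> \<le> C\<^sup>2 * (norm y)\<^sup>2"
    unfolding sum_distrib_left[symmetric] by (intro mult_left_mono partial_sum_le_norm_ell2) auto
  finally show "(\<Sum>n<N. (cmod (coord x n))\<^sup>2) \<le> (C * norm y)\<^sup>2"
    by (simp add: power_mult_distrib)
qed (use assms in simp)

text \<open>
  Dominated convergence for the counting measure. It covers the convergence of truncations and the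
  strong continuity of the diagonal semigroup.
\<close>
lemma ell2_tendsto_dominated:
  assumes lim: "\<And>n. (\<lambda>j. coord (X j) n) \<longlonglongrightarrow> coord L n"
    and bound: "\<And>j n. cmod (coord (X j) n) \<le> cmod (coord y n)"
  shows "X \<longlonglongrightarrow> L"
proof -
  have bL: "cmod (coord L n) \<le> cmod (coord y n)" for n
    by (rule LIMSEQ_le_const2[OF tendsto_norm[OF lim[of n]]]) (use bound in auto)
  have b: "norm ((cmod (coord (X j) n - coord L n))\<^sup>2) \<le> 4 * (cmod (coord y n))\<^sup>2" for j n
  proof -
    have "cmod (coord (X j) n - coord L n) \<le> 2 * cmod (coord y n)"
      using norm_triangle_ineq4[of "coord (X j) n" "coord L n"] bound[of j n] bL[of n] by linarith
    from power_mono[OF this, of 2] show ?thesis by (simp add: power_mult_distrib)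
  qed
  have "(\<lambda>j. (cmod (coord (X j) n - coord L n))\<^sup>2) \<longlonglongrightarrow> 0" for n
    using tendsto_power[OF tendsto_norm[OF LIM_zero[OF lim[of n]]], of 2] by simp
  then have "(\<lambda>j. \<Sum>n. (cmod (coord (X j) n - coord L n))\<^sup>2) \<longlonglongrightarrow> (\<Sum>n. 0::real)"
    using tannerys_theorem[of "\<lambda>n j. (cmod (coord (X j) n - coord L n))\<^sup>2" "\<lambda>_. 0" sequentially
        "\<lambda>n. 4 * (cmod (coord y n))\<^sup>2"] b summable_coord[of y]
    by (auto intro!: always_eventually summable_mult)
  then have "(\<lambda>j. (norm (X j - L))\<^sup>2) \<longlonglongrightarrow> 0"
    by (simp add: norm_ell2_sq)
  then have "(\<lambda>j. sqrt ((norm (X j - L))\<^sup>2)) \<longlonglongrightarrow> sqrt 0"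
    by (rule tendsto_real_sqrt)
  then have "(\<lambda>j. norm (X j - L)) \<longlonglongrightarrow> 0" by simp
  then show ?thesis using LIM_zero_iff tendsto_norm_zero_iff by blast
qed

definition trunc :: "nat \<Rightarrow> ell2 \<Rightarrow> ell2" where
  "trunc N x = Abs_ell2 (\<lambda>n. if n < N then coord x n else 0)"

lemma coord_trunc [simp]: "coord (trunc N x) n = (if n < N then coord x n else 0)"
proof -
  have "(\<lambda>n. if n < N then coord x n else 0) \<in> ell2_seqs"
    by (rule ell2_seqs_dominated[where C=1 and y=x]) auto
  then show ?thesis unfolding trunc_def by (simp add: Abs_ell2_inverse)
qed

lemma norm_trunc_le: "norm (trunc N x) \<le> norm x"
  using norm_ell2_dominated[of 1 "trunc N x" x] by simp

lemma bounded_linear_trunc: "bounded_linear (trunc N)"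
proof (rule bounded_linear_intro[where K=1])
  show "norm (trunc N x) \<le> norm x * 1" for x using norm_trunc_le[of N x] by simp
qed (auto intro!: ell2_eqI)

lemma trunc_tendsto: "(\<lambda>N. trunc N x) \<longlonglongrightarrow> x"
proof (rule ell2_tendsto_dominated[where y=x])
  fix n
  have "eventually (\<lambda>N. coord (trunc N x) n = coord x n) sequentially"
    using eventually_gt_at_top[of n] by eventually_elim auto
  then show "(\<lambda>N. coord (trunc N x) n) \<longlonglongrightarrow> coord x n" by (rule tendsto_eventually)
qed auto

lemma inner_trunc: "inner (trunc N x) y = (\<Sum>n<N. Re (coord x n * cnj (coord y n)))"
  unfolding inner_ell2_suminf by (subst suminf_finite[of "{..<N}"]) auto

lemma inner_trunc_commute: "inner (trunc N x) y = inner x (trunc N y)"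
  unfolding inner_commute[of x] inner_trunc by (simp add: mult.commute)

lemma trunc_trunc [simp]: "trunc N (trunc N x) = trunc N x"
  by (rule ell2_eqI) simp

lemma inner_trunc_trunc: "inner (trunc N x) (trunc N y) = inner (trunc N x) y"
  unfolding inner_trunc by (intro sum.cong) auto

definition single :: "nat \<Rightarrow> complex \<Rightarrow> ell2" where
  "single n z = to_ell2 (\<lambda>m. if m = n \<and> n \<noteq> 0 then z else 0)"

lemma ell2_seqs_finite: "f 0 = 0 \<Longrightarrow> (\<And>n. n \<ge> N \<Longrightarrow> f n = 0) \<Longrightarrow> f \<in> ell2_seqs"
  unfolding ell2_seqs_def by (auto intro!: summable_finite[of "{..<N}"] simp: linorder_not_le[symmetric])

lemma coord_single: "coord (single n z) m = (if m = n \<and> n \<noteq> 0 then z else 0)"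
  unfolding single_def by (subst coord_to_ell2) (auto intro!: ell2_seqs_finite[of _ "Suc n"])

lemma bounded_linear_single: "bounded_linear (single n)"
proof (rule bounded_linear_intro[where K=1])
  fix z
  show "norm (single n z) \<le> norm z * 1"
  proof (rule norm_ell2_leI)
    fix N
    have "(\<Sum>m<N. (cmod (coord (single n z) m))\<^sup>2) \<le> (\<Sum>m<N. if m = n then (cmod z)\<^sup>2 else 0)"
      by (intro sum_mono) (auto simp: coord_single)
    also have "\<dots> \<le> (cmod z)\<^sup>2" by simp
    finally show "(\<Sum>m<N. (cmod (coord (single n z) m))\<^sup>2) \<le> (norm z * 1)\<^sup>2" by simp
  qed simp
qed (auto intro!: ell2_eqI simp: coord_single)

lemma coord_sum: "coord (\<Sum>i\<in>I. f i) n = (\<Sum>i\<in>I. coord (f i) n)"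
  by (rule bounded_linear.linear[OF bounded_linear_coord, THEN linear_sum])

lemma trunc_eq_sum: "trunc N x = (\<Sum>n<N. single n (coord x n))"
proof (rule ell2_eqI)
  fix m
  have "coord (\<Sum>n<N. single n (coord x n)) m = (\<Sum>n<N. if n = m then coord x m else 0)"
    unfolding coord_sum by (intro sum.cong) (auto simp: coord_single)
  then show "coord (trunc N x) m = coord (\<Sum>n<N. single n (coord x n)) m" by simp
qed

text \<open>
  The coordinates of the representing vector are forced by the values of \<open>f\<close> on the real basis
  \<open>\<phi>\<^sub>n, \<i>\<phi>\<^sub>n\<close>. Square-summability follows by testing \<open>f\<close> with the truncations of that vector, for which
  \<open>f(z) = |z|\<^sup>2\<close>.
\<close>
lemma ell2_riesz:
  fixes f :: "ell2 \<Rightarrow> real"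
  assumes f: "bounded_linear f"
  obtains z where "\<And>x. f x = inner x z"
proof -
  interpret f: bounded_linear f by fact
  define g where "g n = Complex (f (single n 1)) (f (single n \<i>))" for n
  have g0: "g 0 = 0"
  proof -
    have "single 0 z = 0" for z by (rule ell2_eqI) (simp add: coord_single)
    then show ?thesis by (simp add: g_def f.zero complex_eq_iff)
  qed
  have fs: "f (single n c) = Re (c * cnj (g n))" for n c
  proof -
    have "single n c = Re c *\<^sub>R single n 1 + Im c *\<^sub>R single n \<i>"
      by (rule ell2_eqI) (auto simp: coord_single complex_eq_iff)
    then show ?thesis by (simp add: f.add f.scale g_def)
  qed
  have ft: "f (trunc N x) = (\<Sum>n<N. Re (coord x n * cnj (g n)))" for N x
    unfolding trunc_eq_sum by (simp add: f.sum fs)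
  obtain K where K: "0 \<le> K" "\<And>x. norm (f x) \<le> norm x * K" using f.nonneg_bounded by blast
  have partial: "(\<Sum>n<N. (cmod (g n))\<^sup>2) \<le> K\<^sup>2" for N
  proof -
    define zN where "zN = to_ell2 (\<lambda>n. if n < N then g n else 0)"
    have c: "coord zN n = (if n < N then g n else 0)" for n
      unfolding zN_def by (subst coord_to_ell2) (auto intro!: ell2_seqs_finite[of _ N] simp: g0)
    have tz: "trunc N zN = zN" by (rule ell2_eqI) (simp add: c)
    have S: "Re (z * cnj z) = (cmod z)\<^sup>2" for z by (simp add: complex_mult_cnj cmod_power2)
    have "(norm zN)\<^sup>2 = inner (trunc N zN) zN" by (simp add: tz power2_norm_eq_inner)
    also have "\<dots> = (\<Sum>n<N. (cmod (g n))\<^sup>2)"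
      unfolding inner_trunc by (intro sum.cong) (simp_all only: c S lessThan_iff if_True)
    finally have n1: "(norm zN)\<^sup>2 = (\<Sum>n<N. (cmod (g n))\<^sup>2)" .
    have "f (trunc N zN) = (\<Sum>n<N. (cmod (g n))\<^sup>2)"
      unfolding ft by (intro sum.cong) (simp_all only: c S lessThan_iff if_True)
    then have "(norm zN)\<^sup>2 \<le> norm zN * K" using K(2)[of zN] n1 tz by simp
    then have "norm zN \<le> K" using K(1)
      by (cases "norm zN = 0") (auto simp: power2_eq_square)
    then show ?thesis unfolding n1[symmetric] by (intro power_mono) auto
  qed
  have "summable (\<lambda>n. (cmod (g n))\<^sup>2)"
    by (rule bounded_imp_summable[of _ "K\<^sup>2"]) (use partial[of "Suc _"] in \<open>auto simp: lessThan_Suc_atMost\<close>)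
  then have cz: "coord (to_ell2 g) = g"
    by (intro coord_to_ell2) (simp add: ell2_seqs_def g0)
  have ftz: "f (trunc N x) = inner (trunc N x) (to_ell2 g)" for N x
    by (simp only: ft inner_trunc cz)
  have "f x = inner x (to_ell2 g)" for x
  proof (rule LIMSEQ_unique)
    show "(\<lambda>N. f (trunc N x)) \<longlonglongrightarrow> f x" by (rule f.tendsto[OF trunc_tendsto])
    show "(\<lambda>N. f (trunc N x)) \<longlonglongrightarrow> inner x (to_ell2 g)"
      unfolding ftz
      by (intro tendsto_intros trunc_tendsto)
  qed
  then show thesis by (rule that)
qed

text \<open>
  The constant \<open>adjoint\<close> is a choice of a function satisfying the adjoint identity; in \<open>ell2\<close> one
  exists by the Riesz representation.
\<close>
lemma adjoint_ell2:
  fixes T :: "ell2 \<Rightarrow> ell2"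
  assumes T: "bounded_linear T"
  shows inner_adjoint_ell2: "inner (T x) y = inner x (adjoint T y)"
    and bounded_linear_adjoint_ell2: "bounded_linear (adjoint T)"
proof -
  have "\<exists>z. \<forall>x. inner (T x) y = inner x z" for y
  proof -
    obtain z where "\<And>x. inner (T x) y = inner x z"
      by (rule ell2_riesz[OF bounded_linear_compose[OF bounded_linear_inner_left T, of y]]) (rule that)
    then show ?thesis by blast
  qed
  then have "\<forall>y. \<exists>z. \<forall>x. inner (T x) y = inner x z" by blast
  from choice[OF this] have "\<exists>f'. \<forall>x y. inner (T x) y = inner x (f' y)" by blast
  then have "\<forall>x y. inner (T x) y = inner x (adjoint T y)"
    unfolding adjoint_def by (rule someI_ex)
  then have a: "inner (T x) y = inner x (adjoint T y)" for x y by blast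
  show "inner (T x) y = inner x (adjoint T y)" by (rule a)
  obtain K where K: "0 \<le> K" "\<And>x. norm (T x) \<le> norm x * K"
    using bounded_linear.nonneg_bounded[OF T] by blast
  show "bounded_linear (adjoint T)"
  proof (rule bounded_linear_intro[where K=K])
    fix u v :: ell2 and r :: real
    show "adjoint T (u + v) = adjoint T u + adjoint T v"
      by (rule vector_eq_ldot[THEN iffD1], simp only: inner_add_right a[symmetric], simp)
    show "adjoint T (r *\<^sub>R u) = r *\<^sub>R adjoint T u"
      by (rule vector_eq_ldot[THEN iffD1], simp only: inner_scaleR_right a[symmetric], simp)
    have "(norm (adjoint T u))\<^sup>2 = inner (T (adjoint T u)) u"
      by (simp add: a power2_norm_eq_inner)
    also have "\<dots> \<le> norm (T (adjoint T u)) * norm u" by (rule norm_cauchy_schwarz)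
    also have "\<dots> \<le> norm (adjoint T u) * K * norm u" by (intro mult_right_mono K) auto
    finally have "norm (adjoint T u) * norm (adjoint T u) \<le> norm (adjoint T u) * (norm u * K)"
      by (simp add: power2_eq_square ac_simps)
    then show "norm (adjoint T u) \<le> norm u * K"
      using K(1) mult_nonneg_nonneg[of "norm u" K] by (cases "norm (adjoint T u) = 0") auto
  qed
qed

lemma borel_measurable_ell2_coord:
  assumes "\<And>n. (\<lambda>x. coord (f x) n) \<in> borel_measurable M"
  shows "f \<in> borel_measurable M"
proof (rule borel_measurable_LIMSEQ_metric[where f="\<lambda>N x. trunc N (f x)"])
  fix N
  have "single n \<in> borel_measurable borel" for n
    using linear_continuous_on[OF bounded_linear_single] by (rule borel_measurable_continuous_onI)
  then have "(\<lambda>x. single n (coord (f x) n)) \<in> borel_measurable M" for n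
    by (rule measurable_compose[OF assms[of n]])
  then show "(\<lambda>x. trunc N (f x)) \<in> borel_measurable M"
    by (simp only: trunc_eq_sum borel_measurable_sum)
qed (rule trunc_tendsto)

lemma measurable_coord: "(\<lambda>x. coord x n) \<in> borel_measurable borel"
  using linear_continuous_on[OF bounded_linear_coord] by (rule borel_measurable_continuous_onI)

lemma ell2_seqs_iff_suminf:
  "f \<in> ell2_seqs \<longleftrightarrow> f 0 = 0 \<and> (\<Sum>n. ennreal ((cmod (f n))\<^sup>2)) \<noteq> \<infinity>"
proof -
  have "summable (\<lambda>n. (cmod (f n))\<^sup>2) \<longleftrightarrow> (\<Sum>n. ennreal ((cmod (f n))\<^sup>2)) \<noteq> \<infinity>"
  proof
    assume "summable (\<lambda>n. (cmod (f n))\<^sup>2)"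
    from suminf_ennreal2[OF zero_le_power2 this] show "(\<Sum>n. ennreal ((cmod (f n))\<^sup>2)) \<noteq> \<infinity>"
      by (simp only: infinity_ennreal_def ennreal_neq_top not_False_eq_True)
  next
    assume "(\<Sum>n. ennreal ((cmod (f n))\<^sup>2)) \<noteq> \<infinity>"
    then show "summable (\<lambda>n. (cmod (f n))\<^sup>2)"
      unfolding infinity_ennreal_def by (rule summable_suminf_not_top[OF zero_le_power2])
  qed
  then show ?thesis by (simp add: ell2_seqs_def)
qed

text \<open>
  Membership in \<open>ell2\<close> is the finiteness of a series of nonnegative measurable functions, hence a
  measurable condition, so the default value \<open>0\<close> of \<open>to_ell2\<close> does not destroy measurability.
\<close>
lemma borel_measurable_to_ell2:
  assumes F: "\<And>n. (\<lambda>x. F x n) \<in> borel_measurable M" and F0: "\<And>x. F x 0 = 0"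
  shows "(\<lambda>x. to_ell2 (F x)) \<in> borel_measurable M"
proof (rule borel_measurable_ell2_coord)
  fix n
  have c: "coord (to_ell2 (F x)) n = (if (\<Sum>n. ennreal ((cmod (F x n))\<^sup>2)) \<noteq> \<infinity> then F x n else 0)" for x
    by (auto simp: to_ell2_def ell2_seqs_iff_suminf F0 Abs_ell2_inverse)
  have [measurable]: "(\<lambda>x. F x n) \<in> borel_measurable M" for n by (rule F)
  show "(\<lambda>x. coord (to_ell2 (F x)) n) \<in> borel_measurable M"
    unfolding c by measurable
qed

section \<open>The bilinear term and the linearized operator\<close>

lemma sum_shift_pred_le:
  fixes g :: "nat \<Rightarrow> real"
  assumes "g 0 = 0" "\<And>n. 0 \<le> g n"
  shows "(\<Sum>n<N. g (n - 1)) \<le> (\<Sum>n<N. g n)"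
proof (cases N)
  case (Suc m)
  have "(\<Sum>n<Suc m. g (n - 1)) = (\<Sum>n<m. g n)"
    by (subst sum.lessThan_Suc_shift) (simp add: assms)
  then show ?thesis using assms(2)[of m] by (simp add: Suc)
qed simp

text \<open>
  Component \<open>n\<close> of \<open>B(u,v)\<close> involves only these coordinates of \<open>u\<close> and \<open>v\<close>.
  Truncated subtraction is harmless because coordinate \<open>0\<close> vanishes.
\<close>
definition neighbours :: "ell2 \<Rightarrow> nat \<Rightarrow> real" where
  "neighbours y n = cmod (coord y (n + 2)) + cmod (coord y (n + 1))
     + cmod (coord y (n - 1)) + cmod (coord y (n - 2))"

text \<open>
  Each of the four shifts has norm at most \<open>1\<close> on square-summable sequences.
\<close>
lemma neighbours_dominated:
  assumes f0: "f 0 = 0" and C: "0 \<le> C" and f: "\<And>n. 0 < n \<Longrightarrow> cmod (f n) \<le> C * neighbours y n"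
  shows "f \<in> ell2_seqs" and "norm (to_ell2 f) \<le> 4 * C * norm y"
proof -
  define g where "g n = (cmod (coord y n))\<^sup>2" for n
  have g0: "g 0 = 0" "\<And>n. 0 \<le> g n" by (auto simp: g_def)
  have gN: "(\<Sum>n<N. g n) \<le> (norm y)\<^sup>2" for N
    unfolding g_def by (rule partial_sum_le_norm_ell2)
  have s1: "(\<Sum>n<N. g (n + 1)) \<le> (norm y)\<^sup>2" for N
    using gN[of "Suc N"] unfolding sum.lessThan_Suc_shift g0 by simp
  have s2: "(\<Sum>n<N. g (n + 2)) \<le> (norm y)\<^sup>2" for N
  proof -
    have "(\<Sum>n<N. g (n + 2)) \<le> (\<Sum>n<Suc N. g (n + 1))"
      unfolding sum.lessThan_Suc_shift using g0(2)[of 1] by simp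
    with s1[of "Suc N"] show ?thesis by linarith
  qed
  have s3: "(\<Sum>n<N. g (n - 1)) \<le> (norm y)\<^sup>2" for N
    using sum_shift_pred_le[of g N] g0 gN[of N] by (meson order_trans)
  have s4: "(\<Sum>n<N. g (n - 2)) \<le> (norm y)\<^sup>2" for N
    using sum_shift_pred_le[of "\<lambda>n. g (n - 1)" N] g0 s3[of N]
    by (simp add: numeral_2_eq_2)
  have fn: "(cmod (f n))\<^sup>2 \<le> (4 * C\<^sup>2) * (g (n + 2) + g (n + 1) + g (n - 1) + g (n - 2))" for n
  proof (cases "n = 0")
    case False
    have q: "(p + q + r + s)\<^sup>2 \<le> 4 * (p\<^sup>2 + q\<^sup>2 + r\<^sup>2 + s\<^sup>2)" for p q r s :: real
    proof -
      have "0 \<le> (p - q)\<^sup>2 + (p - r)\<^sup>2 + (p - s)\<^sup>2 + (q - r)\<^sup>2 + (q - s)\<^sup>2 + (r - s)\<^sup>2"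
        by (intro add_nonneg_nonneg zero_le_power2)
      then show ?thesis by (simp add: power2_eq_square algebra_simps)
    qed
    have "(cmod (f n))\<^sup>2 \<le> (C * neighbours y n)\<^sup>2"
      using False by (intro power_mono f) auto
    also have "\<dots> \<le> C\<^sup>2 * (4 * (g (n + 2) + g (n + 1) + g (n - 1) + g (n - 2)))"
      unfolding power_mult_distrib g_def neighbours_def by (intro mult_left_mono q) auto
    finally show ?thesis by (simp only: mult.assoc mult.left_commute)
  qed (use f0 g0 in \<open>auto intro!: mult_nonneg_nonneg add_nonneg_nonneg\<close>)
  have S: "(\<Sum>n<N. (cmod (f n))\<^sup>2) \<le> (4 * C * norm y)\<^sup>2" for N
  proof -
    have "(\<Sum>n<N. (cmod (f n))\<^sup>2)
        \<le> (\<Sum>n<N. (4 * C\<^sup>2) * (g (n + 2) + g (n + 1) + g (n - 1) + g (n - 2)))"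
      by (intro sum_mono fn)
    also have "\<dots> = (4 * C\<^sup>2) * ((\<Sum>n<N. g (n + 2)) + (\<Sum>n<N. g (n + 1))
        + (\<Sum>n<N. g (n - 1)) + (\<Sum>n<N. g (n - 2)))"
      by (simp only: sum_distrib_left[symmetric] sum.distrib)
    also have "\<dots> \<le> (4 * C\<^sup>2) * (4 * (norm y)\<^sup>2)"
      using s1[of N] s2[of N] s3[of N] s4[of N] by (intro mult_left_mono; (linarith | simp))
    finally show ?thesis by (simp add: power_mult_distrib)
  qed
  have "summable (\<lambda>n. (cmod (f n))\<^sup>2)"
    by (rule bounded_imp_summable[of _ "(4 * C * norm y)\<^sup>2"])
      (use S[of "Suc _"] in \<open>auto simp: lessThan_Suc_atMost\<close>)
  then show e: "f \<in> ell2_seqs" by (simp add: ell2_seqs_def f0)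
  show "norm (to_ell2 f) \<le> 4 * C * norm y"
    by (rule norm_ell2_leI) (use S C in \<open>auto simp: coord_to_ell2[OF e]\<close>)
qed

locale shell_model =
  fixes lam k0 \<nu> a b :: real and k :: "nat \<Rightarrow> real"
  assumes lam: "lam > 1" and k0: "k0 > 0" and k: "\<And>n. k n = k0 * lam ^ n" and nu: "\<nu> > 0"
begin

lemma k_pos: "k n > 0"
  using lam k0 by (simp add: k)

lemma k_mono: "m \<le> n \<Longrightarrow> k m \<le> k n"
  using lam k0 by (simp add: k power_increasing)

lemma k0_le: "k0 \<le> k n"
  using k_mono[of 0 n] by (simp add: k)

lemma k_Suc: "k (Suc n) = lam * k n"
  by (simp add: k)

lemma coord_A_op: "u \<in> dom_A k \<Longrightarrow> coord (A_op k u) n = (k n)\<^sup>2 * coord u n"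
  by (simp add: dom_A_def A_op_def coord_to_ell2 A_seq_def)

lemma trunc_in_dom_A: "trunc N x \<in> dom_A k"
  unfolding dom_A_def A_seq_def by (auto intro!: ell2_seqs_finite[of _ N])

lemma bounded_linear_A_trunc: "bounded_linear (\<lambda>x. A_op k (trunc N x))"
proof (rule bounded_linear_intro[where K="(k N)\<^sup>2"])
  show "norm (A_op k (trunc N x)) \<le> norm x * (k N)\<^sup>2" for x
  proof -
    have "norm (A_op k (trunc N x)) \<le> (k N)\<^sup>2 * norm x"
    proof (rule norm_ell2_dominated)
      fix n
      have "n < N \<Longrightarrow> (k n)\<^sup>2 \<le> (k N)\<^sup>2"
        using k_mono[of n N] k_pos[of n] by (intro power_mono) auto
      then show "cmod (coord (A_op k (trunc N x)) n) \<le> (k N)\<^sup>2 * cmod (coord x n)"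
        by (auto simp: coord_A_op trunc_in_dom_A norm_mult norm_power intro!: mult_right_mono)
    qed simp
    then show ?thesis by (simp add: mult.commute)
  qed
qed (auto intro!: ell2_eqI simp: coord_A_op trunc_in_dom_A algebra_simps scaleR_conv_of_real)

lemma trunc_A_op: "u \<in> dom_A k \<Longrightarrow> trunc N (A_op k u) = A_op k (trunc N u)"
  by (rule ell2_eqI) (simp add: coord_A_op trunc_in_dom_A)

lemma A_trunc_trunc: "trunc N (A_op k (trunc N u)) = A_op k (trunc N u)"
  by (simp add: trunc_A_op trunc_in_dom_A)

lemma A_op_symmetric: "u \<in> dom_A k \<Longrightarrow> v \<in> dom_A k \<Longrightarrow> inner (A_op k u) v = inner u (A_op k v)"
  unfolding inner_ell2_suminf by (intro suminf_cong) (simp add: coord_A_op mult_ac)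

lemma inner_A_trunc:
  "inner (trunc N x) (A_op k (trunc N x)) = (\<Sum>n<N. (k n * cmod (coord x n))\<^sup>2)"
proof -
  have "Re (z * cnj (of_real r * z)) = r * (cmod z)\<^sup>2" for z r
    by (simp only: cmod_power2) (simp add: power2_eq_square algebra_simps)
  then show ?thesis
    unfolding inner_trunc
    by (intro sum.cong refl) (simp add: coord_A_op trunc_in_dom_A power_mult_distrib del: of_real_power)
qed

definition linearized_B :: "ell2 \<Rightarrow> ell2 \<Rightarrow> ell2" where
  "linearized_B ue u = B_op k a b u ue + B_op k a b ue u"

lemma coord_sqrtA_op: "u \<in> V_space k \<Longrightarrow> coord (sqrtA_op k u) n = k n * coord u n"
  by (simp add: V_space_def sqrtA_op_def coord_to_ell2 sqrtA_seq_def)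

lemma k_coord_le: "u \<in> V_space k \<Longrightarrow> k n * cmod (coord u n) \<le> norm (sqrtA_op k u)"
  using cmod_coord_le[of "sqrtA_op k u" n] k_pos[of n]
  by (simp add: coord_sqrtA_op norm_mult)

text \<open>
  Moving the weight \<open>k\<close> up by one index costs the factor \<open>lam\<close>; moving it down costs nothing.
  The larger bound is stated in both cases, so that all terms of \<open>B\<close> are treated alike.
\<close>
lemma k_shift_le:
  assumes "u \<in> V_space k"
  shows "m \<le> n \<Longrightarrow> k m * cmod (coord u n) \<le> lam * norm (sqrtA_op k u)"
    and "k n * cmod (coord u (n - 1)) \<le> lam * norm (sqrtA_op k u)"
proof -
  have 1: "x \<le> norm (sqrtA_op k u) \<Longrightarrow> x \<le> lam * norm (sqrtA_op k u)" for x
    using mult_right_mono[of 1 lam "norm (sqrtA_op k u)"] lam by simp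
  show "k m * cmod (coord u n) \<le> lam * norm (sqrtA_op k u)" if "m \<le> n"
    using mult_right_mono[OF k_mono[OF that], of "cmod (coord u n)"] k_coord_le[OF assms, of n]
    by (intro 1) simp
  show "k n * cmod (coord u (n - 1)) \<le> lam * norm (sqrtA_op k u)"
    using k_coord_le[OF assms, of "n - 1"] lam
    by (cases n) (auto simp: k_Suc mult.assoc)
qed

definition cB :: real where "cB = 8 * (\<bar>a\<bar> + \<bar>b\<bar>) * lam"

lemma cB_nonneg: "0 \<le> cB"
  using lam by (simp add: cB_def)

text \<open>
  Both estimates on \<open>B\<close> have this form: in every term, the weight \<open>k\<close> and one coordinate are
  bounded by \<open>W\<close>, and the other coordinate is a neighbour of index \<open>n\<close>.
\<close>
lemma B_op_bound_of_terms:
  assumes W: "0 \<le> W"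
    and le: "\<And>n. k (n + 1) * cmod (coord y (n + 2)) * cmod (coord x (n + 1)) \<le> W * neighbours v n"
      "\<And>n. k n * cmod (coord y (n + 1)) * cmod (coord x (n - 1)) \<le> W * neighbours v n"
      "\<And>n. k (n - 1) * cmod (coord x (n - 1)) * cmod (coord y (n - 2)) \<le> W * neighbours v n"
      "\<And>n. k (n - 1) * cmod (coord y (n - 1)) * cmod (coord x (n - 2)) \<le> W * neighbours v n"
  shows "B_seq k a b x y \<in> ell2_seqs"
    and "norm (B_op k a b x y) \<le> 8 * (\<bar>a\<bar> + \<bar>b\<bar>) * W * norm v"
proof -
  have t: "cmod (of_real (c * k m) * z * z') \<le> \<bar>c\<bar> * (W * neighbours v n)"
    if "k m * cmod z * cmod z' \<le> W * neighbours v n" for c m z z' n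
    using mult_left_mono[OF that abs_ge_zero[of c]] k_pos[of m] by (simp add: norm_mult abs_mult mult_ac)
  have bound: "cmod (B_seq k a b x y n) \<le> (2 * (\<bar>a\<bar> + \<bar>b\<bar>) * W) * neighbours v n" if n: "0 < n" for n
  proof -
    have "cmod (B_seq k a b x y n) = cmod (of_real (a * k (n + 1)) * coord y (n + 2) * cnj (coord x (n + 1))
        + of_real (b * k n) * coord y (n + 1) * cnj (coord x (n - 1))
        + of_real (a * k (n - 1)) * coord x (n - 1) * coord y (n - 2)
        + of_real (b * k (n - 1)) * coord y (n - 1) * coord x (n - 2))"
      using n by (simp add: B_seq_def norm_mult)
    also have "\<dots> \<le> \<bar>a\<bar> * (W * neighbours v n) + \<bar>b\<bar> * (W * neighbours v n)
        + \<bar>a\<bar> * (W * neighbours v n) + \<bar>b\<bar> * (W * neighbours v n)"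
      by (intro norm_triangle_le add_mono t) (simp_all only: complex_mod_cnj le)
    finally show ?thesis by (simp add: algebra_simps)
  qed
  have B0: "B_seq k a b x y 0 = 0" by (simp add: B_seq_def)
  have C: "0 \<le> 2 * (\<bar>a\<bar> + \<bar>b\<bar>) * W" using W by simp
  show "B_seq k a b x y \<in> ell2_seqs" by (rule neighbours_dominated(1)[OF B0 C bound])
  show "norm (B_op k a b x y) \<le> 8 * (\<bar>a\<bar> + \<bar>b\<bar>) * W * norm v"
    using neighbours_dominated(2)[OF B0 C bound] by (simp add: B_op_def algebra_simps)
qed

lemma B_op_bound_right:
  assumes y: "y \<in> V_space k"
  shows "B_seq k a b x y \<in> ell2_seqs"
    and "norm (B_op k a b x y) \<le> cB * norm x * norm (sqrtA_op k y)"
proof -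
  let ?W = "lam * norm (sqrtA_op k y)"
  have W: "0 \<le> ?W" using lam by simp
  have m: "k m * cmod (coord y p) * cmod (coord x q) \<le> ?W * neighbours x n"
    if "m \<le> p \<or> p = m - 1" "q \<in> {n + 2, n + 1, n - 1, n - 2}" for m p q n
  proof (rule mult_mono)
    show "k m * cmod (coord y p) \<le> ?W" using that(1) k_shift_le[OF y] by auto
    show "cmod (coord x q) \<le> neighbours x n" using that(2) by (auto simp: neighbours_def)
  qed (use W in auto)
  have m': "k (n - 1) * cmod (coord x (n - 1)) * cmod (coord y (n - 2)) \<le> ?W * neighbours x n" for n
    using m[of "n - 1" "n - 2" "n - 1" n] by (simp add: mult_ac numeral_2_eq_2)
  show "B_seq k a b x y \<in> ell2_seqs"
    by (rule B_op_bound_of_terms(1)[OF W m m m' m]) auto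
  have "norm (B_op k a b x y) \<le> 8 * (\<bar>a\<bar> + \<bar>b\<bar>) * ?W * norm x"
    by (rule B_op_bound_of_terms(2)[OF W m m m' m]) auto
  then show "norm (B_op k a b x y) \<le> cB * norm x * norm (sqrtA_op k y)"
    by (simp add: cB_def mult_ac)
qed

lemma B_op_bound_left:
  assumes x: "x \<in> V_space k"
  shows "B_seq k a b x y \<in> ell2_seqs"
    and "norm (B_op k a b x y) \<le> cB * norm (sqrtA_op k x) * norm y"
proof -
  let ?W = "lam * norm (sqrtA_op k x)"
  have W: "0 \<le> ?W" using lam by simp
  have m: "k m * cmod (coord x p) * cmod (coord y q) \<le> ?W * neighbours y n"
    if "m \<le> p \<or> p = m - 1" "q \<in> {n + 2, n + 1, n - 1, n - 2}" for m p q n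
  proof (rule mult_mono)
    show "k m * cmod (coord x p) \<le> ?W" using that(1) k_shift_le[OF x] by auto
    show "cmod (coord y q) \<le> neighbours y n" using that(2) by (auto simp: neighbours_def)
  qed (use W in auto)
  have m': "k m * cmod (coord y q) * cmod (coord x p) \<le> ?W * neighbours y n"
    if "m \<le> p \<or> p = m - 1" "q \<in> {n + 2, n + 1, n - 1, n - 2}" for m p q n
    using m[OF that] by (simp add: mult_ac)
  show "B_seq k a b x y \<in> ell2_seqs"
    by (rule B_op_bound_of_terms(1)[OF W m' m' m m']) auto
  have "norm (B_op k a b x y) \<le> 8 * (\<bar>a\<bar> + \<bar>b\<bar>) * ?W * norm y"
    by (rule B_op_bound_of_terms(2)[OF W m' m' m m']) auto
  then show "norm (B_op k a b x y) \<le> cB * norm (sqrtA_op k x) * norm y"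
    by (simp add: cB_def mult_ac)
qed

lemma coord_B_op:
  "x \<in> V_space k \<or> y \<in> V_space k \<Longrightarrow> coord (B_op k a b x y) = B_seq k a b x y"
  using B_op_bound_left(1)[of x y] B_op_bound_right(1)[of y x] by (auto simp: B_op_def coord_to_ell2)

lemma B_seq_linear:
  "B_seq k a b (x + x') y n = B_seq k a b x y n + B_seq k a b x' y n"
  "B_seq k a b (x - x') y n = B_seq k a b x y n - B_seq k a b x' y n"
  "B_seq k a b (r *\<^sub>R x) y n = r *\<^sub>R B_seq k a b x y n"
  "B_seq k a b x (y + y') n = B_seq k a b x y n + B_seq k a b x y' n"
  "B_seq k a b x (y - y') n = B_seq k a b x y n - B_seq k a b x y' n"
  "B_seq k a b x (r *\<^sub>R y) n = r *\<^sub>R B_seq k a b x y n"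
  by (auto simp: B_seq_def algebra_simps scaleR_conv_of_real)

lemma B_op_diff_quadratic:
  assumes "x \<in> V_space k" "y \<in> V_space k"
  shows "B_op k a b x x - B_op k a b y y = B_op k a b (x - y) x + B_op k a b y (x - y)"
  by (rule ell2_eqI) (simp add: coord_B_op assms B_seq_linear)

lemma bounded_linear_linearized_B:
  assumes ue: "ue \<in> V_space k"
  shows "bounded_linear (linearized_B ue)"
proof (rule bounded_linear_intro[where K="2 * cB * norm (sqrtA_op k ue)"])
  fix x
  have "norm (linearized_B ue x) \<le> norm (B_op k a b x ue) + norm (B_op k a b ue x)"
    unfolding linearized_B_def by (rule norm_triangle_ineq)
  also have "\<dots> \<le> cB * norm x * norm (sqrtA_op k ue) + cB * norm (sqrtA_op k ue) * norm x"
    by (intro add_mono B_op_bound_left B_op_bound_right ue)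
  finally show "norm (linearized_B ue x) \<le> norm x * (2 * cB * norm (sqrtA_op k ue))"
    by (simp add: mult_ac)
qed (auto intro!: ell2_eqI simp: linearized_B_def coord_B_op ue B_seq_linear algebra_simps)

lemma dom_A_subset_V: "dom_A k \<subseteq> V_space k"
proof
  fix u assume u: "u \<in> dom_A k"
  have "cmod (sqrtA_seq k u n) \<le> 1 / k0 * cmod (coord (A_op k u) n)" for n
  proof -
    have "k n * cmod (coord u n) * k0 \<le> k n * cmod (coord u n) * k n"
      using k0_le[of n] k_pos[of n] by (intro mult_left_mono) auto
    then show ?thesis using k0 k_pos[of n] u
      by (simp add: sqrtA_seq_def coord_A_op norm_mult norm_power field_simps power2_eq_square)
  qed
  then have "sqrtA_seq k u \<in> ell2_seqs"
    by (intro ell2_seqs_dominated[where C="1 / k0" and y="A_op k u"]) (simp_all add: sqrtA_seq_def)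
  then show "u \<in> V_space k" by (simp add: V_space_def)
qed

text \<open>
  Since \<open>linearized_B ue\<close> and \<open>K\<close> map \<open>H\<close> into itself, they do not affect which \<open>u\<close> have a
  square-summable image.
\<close>
lemma closed_loop_eq:
  assumes ue: "ue \<in> V_space k"
  shows "closed_loop_dom k \<nu> a b ue K = dom_A k"
    and "u \<in> dom_A k \<Longrightarrow> closed_loop_op k \<nu> a b ue K u = \<nu> *\<^sub>R A_op k u + (linearized_B ue u + K u)"
    and "u \<in> dom_A k \<Longrightarrow> lin_op k \<nu> a b ue u = \<nu> *\<^sub>R A_op k u + linearized_B ue u"
proof -
  have eq: "closed_loop_seq k \<nu> a b ue K u n
      = of_real \<nu> * A_seq k u n + coord (linearized_B ue u + K u) n" for u n
    by (simp add: closed_loop_seq_def lin_seq_def linearized_B_def coord_B_op ue)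
  show "closed_loop_dom k \<nu> a b ue K = dom_A k"
  proof (intro set_eqI iffI)
    fix u assume "u \<in> dom_A k"
    then have "closed_loop_seq k \<nu> a b ue K u = coord (\<nu> *\<^sub>R A_op k u + (linearized_B ue u + K u))"
      by (auto simp: eq coord_A_op A_seq_def scaleR_conv_of_real)
    then show "u \<in> closed_loop_dom k \<nu> a b ue K"
      unfolding closed_loop_dom_def using coord by simp
  next
    fix u assume "u \<in> closed_loop_dom k \<nu> a b ue K"
    then have c: "closed_loop_seq k \<nu> a b ue K u \<in> ell2_seqs" by (simp add: closed_loop_dom_def)
    have "A_seq k u = coord ((1 / \<nu>) *\<^sub>R (to_ell2 (closed_loop_seq k \<nu> a b ue K u) - (linearized_B ue u + K u)))"
      using nu by (auto simp: coord_to_ell2[OF c] eq scaleR_conv_of_real)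
    then show "u \<in> dom_A k" unfolding dom_A_def using coord by simp
  qed
  assume u: "u \<in> dom_A k"
  then have "closed_loop_seq k \<nu> a b ue K u = coord (\<nu> *\<^sub>R A_op k u + (linearized_B ue u + K u))"
    by (auto simp: eq coord_A_op A_seq_def scaleR_conv_of_real)
  then show "closed_loop_op k \<nu> a b ue K u = \<nu> *\<^sub>R A_op k u + (linearized_B ue u + K u)"
    unfolding closed_loop_op_def by (intro ell2_eqI) (simp add: coord_to_ell2 coord)
  have "lin_seq k \<nu> a b ue u = coord (\<nu> *\<^sub>R A_op k u + linearized_B ue u)"
    using u by (auto simp: lin_seq_def linearized_B_def coord_B_op ue coord_A_op A_seq_def scaleR_conv_of_real)
  then show "lin_op k \<nu> a b ue u = \<nu> *\<^sub>R A_op k u + linearized_B ue u"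
    unfolding lin_op_def by (intro ell2_eqI) (simp add: coord_to_ell2 coord)
qed

end

section \<open>Weak solutions as limits of truncated equations\<close>

lemma continuous_on_Icc_of_Ici: "continuous_on {0..} f \<Longrightarrow> continuous_on {0..t::real} f"
  by (erule continuous_on_subset) auto

text \<open>
  All passages from truncated equations to the full one are instances of this: \<open>T N\<close> and \<open>S N\<close> are
  composed of truncations and fixed bounded operators, uniformly bounded and strongly convergent.
\<close>
lemma tendsto_integral_inner_approx:
  fixes T S :: "nat \<Rightarrow> ell2 \<Rightarrow> ell2" and u h :: "real \<Rightarrow> ell2"
  assumes u: "continuous_on {0..t} u" and h: "set_integrable lborel {0..t} h"
    and T: "\<And>N. bounded_linear (T N)" "\<And>N x. norm (T N x) \<le> K * norm x" "\<And>x. (\<lambda>N. T N x) \<longlonglongrightarrow> T' x"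
    and S: "\<And>N. bounded_linear (S N)" "\<And>N x. norm (S N x) \<le> L * norm x" "\<And>x. (\<lambda>N. S N x) \<longlonglongrightarrow> S' x"
    and T': "bounded_linear T'" and S': "bounded_linear S'"
  shows "(\<lambda>N. LBINT s:{0..t}. inner (T N (u s)) (S N (h s))) \<longlonglongrightarrow> (LBINT s:{0..t}. inner (T' (u s)) (S' (h s)))"
proof -
  obtain C where C: "\<And>s. s \<in> {0..t} \<Longrightarrow> norm (u s) \<le> C"
    using compact_imp_bounded[OF compact_continuous_image[OF u compact_Icc]]
    unfolding bounded_iff by (metis imageI)
  have K: "norm (T N x) \<le> \<bar>K\<bar> * norm x" "norm (S N x) \<le> \<bar>L\<bar> * norm x" for N x
    using T(2)[of N x] S(2)[of N x] by (meson abs_ge_self mult_right_mono norm_ge_zero order_trans)+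
  have int: "set_integrable lborel {0..t} (\<lambda>s. inner (A (u s)) (B (h s)))"
    if "bounded_linear A" "bounded_linear B" for A B :: "ell2 \<Rightarrow> ell2"
    by (rule set_integrable_bilinear_continuous[OF bounded_bilinear_inner])
      (auto intro!: set_integrable_bounded_linear[OF that(2) h] bounded_linear.continuous_on[OF that(1) u])
  have "norm (inner (T N (u s)) (S N (h s))) \<le> (\<bar>K\<bar> * \<bar>C\<bar> * \<bar>L\<bar>) * norm (h s)" if s: "s \<in> {0..t}" for N s
  proof -
    have "norm (inner (T N (u s)) (S N (h s))) \<le> norm (T N (u s)) * norm (S N (h s))"
      using Cauchy_Schwarz_ineq2 by simp
    also have "\<dots> \<le> (\<bar>K\<bar> * \<bar>C\<bar>) * (\<bar>L\<bar> * norm (h s))"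
    proof (rule mult_mono)
      have "norm (T N (u s)) \<le> \<bar>K\<bar> * norm (u s)" by (rule K)
      also have "\<dots> \<le> \<bar>K\<bar> * \<bar>C\<bar>" using C[OF s] by (intro mult_left_mono) auto
      finally show "norm (T N (u s)) \<le> \<bar>K\<bar> * \<bar>C\<bar>" .
    qed (use K in auto)
    finally show ?thesis by (simp add: mult_ac)
  qed
  then show ?thesis
    by (intro tendsto_set_integral_dominated[where w="\<lambda>s. (\<bar>K\<bar> * \<bar>C\<bar> * \<bar>L\<bar>) * norm (h s)"]
        int T S T' S' set_integrable_mult_right set_integrable_norm h tendsto_inner) auto
qed

lemma set_integral_inner_right_const:
  fixes h :: "real \<Rightarrow> ell2"
  assumes "set_integrable lborel {0..t} h"
  shows "set_integrable lborel {0..t} (\<lambda>s. inner v (h s))"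
    and "(LBINT s:{0..t}. inner v (h s)) = inner v (LBINT s:{0..t}. h s)"
  using set_integrable_bounded_linear[OF bounded_linear_inner_right assms]
    set_integral_bounded_linear[OF bounded_linear_inner_right assms] by auto

lemma trunc_eq_0_imp: "(\<And>N. trunc N x = 0) \<Longrightarrow> x = 0"
  using LIMSEQ_unique[OF trunc_tendsto[of x], of 0] by simp

lemma trunc_diff: "trunc N (x - y) = trunc N x - trunc N y"
  by (rule ell2_eqI) simp

context shell_model
begin

lemma A_trunc_diff: "A_op k (trunc N x - trunc N y) = A_op k (trunc N x) - A_op k (trunc N y)"
  using linear_diff[OF bounded_linear.linear[OF bounded_linear_A_trunc]] by (simp add: trunc_diff)

text \<open>
  The domain of \<open>A\<close> contains all truncations and is therefore dense, so the definite
  description in \<open>adj_op\<close> refers to a unique vector.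
\<close>
lemma adj_op_dom_A:
  assumes "v \<in> adj_dom (dom_A k) T" "x \<in> dom_A k"
  shows "inner (T x) v = inner x (adj_op (dom_A k) T v)"
proof -
  obtain z where z: "\<forall>u\<in>dom_A k. inner (T u) v = inner u z"
    using assms(1) by (auto simp: adj_dom_def)
  have "\<forall>u\<in>dom_A k. inner (T u) v = inner u (adj_op (dom_A k) T v)"
    unfolding adj_op_def
  proof (rule theI)
    show "\<forall>u\<in>dom_A k. inner (T u) v = inner u z" by (rule z)
    fix z' assume z': "\<forall>u\<in>dom_A k. inner (T u) v = inner u z'"
    have "trunc N (z' - z) = 0" for N
    proof -
      have "inner (trunc N (z' - z)) (z' - z) = 0"
        using z z' trunc_in_dom_A[of N "z' - z"] by (simp add: inner_diff_right)
      then show ?thesis by (metis inner_trunc_trunc inner_eq_zero_iff)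
    qed
    then show "z' = z" using trunc_eq_0_imp[of "z' - z"] by simp
  qed
  with assms(2) show ?thesis by blast
qed

abbreviation rhs :: "nat \<Rightarrow> ell2 \<Rightarrow> ell2 \<Rightarrow> ell2" where
  "rhs N x y \<equiv> trunc N x - \<nu> *\<^sub>R A_op k (trunc N y)"

text \<open>
  \<open>u' + \<nu>Au = h\<close> with \<open>u(0) = u0\<close>, componentwise in integrated form. All components below \<open>N\<close> are
  collected in one Bochner integral in \<open>ell2\<close>, so that the product rule for bilinear forms applies.
\<close>
definition diffusion_solution :: "(real \<Rightarrow> ell2) \<Rightarrow> ell2 \<Rightarrow> (real \<Rightarrow> ell2) \<Rightarrow> bool" where
  "diffusion_solution h u0 u \<longleftrightarrow>
     continuous_on {0..} u \<and> u 0 = u0 \<and> (\<forall>t\<ge>0. set_integrable lborel {0..t} h) \<and>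
     (\<forall>N. \<forall>t\<ge>0. trunc N (u t)
        = trunc N u0 + (LBINT s:{0..t}. rhs N (h s) (u s)))"

lemma diffusion_solutionD:
  assumes "diffusion_solution h u0 u"
  shows "continuous_on {0..} u" "u 0 = u0" "0 \<le> t \<Longrightarrow> set_integrable lborel {0..t} h"
    and "0 \<le> t \<Longrightarrow> trunc N (u t)
        = trunc N u0 + (LBINT s:{0..t}. rhs N (h s) (u s))"
  using assms by (auto simp: diffusion_solution_def)

lemma set_integrable_diffusion_terms:
  fixes u h :: "real \<Rightarrow> ell2"
  assumes "continuous_on {0..} u" "set_integrable lborel {0..t} h"
  shows "set_integrable lborel {0..t} (\<lambda>s. trunc N (h s))"
    and "set_integrable lborel {0..t} (\<lambda>s. A_op k (trunc N (u s)))"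
    and "set_integrable lborel {0..t} (\<lambda>s. rhs N (h s) (u s))"
proof -
  show 1: "set_integrable lborel {0..t} (\<lambda>s. trunc N (h s))"
    by (rule set_integrable_bounded_linear[OF bounded_linear_trunc assms(2)])
  show 2: "set_integrable lborel {0..t} (\<lambda>s. A_op k (trunc N (u s)))"
    by (rule borel_integrable_atLeastAtMost'[OF bounded_linear.continuous_on[OF bounded_linear_A_trunc
        continuous_on_Icc_of_Ici[OF assms(1)]]])
  show "set_integrable lborel {0..t} (\<lambda>s. rhs N (h s) (u s))"
    by (intro set_integral_diff(1) 1 set_integrable_scaleR_right 2)
qed

lemma diffusion_solution_diff:
  assumes "diffusion_solution h u0 u" "diffusion_solution h' v0 v"
  shows "diffusion_solution (\<lambda>s. h s - h' s) (u0 - v0) (\<lambda>s. u s - v s)"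
  unfolding diffusion_solution_def
proof (intro conjI allI impI)
  note u = diffusion_solutionD[OF assms(1)] and v = diffusion_solutionD[OF assms(2)]
  show "continuous_on {0..} (\<lambda>s. u s - v s)" by (intro continuous_intros u v)
  show "u 0 - v 0 = u0 - v0" by (simp add: u v)
  show "set_integrable lborel {0..t} (\<lambda>s. h s - h' s)" if "0 \<le> t" for t
    by (intro set_integral_diff(1) u v that)
  fix N and t :: real assume t: "0 \<le> t"
  have e: "trunc N (h s - h' s) - \<nu> *\<^sub>R A_op k (trunc N (u s - v s))
      = (rhs N (h s) (u s)) - (rhs N (h' s) (v s))" for s
    by (simp add: trunc_diff A_trunc_diff
        scaleR_right_diff_distrib)
  show "trunc N (u t - v t) = trunc N (u0 - v0)
      + (LBINT s:{0..t}. trunc N (h s - h' s) - \<nu> *\<^sub>R A_op k (trunc N (u s - v s)))"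
    unfolding e
    by (subst set_integral_diff(2)[OF set_integrable_diffusion_terms(3)[OF u(1) u(3)[OF t]]
          set_integrable_diffusion_terms(3)[OF v(1) v(3)[OF t]]])
      (simp add: trunc_diff u(4)[OF t, of N] v(4)[OF t, of N])
qed

lemma diffusion_solution_cong:
  assumes "diffusion_solution h u0 u" and u: "\<And>s. 0 \<le> s \<Longrightarrow> u' s = u s"
    and int: "\<And>t. 0 \<le> t \<Longrightarrow> set_integrable lborel {0..t} h'"
    and h: "AE s in lborel. 0 \<le> s \<longrightarrow> h' s = h s"
  shows "diffusion_solution h' u0 u'"
  unfolding diffusion_solution_def
proof (intro conjI allI impI)
  note u' = diffusion_solutionD[OF assms(1)]
  have c: "continuous_on {0..} u'" using u'(1) by (rule continuous_on_eq) (use u in auto)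
  then show "continuous_on {0..} u'" .
  show "u' 0 = u0" using u'(2) u[of 0] by simp
  show "set_integrable lborel {0..t} h'" if "0 \<le> t" for t using int[OF that] .
  fix N and t :: real assume t: "0 \<le> t"
  have "(LBINT s:{0..t}. rhs N (h' s) (u' s))
      = (LBINT s:{0..t}. rhs N (h s) (u s))"
    unfolding set_lebesgue_integral_def
  proof (rule integral_cong_AE)
    show "(\<lambda>s. indicator {0..t} s *\<^sub>R (rhs N (h' s) (u' s))) \<in> borel_measurable lborel"
      "(\<lambda>s. indicator {0..t} s *\<^sub>R (rhs N (h s) (u s))) \<in> borel_measurable lborel"
      using set_integrable_diffusion_terms(3)[OF c int[OF t], of N]
        set_integrable_diffusion_terms(3)[OF u'(1) u'(3)[OF t], of N]
      unfolding set_integrable_def by (auto dest: borel_measurable_integrable)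
    show "AE s in lborel. indicator {0..t} s *\<^sub>R (rhs N (h' s) (u' s))
        = indicator {0..t} s *\<^sub>R (rhs N (h s) (u s))"
      using h by eventually_elim (auto simp: u indicator_def)
  qed
  then show "trunc N (u' t) = trunc N u0 + (LBINT s:{0..t}. rhs N (h' s) (u' s))"
    using u'(4)[OF t, of N] u[OF t] by simp
qed

text \<open>
  Truncations \<open>trunc N y\<close> lie in the domain of the adjoint, with \<open>T\<^sup>*(trunc N y) = \<nu>A(trunc N y) + M\<^sup>*(trunc N y)\<close>,
  so testing with them gives the truncated equations. Conversely, the truncated equation is
  tested with an arbitrary \<open>v \<in> D(T\<^sup>*)\<close>; as truncations lie in \<open>D(T)\<close>, the operator can be moved to
  \<open>v\<close> before \<open>N\<close> tends to infinity, which leaves only bounded operators in the limit.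
\<close>
lemma evolution_solution_iff_diffusion:
  assumes M: "bounded_linear M" and T: "\<And>x. x \<in> dom_A k \<Longrightarrow> T x = \<nu> *\<^sub>R A_op k x + M x"
    and g: "\<And>t. 0 \<le> t \<Longrightarrow> set_integrable lborel {0..t} g"
  shows "evolution_solution (dom_A k) T g u0 u \<longleftrightarrow> diffusion_solution (\<lambda>s. g s - M (u s)) u0 u"
    (is "_ \<longleftrightarrow> diffusion_solution ?h u0 u")
proof
  assume ev: "evolution_solution (dom_A k) T g u0 u"
  then have u: "continuous_on {0..} u" "u 0 = u0" by (auto simp: evolution_solution_def)
  have iu: "set_integrable lborel {0..t} u" for t
    by (rule borel_integrable_atLeastAtMost'[OF continuous_on_Icc_of_Ici[OF u(1)]])
  note iM = set_integrable_bounded_linear[OF M iu]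
  have h: "set_integrable lborel {0..t} ?h" if "0 \<le> t" for t
    by (intro set_integral_diff(1) g that iM)
  have "trunc N (u t) = trunc N u0 + (LBINT s:{0..t}. rhs N (?h s) (u s))"
    if t: "0 \<le> t" for N t
  proof -
    note int = set_integrable_diffusion_terms[OF u(1) h[OF t], of N]
    have "inner y (trunc N (u t) - trunc N u0) = inner y (LBINT s:{0..t}. rhs N (?h s) (u s))" for y
    proof -
      let ?v = "trunc N y"
      have Tv: "inner (T x) ?v = inner x (\<nu> *\<^sub>R A_op k ?v + adjoint M ?v)" if "x \<in> dom_A k" for x
        by (simp add: T that inner_add_left inner_add_right inner_adjoint_ell2[OF M]
            A_op_symmetric[OF that trunc_in_dom_A])
      then have va: "?v \<in> adj_dom (dom_A k) T" unfolding adj_dom_def by blast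
      have "adj_op (dom_A k) T ?v = \<nu> *\<^sub>R A_op k ?v + adjoint M ?v" (is "?z = ?z'")
      proof -
        have "trunc m (?z - ?z') = 0" for m
        proof -
          have "inner (trunc m (?z - ?z')) (?z - ?z') = 0"
            unfolding inner_diff_right
            using Tv[OF trunc_in_dom_A] adj_op_dom_A[OF va trunc_in_dom_A] by simp
          then show ?thesis by (metis inner_trunc_trunc inner_eq_zero_iff)
        qed
        then show ?thesis using trunc_eq_0_imp[of "?z - ?z'"] by simp
      qed
      then have ev': "inner (u t) ?v - inner u0 ?v + (LBINT s:{0..t}. inner (u s) (\<nu> *\<^sub>R A_op k ?v + adjoint M ?v))
          = (LBINT s:{0..t}. inner (g s) ?v)"
        using ev va t unfolding evolution_solution_def by metis
      have tr: "inner (u s) (\<nu> *\<^sub>R A_op k ?v + adjoint M ?v)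
          = \<nu> * inner y (A_op k (trunc N (u s))) + inner ?v (M (u s))" for s
      proof -
        have "inner (u s) (A_op k ?v) = inner (u s) (trunc N (A_op k ?v))" by (simp add: A_trunc_trunc)
        also have "\<dots> = inner (trunc N (u s)) (A_op k ?v)" by (simp add: inner_trunc_commute)
        also have "\<dots> = inner (A_op k (trunc N (u s))) ?v"
          by (simp add: A_op_symmetric trunc_in_dom_A)
        also have "\<dots> = inner y (A_op k (trunc N (u s)))"
          by (simp add: inner_commute[of _ "trunc N y"] inner_trunc_commute A_trunc_trunc)
        finally show ?thesis
          by (simp add: inner_add_right inner_adjoint_ell2[OF M, symmetric] inner_commute)
      qed
      have i1: "set_integrable lborel {0..t} (\<lambda>s. \<nu> * inner y (A_op k (trunc N (u s))))"
        using set_integral_inner_right_const(1)[OF int(2)] by simp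
      have i2: "set_integrable lborel {0..t} (\<lambda>s. inner ?v (M (u s)))"
        by (rule set_integral_inner_right_const(1)[OF iM])
      have i3: "set_integrable lborel {0..t} (\<lambda>s. inner ?v (g s))"
        by (rule set_integral_inner_right_const(1)[OF g[OF t]])
      have "inner y (LBINT s:{0..t}. rhs N (?h s) (u s))
          = (LBINT s:{0..t}. inner y (rhs N (?h s) (u s)))"
        by (rule set_integral_inner_right_const(2)[OF int(3), symmetric])
      also have "\<dots> = (LBINT s:{0..t}. inner ?v (g s) - (\<nu> * inner y (A_op k (trunc N (u s))) + inner ?v (M (u s))))"
        by (intro set_lebesgue_integral_cong)
          (auto simp: inner_diff_right inner_trunc_commute[of N y] trunc_diff)
      also have "\<dots> = (LBINT s:{0..t}. inner ?v (g s))
          - (LBINT s:{0..t}. \<nu> * inner y (A_op k (trunc N (u s))) + inner ?v (M (u s)))"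
        by (intro set_integral_diff(2) i3 set_integral_add(1) i1 i2)
      also have "\<dots> = inner (u t) ?v - inner u0 ?v"
        using ev' unfolding tr by (simp add: inner_commute)
      also have "\<dots> = inner y (trunc N (u t) - trunc N u0)"
        by (simp only: inner_diff_right inner_commute[of y] inner_trunc_commute)
      finally show ?thesis by simp
    qed
    from vector_eq_ldot[THEN iffD1, OF allI, OF this]
    show ?thesis by (simp add: algebra_simps)
  qed
  with u h show "diffusion_solution ?h u0 u" by (auto simp: diffusion_solution_def)
next
  assume sol: "diffusion_solution ?h u0 u"
  note u = diffusion_solutionD[OF sol]
  have iu: "set_integrable lborel {0..t} u" for t
    by (rule borel_integrable_atLeastAtMost'[OF continuous_on_Icc_of_Ici[OF u(1)]])
  note iM = set_integrable_bounded_linear[OF M iu]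
  have "inner (u t) v - inner u0 v + (LBINT s:{0..t}. inner (u s) (adj_op (dom_A k) T v))
          = (LBINT s:{0..t}. inner (g s) v)"
    if v: "v \<in> adj_dom (dom_A k) T" and t: "0 \<le> t" for v t
  proof -
    define z where "z = adj_op (dom_A k) T v"
    have z: "inner (\<nu> *\<^sub>R A_op k x + M x) v = inner x z" if "x \<in> dom_A k" for x
      using adj_op_dom_A[OF v that] T[OF that] by (simp add: z_def)
    note int = set_integrable_diffusion_terms[OF u(1) u(3)[OF t]]
    note MP = bounded_linear_compose[OF M bounded_linear_trunc]
    have eN: "inner (trunc N (u t)) v - inner (trunc N u0) v
        = (LBINT s:{0..t}. inner v (trunc N (?h s))) + (LBINT s:{0..t}. inner v (M (trunc N (u s))))
          - (LBINT s:{0..t}. inner z (trunc N (u s)))" for N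
    proof -
      have "inner (trunc N (u t)) v - inner (trunc N u0) v
          = inner v (LBINT s:{0..t}. rhs N (?h s) (u s))"
        by (subst u(4)[OF t, of N]) (simp add: inner_commute[of _ v] inner_add_right)
      also have "\<dots> = (LBINT s:{0..t}. inner v (rhs N (?h s) (u s)))"
        by (rule set_integral_inner_right_const(2)[OF int(3), symmetric])
      also have "\<dots> = (LBINT s:{0..t}. inner v (trunc N (?h s)) + inner v (M (trunc N (u s))) - inner z (trunc N (u s)))"
        by (intro set_lebesgue_integral_cong)
          (use z[OF trunc_in_dom_A] in \<open>auto simp: inner_commute[of _ v] inner_commute[of _ z] inner_add_right inner_diff_right algebra_simps\<close>)
      also have "\<dots> = (LBINT s:{0..t}. inner v (trunc N (?h s)) + inner v (M (trunc N (u s))))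
          - (LBINT s:{0..t}. inner z (trunc N (u s)))"
        by (intro set_integral_diff(2) set_integral_add(1) set_integral_inner_right_const(1) int
            set_integrable_bounded_linear[OF MP iu] set_integrable_bounded_linear[OF bounded_linear_trunc iu])
      also have "(LBINT s:{0..t}. inner v (trunc N (?h s)) + inner v (M (trunc N (u s))))
          = (LBINT s:{0..t}. inner v (trunc N (?h s))) + (LBINT s:{0..t}. inner v (M (trunc N (u s))))"
        by (intro set_integral_add(2) set_integral_inner_right_const(1) int set_integrable_bounded_linear[OF MP iu])
      finally show ?thesis .
    qed
    obtain K where K: "\<And>x. norm (M x) \<le> norm x * K" "K \<ge> 0" using bounded_linear.nonneg_bounded[OF M] by blast
    have MPb: "norm (M (trunc N x)) \<le> K * norm x" for N x
      using K(1)[of "trunc N x"] mult_right_mono[OF norm_trunc_le[of N x] K(2)] by (simp add: mult.commute)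
    have Pb: "norm (trunc N x) \<le> 1 * norm x" for N x using norm_trunc_le by simp
    have idb: "norm x \<le> 1 * norm x" for x :: ell2 by simp
    have c: "continuous_on {0..t} (\<lambda>s. w)" for w :: ell2 by simp
    have L1: "(\<lambda>N. LBINT s:{0..t}. inner v (trunc N (?h s))) \<longlonglongrightarrow> (LBINT s:{0..t}. inner v (?h s))"
      by (rule tendsto_integral_inner_approx[OF c u(3)[OF t] bounded_linear_ident idb tendsto_const
            bounded_linear_trunc Pb trunc_tendsto bounded_linear_ident bounded_linear_ident])
    have L2: "(\<lambda>N. LBINT s:{0..t}. inner v (M (trunc N (u s)))) \<longlonglongrightarrow> (LBINT s:{0..t}. inner v (M (u s)))"
      by (rule tendsto_integral_inner_approx[OF c iu bounded_linear_ident idb tendsto_const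
            MP MPb bounded_linear.tendsto[OF M trunc_tendsto] bounded_linear_ident M])
    have L3: "(\<lambda>N. LBINT s:{0..t}. inner z (trunc N (u s))) \<longlonglongrightarrow> (LBINT s:{0..t}. inner z (u s))"
      by (rule tendsto_integral_inner_approx[OF c iu bounded_linear_ident idb tendsto_const
            bounded_linear_trunc Pb trunc_tendsto bounded_linear_ident bounded_linear_ident])
    have "(\<lambda>N. inner (trunc N (u t)) v - inner (trunc N u0) v) \<longlonglongrightarrow> inner (u t) v - inner u0 v"
      by (intro tendsto_intros trunc_tendsto)
    moreover have "(\<lambda>N. inner (trunc N (u t)) v - inner (trunc N u0) v)
        \<longlonglongrightarrow> (LBINT s:{0..t}. inner v (?h s)) + (LBINT s:{0..t}. inner v (M (u s))) - (LBINT s:{0..t}. inner z (u s))"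
      unfolding eN by (intro tendsto_add tendsto_diff L1 L2 L3)
    ultimately have "inner (u t) v - inner u0 v
        = (LBINT s:{0..t}. inner v (?h s)) + (LBINT s:{0..t}. inner v (M (u s))) - (LBINT s:{0..t}. inner z (u s))"
      by (rule LIMSEQ_unique)
    also have "(LBINT s:{0..t}. inner v (?h s)) + (LBINT s:{0..t}. inner v (M (u s))) = (LBINT s:{0..t}. inner v (g s))"
      by (subst set_integral_add(2)[OF set_integral_inner_right_const(1)[OF u(3)[OF t]]
            set_integral_inner_right_const(1)[OF iM], symmetric]) (simp add: inner_diff_right)
    finally show ?thesis by (simp add: z_def inner_commute)
  qed
  with u g show "evolution_solution (dom_A k) T g u0 u" by (auto simp: evolution_solution_def)
qed

end

section \<open>Energy identities and the Lyapunov functional\<close>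

lemma nn_integral_half_line_le:
  fixes f :: "real \<Rightarrow> ennreal"
  assumes f: "f \<in> borel_measurable half_line"
    and le: "\<And>t. 0 \<le> t \<Longrightarrow> (\<integral>\<^sup>+ s\<in>{0..t}. f s \<partial>lborel) \<le> c"
  shows "(\<integral>\<^sup>+ s. f s \<partial>half_line) \<le> c"
proof -
  define F where "F n s = f s * indicator {0..real n} s" for n :: nat and s
  have m0: "(\<lambda>s. f s * indicator {0..} s) \<in> borel_measurable lborel"
    using f by (simp add: borel_measurable_restrict_space_iff_ennreal)
  have m: "F n \<in> borel_measurable lborel" for n
  proof -
    have "F n = (\<lambda>s. (f s * indicator {0..} s) * indicator {0..real n} s)"
      by (auto simp: F_def indicator_def)
    then show ?thesis using m0 by simp
  qed
  have sup: "(SUP n. F n s) = f s * indicator {0..} s" for s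
  proof (rule antisym)
    show "(SUP n. F n s) \<le> f s * indicator {0..} s"
      by (intro SUP_least) (auto simp: F_def indicator_def)
    obtain n where "s \<le> real n" using real_arch_simple by blast
    then have "f s * indicator {0..} s \<le> F n s" by (auto simp: F_def indicator_def)
    also have "\<dots> \<le> (SUP n. F n s)" by (intro SUP_upper) auto
    finally show "f s * indicator {0..} s \<le> (SUP n. F n s)" .
  qed
  have "(\<integral>\<^sup>+ s. f s \<partial>half_line) = (\<integral>\<^sup>+ s. (SUP n. F n s) \<partial>lborel)"
    unfolding sup by (simp add: nn_integral_restrict_space)
  also have "\<dots> = (SUP n. integral\<^sup>N lborel (F n))"
    by (intro nn_integral_monotone_convergence_SUP m)
      (auto simp: incseq_def F_def le_fun_def indicator_def)
  also have "\<dots> \<le> c" unfolding F_def by (intro SUP_least le) simp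
  finally show ?thesis .
qed

lemma nn_integral_Icc_le_half_line:
  "(\<integral>\<^sup>+ s\<in>{0..t}. f s \<partial>lborel) \<le> (\<integral>\<^sup>+ s. f s \<partial>half_line)" for f :: "real \<Rightarrow> ennreal"
  by (subst nn_integral_restrict_space) (auto intro!: nn_integral_mono simp: indicator_def)

lemma measurable_half_line_continuous:
  fixes u :: "real \<Rightarrow> 'a::{second_countable_topology, real_normed_vector}"
  assumes "continuous_on {0..} u"
  shows "u \<in> borel_measurable half_line"
  using borel_measurable_continuous_on_restrict[OF assms]
  by (simp add: measurable_cong_sets[OF sets_restrict_space_cong[OF sets_lborel] refl])

abbreviation sq_int :: "(real \<Rightarrow> 'a::real_normed_vector) \<Rightarrow> ennreal" where
  "sq_int f \<equiv> (\<integral>\<^sup>+ s. ennreal ((norm (f s))\<^sup>2) \<partial>half_line)"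

lemma square_integrable_Icc:
  fixes g :: "real \<Rightarrow> ell2"
  assumes g: "set_integrable lborel {0..t} g" and G: "0 \<le> G"
    and le: "sq_int g \<le> ennreal G"
  shows "set_integrable lborel {0..t} (\<lambda>s. (norm (g s))\<^sup>2)"
    and "(LBINT s:{0..t}. (norm (g s))\<^sup>2) \<le> G"
proof -
  have m: "(\<lambda>s. indicator {0..t} s *\<^sub>R (norm (g s))\<^sup>2) \<in> borel_measurable lborel"
  proof -
    have "(\<lambda>s. (norm (indicator {0..t} s *\<^sub>R g s))\<^sup>2) \<in> borel_measurable lborel"
      by (rule measurable_compose[OF borel_measurable_integrable[OF g[unfolded set_integrable_def]],
            of "\<lambda>x. (norm x)\<^sup>2"]) measurable
    moreover have "(\<lambda>s. (norm (indicator {0..t} s *\<^sub>R g s))\<^sup>2) = (\<lambda>s. indicator {0..t} s *\<^sub>R (norm (g s))\<^sup>2)"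
      by (auto simp: indicator_def)
    ultimately show ?thesis by simp
  qed
  have nn: "(\<integral>\<^sup>+ s. ennreal (indicator {0..t} s *\<^sub>R (norm (g s))\<^sup>2) \<partial>lborel) \<le> ennreal G"
  proof -
    have "(\<integral>\<^sup>+ s. ennreal (indicator {0..t} s *\<^sub>R (norm (g s))\<^sup>2) \<partial>lborel)
        = (\<integral>\<^sup>+ s\<in>{0..t}. ennreal ((norm (g s))\<^sup>2) \<partial>lborel)"
      by (intro nn_integral_cong) (auto simp: indicator_def)
    then show ?thesis using order_trans[OF nn_integral_Icc_le_half_line le] by (simp only:)
  qed
  show 1: "set_integrable lborel {0..t} (\<lambda>s. (norm (g s))\<^sup>2)"
    unfolding set_integrable_def
    by (rule integrableI_nonneg[OF m _ le_less_trans[OF nn ennreal_less_top, folded infinity_ennreal_def]])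
      (auto intro!: AE_I2)
  have "ennreal (LBINT s:{0..t}. (norm (g s))\<^sup>2) \<le> ennreal G"
    using nn unfolding set_lebesgue_integral_def
    by (subst nn_integral_eq_integral[OF 1[unfolded set_integrable_def], symmetric]) (auto intro!: AE_I2 simp only:, simp)
  then show "(LBINT s:{0..t}. (norm (g s))\<^sup>2) \<le> G" using G by (simp add: ennreal_le_iff)
qed

context shell_model
begin

text \<open>
  \<open>|A\<^bsup>1/2\<^esup>x|\<^sup>2\<close>, with value \<open>\<infinity>\<close> outside \<open>V\<close>. Unlike the norm of \<open>sqrtA_op\<close>, which is \<open>0\<close> there, it is
  lower semicontinuous.
\<close>
definition V_sq :: "ell2 \<Rightarrow> ennreal" where
  "V_sq x = (\<Sum>n. ennreal ((k n * cmod (coord x n))\<^sup>2))"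

lemma borel_measurable_V_sq [measurable]: "V_sq \<in> borel_measurable borel"
proof -
  note [measurable] = measurable_coord
  show ?thesis unfolding V_sq_def[abs_def] by measurable
qed

lemma V_sq_partial: "ennreal (\<Sum>n<N. (k n * cmod (coord x n))\<^sup>2) \<le> V_sq x"
proof -
  have "ennreal (\<Sum>n<N. (k n * cmod (coord x n))\<^sup>2) = (\<Sum>n<N. ennreal ((k n * cmod (coord x n))\<^sup>2))"
    by (rule sum_ennreal[symmetric]) (rule zero_le_power2)
  also have "\<dots> \<le> V_sq x" unfolding V_sq_def by (rule sum_le_suminf) simp_all
  finally show ?thesis .
qed

lemma V_sq_tendsto: "(\<lambda>N. ennreal (\<Sum>n<N. (k n * cmod (coord x n))\<^sup>2)) \<longlonglongrightarrow> V_sq x"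
proof -
  have "(\<lambda>N. \<Sum>n<N. ennreal ((k n * cmod (coord x n))\<^sup>2)) \<longlonglongrightarrow> V_sq x"
    unfolding V_sq_def by (rule summable_LIMSEQ) simp
  moreover have "(\<Sum>n<N. ennreal ((k n * cmod (coord x n))\<^sup>2)) = ennreal (\<Sum>n<N. (k n * cmod (coord x n))\<^sup>2)" for N
    by (rule sum_ennreal) (rule zero_le_power2)
  ultimately show ?thesis by (simp only:)
qed

text \<open>
  The product rule for the symmetric form \<open>(x,y) \<mapsto> (x,Qy)\<close>; it is used for \<open>Q = 1\<close> and for the
  Riccati operator.
\<close>
lemma energy_trunc:
  assumes sol: "diffusion_solution h u0 u" and t: "0 \<le> t"
    and Q: "bounded_linear Q" and sym: "\<And>x y. inner (Q x) y = inner x (Q y)"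
  shows "inner (trunc N (u t)) (Q (trunc N (u t))) = inner (trunc N u0) (Q (trunc N u0))
     + 2 * (LBINT s:{0..t}. inner (Q (trunc N (u s))) (rhs N (h s) (u s)))"
proof -
  note u = diffusion_solutionD[OF sol]
  let ?f = "\<lambda>s. rhs N (h s) (u s)"
  have bb: "bounded_bilinear (\<lambda>x y. inner x (Q y))"
    by (rule bounded_bilinear.comp[OF bounded_bilinear_inner bounded_linear_ident Q])
  have f: "set_integrable lborel {0..t} ?f"
    by (rule set_integrable_diffusion_terms(3)[OF u(1) u(3)[OF t]])
  have F: "trunc N (u s) = trunc N (u 0) + (LBINT r:{0..s}. ?f r)" if "0 \<le> s" "s \<le> t" for s
    using u(4)[OF that(1), of N] u(2) by simp
  have "inner (trunc N (u t)) (Q (trunc N (u t))) = inner (trunc N (u 0)) (Q (trunc N (u 0)))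
      + (LBINT s:{0..t}. inner (?f s) (Q (trunc N (u s))) + inner (trunc N (u s)) (Q (?f s)))"
    by (rule bilinear_integral_product_rule(2)[OF bb t f f F F])
  also have "(\<lambda>s. inner (?f s) (Q (trunc N (u s))) + inner (trunc N (u s)) (Q (?f s)))
      = (\<lambda>s. 2 * inner (Q (trunc N (u s))) (?f s))"
  proof
    fix s
    show "inner (?f s) (Q (trunc N (u s))) + inner (trunc N (u s)) (Q (?f s)) = 2 * inner (Q (trunc N (u s))) (?f s)"
      using sym[of "trunc N (u s)" "?f s"] inner_commute[of "?f s" "Q (trunc N (u s))"] by linarith
  qed
  finally show ?thesis by (simp add: u(2))
qed

lemma norm_trunc_le1: "norm (trunc N x) \<le> 1 * norm x"
  using norm_trunc_le by simp

text \<open>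
  Truncated energies increase with \<open>N\<close>, so monotone convergence yields the dissipation integral.
  Its finiteness shows that \<open>u\<close> takes values in \<open>V\<close> almost everywhere.
\<close>
lemma energy_identity:
  assumes sol: "diffusion_solution h u0 u" and t: "0 \<le> t"
  shows "0 \<le> (norm u0)\<^sup>2 - (norm (u t))\<^sup>2 + 2 * (LBINT s:{0..t}. inner (u s) (h s))"
    and "(\<integral>\<^sup>+ s\<in>{0..t}. V_sq (u s) \<partial>lborel)
      = ennreal (((norm u0)\<^sup>2 - (norm (u t))\<^sup>2 + 2 * (LBINT s:{0..t}. inner (u s) (h s))) / (2 * \<nu>))"
proof -
  note u = diffusion_solutionD[OF sol]
  define S where "S N x = (\<Sum>n<N. (k n * cmod (coord x n))\<^sup>2)" for N x
  have Snn: "0 \<le> S N x" for N x by (simp add: S_def sum_nonneg)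
  have SI: "inner (trunc N x) (A_op k (trunc N x)) = S N x" for N x
    by (simp add: S_def inner_A_trunc)
  have iS: "set_integrable lborel {0..t} (\<lambda>s. S N (u s))" for N
    unfolding SI[symmetric]
    by (intro borel_integrable_atLeastAtMost' continuous_intros
        bounded_linear.continuous_on[OF bounded_linear_A_trunc]
        bounded_linear.continuous_on[OF bounded_linear_trunc] continuous_on_Icc_of_Ici u)
  have iP: "set_integrable lborel {0..t} (\<lambda>s. inner (trunc N (u s)) (trunc N (h s)))" for N
    by (rule set_integrable_bilinear_continuous[OF bounded_bilinear_inner
          bounded_linear.continuous_on[OF bounded_linear_trunc continuous_on_Icc_of_Ici[OF u(1)]]
          set_integrable_diffusion_terms(1)[OF u(1) u(3)[OF t]]])
  define Y where "Y = ((norm u0)\<^sup>2 - (norm (u t))\<^sup>2 + 2 * (LBINT s:{0..t}. inner (u s) (h s))) / (2 * \<nu>)"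
  have eq: "(LBINT s:{0..t}. S N (u s)) = ((norm (trunc N u0))\<^sup>2 - (norm (trunc N (u t)))\<^sup>2
      + 2 * (LBINT s:{0..t}. inner (trunc N (u s)) (trunc N (h s)))) / (2 * \<nu>)" for N
  proof -
    have "(LBINT s:{0..t}. inner (trunc N (u s)) (rhs N (h s) (u s)))
        = (LBINT s:{0..t}. inner (trunc N (u s)) (trunc N (h s)) - \<nu> * S N (u s))"
      by (simp add: inner_diff_right SI)
    also have "\<dots> = (LBINT s:{0..t}. inner (trunc N (u s)) (trunc N (h s))) - \<nu> * (LBINT s:{0..t}. S N (u s))"
      using iS by (subst set_integral_diff(2)[OF iP]) auto
    finally show ?thesis
      using energy_trunc[OF sol t bounded_linear_ident, of N] nu
      by (simp add: power2_norm_eq_inner field_simps)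
  qed
  have lim: "(\<lambda>N. LBINT s:{0..t}. S N (u s)) \<longlonglongrightarrow> Y"
    unfolding eq Y_def
    by (intro tendsto_intros trunc_tendsto tendsto_integral_inner_approx[OF continuous_on_Icc_of_Ici[OF u(1)] u(3)[OF t]
      bounded_linear_trunc norm_trunc_le1 trunc_tendsto bounded_linear_trunc norm_trunc_le1 trunc_tendsto
      bounded_linear_ident bounded_linear_ident]) (use nu in auto)
  have Y0: "0 \<le> Y"
    by (rule LIMSEQ_le_const[OF lim]) (auto intro!: exI[of _ 0] simp: set_lebesgue_integral_def Snn)
  then show "0 \<le> (norm u0)\<^sup>2 - (norm (u t))\<^sup>2 + 2 * (LBINT s:{0..t}. inner (u s) (h s))"
    using nu by (simp add: Y_def zero_le_divide_iff)
  have nnS: "(\<integral>\<^sup>+ s. ennreal (S N (u s)) * indicator {0..t} s \<partial>lborel) = ennreal (LBINT s:{0..t}. S N (u s))" for N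
  proof -
    have "(\<integral>\<^sup>+ s. ennreal (S N (u s)) * indicator {0..t} s \<partial>lborel)
        = (\<integral>\<^sup>+ s. ennreal (indicator {0..t} s *\<^sub>R S N (u s)) \<partial>lborel)"
      by (intro nn_integral_cong) (auto simp: indicator_def)
    also have "\<dots> = ennreal (LBINT s:{0..t}. S N (u s))"
      using iS[of N] Snn unfolding set_integrable_def set_lebesgue_integral_def
      by (intro nn_integral_eq_integral) auto
    finally show ?thesis .
  qed
  have mS: "(\<lambda>s. ennreal (S N (u s)) * indicator {0..t} s) \<in> borel_measurable lborel" for N
  proof -
    have "(\<lambda>s. ennreal (indicator {0..t} s *\<^sub>R S N (u s))) \<in> borel_measurable lborel"
      using iS[of N] unfolding set_integrable_def by (auto dest: borel_measurable_integrable)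
    moreover have "(\<lambda>s. ennreal (indicator {0..t} s *\<^sub>R S N (u s))) = (\<lambda>s. ennreal (S N (u s)) * indicator {0..t} s)"
      by (auto simp: indicator_def)
    ultimately show ?thesis by simp
  qed
  have "(\<lambda>N. \<integral>\<^sup>+ s. ennreal (S N (u s)) * indicator {0..t} s \<partial>lborel) \<longlonglongrightarrow> (\<integral>\<^sup>+ s\<in>{0..t}. V_sq (u s) \<partial>lborel)"
  proof (rule nn_integral_LIMSEQ[OF _ mS])
    show "incseq (\<lambda>N s. ennreal (S N (u s)) * indicator {0..t} s)"
      unfolding incseq_def le_fun_def S_def
      by (auto intro!: mult_right_mono ennreal_leI sum_mono2)
    show "(\<lambda>N. ennreal (S N (u s)) * indicator {0..t} s) \<longlonglongrightarrow> V_sq (u s) * indicator {0..t} s" for s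
      using V_sq_tendsto[of "u s"] by (cases "s \<in> {0..t}") (auto simp: S_def)
  qed
  moreover have "(\<lambda>N. \<integral>\<^sup>+ s. ennreal (S N (u s)) * indicator {0..t} s \<partial>lborel) \<longlonglongrightarrow> ennreal Y"
    unfolding nnS by (rule tendsto_ennrealI[OF lim])
  ultimately show "(\<integral>\<^sup>+ s\<in>{0..t}. V_sq (u s) \<partial>lborel)
      = ennreal (((norm u0)\<^sup>2 - (norm (u t))\<^sup>2 + 2 * (LBINT s:{0..t}. inner (u s) (h s))) / (2 * \<nu>))"
    unfolding Y_def by (rule LIMSEQ_unique)
qed

end

text \<open>
  The closed loop operator is \<open>\<nu>A + M\<close>, and \<open>(x,Rx)\<close> decreases along its semigroup at least at the rate
  \<open>|x|\<^sup>2\<close>. The properties of the game enter through this inequality.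
\<close>
locale lyapunov_shell_model = shell_model +
  fixes M R :: "ell2 \<Rightarrow> ell2"
  assumes M: "bounded_linear M" and R: "bounded_linear R"
    and R_sym: "\<And>x y. inner (R x) y = inner x (R y)" and R_nonneg: "\<And>x. 0 \<le> inner x (R x)"
    and lyapunov: "\<And>x. x \<in> dom_A k \<Longrightarrow> (norm x)\<^sup>2 \<le> 2 * inner (R x) (\<nu> *\<^sub>R A_op k x + M x)"
begin

text \<open>
  The Lyapunov inequality is available on \<open>D(A)\<close> only, hence applied to truncations of \<open>u\<close>. They solve
  the equation up to the commutator \<open>D N = M \<circ> trunc N - trunc N \<circ> M\<close>, which tends to \<open>0\<close> strongly. The
  final value \<open>(u(t),Ru(t))\<close> is nonnegative and is dropped.
\<close>
lemma lyapunov_integral: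
  assumes sol: "diffusion_solution (\<lambda>s. g s - M (u s)) u0 u" and t: "0 \<le> t"
  shows "(LBINT s:{0..t}. (norm (u s))\<^sup>2) \<le> inner u0 (R u0) + 2 * (LBINT s:{0..t}. inner (R (u s)) (g s))"
proof -
  note u = diffusion_solutionD[OF sol]
  have iu: "set_integrable lborel {0..t} u"
    by (rule borel_integrable_atLeastAtMost'[OF continuous_on_Icc_of_Ici[OF u(1)]])
  note iM = set_integrable_bounded_linear[OF M iu]
  have g: "set_integrable lborel {0..t} g"
    using set_integral_add(1)[OF u(3)[OF t] iM] by simp
  define D where "D N x = M (trunc N x) - trunc N (M x)" for N x
  have D: "bounded_linear (D N)" for N
    unfolding D_def by (intro bounded_linear_sub bounded_linear_compose[OF M bounded_linear_trunc]
        bounded_linear_compose[OF bounded_linear_trunc M])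
  obtain K where K: "\<And>x. norm (M x) \<le> norm x * K" "0 \<le> K"
    using bounded_linear.nonneg_bounded[OF M] by blast
  obtain L where L: "\<And>x. norm (R x) \<le> norm x * L" "0 \<le> L"
    using bounded_linear.nonneg_bounded[OF R] by blast
  have Db: "norm (D N x) \<le> (2 * K) * norm x" for N x
  proof -
    have "norm (D N x) \<le> norm (M (trunc N x)) + norm (trunc N (M x))"
      unfolding D_def by (rule norm_triangle_ineq4)
    also have "\<dots> \<le> norm (trunc N x) * K + norm (M x)" by (intro add_mono K norm_trunc_le)
    also have "\<dots> \<le> norm x * K + norm x * K"
      by (intro add_mono K mult_right_mono norm_trunc_le)
    finally show ?thesis by simp
  qed
  have D0: "(\<lambda>N. D N x) \<longlonglongrightarrow> (\<lambda>_. 0) x" for x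
    using tendsto_diff[OF bounded_linear.tendsto[OF M trunc_tendsto[of x]] trunc_tendsto[of "M x"]]
    by (simp add: D_def)
  note RP = bounded_linear_compose[OF R bounded_linear_trunc]
  have RPb: "norm (R (trunc N x)) \<le> L * norm x" for N x
    using L(1)[of "trunc N x"] mult_right_mono[OF norm_trunc_le[of N x] L(2)] by (simp add: mult.commute)
  note uc = continuous_on_Icc_of_Ici[OF u(1)]
  have ii: "set_integrable lborel {0..t} (\<lambda>s. inner (R (trunc N (u s))) (f s))"
    if "set_integrable lborel {0..t} f" for N f
    by (rule set_integrable_bilinear_continuous[OF bounded_bilinear_inner bounded_linear.continuous_on[OF RP uc] that])
  have in2: "set_integrable lborel {0..t} (\<lambda>s. (norm (trunc N (u s)))\<^sup>2)" for N
    by (intro borel_integrable_atLeastAtMost' continuous_intros bounded_linear.continuous_on[OF bounded_linear_trunc uc])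
  define J where "J N = (LBINT s:{0..t}. inner (R (trunc N (u s))) (D N (u s)))" for N
  define G where "G N = (LBINT s:{0..t}. inner (R (trunc N (u s))) (trunc N (g s)))" for N
  have ineq: "(LBINT s:{0..t}. inner (trunc N (u s)) (trunc N (u s))) \<le> inner (trunc N u0) (R (trunc N u0))
      + 2 * (J N + G N)" for N
  proof -
    have i1: "set_integrable lborel {0..t} (\<lambda>s. inner (R (trunc N (u s))) (trunc N (g s - M (u s)) - \<nu> *\<^sub>R A_op k (trunc N (u s))))"
      by (intro ii set_integrable_diffusion_terms(3)[OF u(1) u(3)[OF t]])
    have i2: "set_integrable lborel {0..t} (\<lambda>s. inner (R (trunc N (u s))) (D N (u s)))"
      "set_integrable lborel {0..t} (\<lambda>s. inner (R (trunc N (u s))) (trunc N (g s)))"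
      by (intro ii set_integrable_bounded_linear[OF D iu] set_integrable_bounded_linear[OF bounded_linear_trunc g])+
    have "0 \<le> inner (trunc N (u t)) (R (trunc N (u t)))" by (rule R_nonneg)
    also have "\<dots> = inner (trunc N u0) (R (trunc N u0)) + 2 * (LBINT s:{0..t}. inner (R (trunc N (u s))) (trunc N (g s - M (u s)) - \<nu> *\<^sub>R A_op k (trunc N (u s))))"
      by (rule energy_trunc[OF sol t R R_sym])
    also have "\<dots> \<le> inner (trunc N u0) (R (trunc N u0)) + 2 * (LBINT s:{0..t}.
        (inner (R (trunc N (u s))) (D N (u s)) + inner (R (trunc N (u s))) (trunc N (g s))) - (1/2) * (norm (trunc N (u s)))\<^sup>2)"
    proof (intro add_left_mono mult_left_mono set_integral_mono i1 set_integral_diff(1) set_integral_add(1) i2 set_integrable_mult_right in2)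
      fix s
      have "inner (R (trunc N (u s))) (trunc N (g s - M (u s)) - \<nu> *\<^sub>R A_op k (trunc N (u s)))
          = inner (R (trunc N (u s))) (D N (u s)) + inner (R (trunc N (u s))) (trunc N (g s))
            - inner (R (trunc N (u s))) (\<nu> *\<^sub>R A_op k (trunc N (u s)) + M (trunc N (u s)))"
        unfolding D_def trunc_diff by (simp add: inner_diff_right inner_add_right)
      then show "inner (R (trunc N (u s))) (trunc N (g s - M (u s)) - \<nu> *\<^sub>R A_op k (trunc N (u s)))
          \<le> (inner (R (trunc N (u s))) (D N (u s)) + inner (R (trunc N (u s))) (trunc N (g s))) - (1/2) * (norm (trunc N (u s)))\<^sup>2"
        using lyapunov[OF trunc_in_dom_A[of N "u s"]] by linarith
    qed simp
    also have "(LBINT s:{0..t}. (inner (R (trunc N (u s))) (D N (u s)) + inner (R (trunc N (u s))) (trunc N (g s))) - (1/2) * (norm (trunc N (u s)))\<^sup>2)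
        = (LBINT s:{0..t}. inner (R (trunc N (u s))) (D N (u s)) + inner (R (trunc N (u s))) (trunc N (g s))) - (LBINT s:{0..t}. (1/2) * (norm (trunc N (u s)))\<^sup>2)"
      by (intro set_integral_diff(2) set_integral_add(1) i2 set_integrable_mult_right in2)
    also have "(LBINT s:{0..t}. inner (R (trunc N (u s))) (D N (u s)) + inner (R (trunc N (u s))) (trunc N (g s)))
        = J N + G N"
      unfolding J_def G_def by (intro set_integral_add(2) i2)
    finally show ?thesis unfolding power2_norm_eq_inner by (simp add: set_integral_mult_right)
  qed
  have L1: "(\<lambda>N. LBINT s:{0..t}. inner (trunc N (u s)) (trunc N (u s))) \<longlonglongrightarrow> (LBINT s:{0..t}. inner (u s) (u s))"
    by (rule tendsto_integral_inner_approx[OF uc iu bounded_linear_trunc norm_trunc_le1 trunc_tendsto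
          bounded_linear_trunc norm_trunc_le1 trunc_tendsto bounded_linear_ident bounded_linear_ident])
  have L2: "J \<longlonglongrightarrow> (LBINT s:{0..t}. inner (R (u s)) ((\<lambda>_. 0) (u s)))"
    unfolding J_def by (rule tendsto_integral_inner_approx[OF uc iu RP RPb bounded_linear.tendsto[OF R trunc_tendsto]
          D Db D0 R bounded_linear_zero])
  have L3: "G \<longlonglongrightarrow> (LBINT s:{0..t}. inner (R (u s)) (g s))"
    unfolding G_def by (rule tendsto_integral_inner_approx[OF uc g RP RPb bounded_linear.tendsto[OF R trunc_tendsto]
          bounded_linear_trunc norm_trunc_le1 trunc_tendsto R bounded_linear_ident])
  have "(LBINT s:{0..t}. inner (u s) (u s)) \<le> inner u0 (R u0) + 2 * ((LBINT s:{0..t}. inner (R (u s)) ((\<lambda>_. 0) (u s))) + (LBINT s:{0..t}. inner (R (u s)) (g s)))"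
  proof (rule LIMSEQ_le[OF L1])
    show "(\<lambda>N. inner (trunc N u0) (R (trunc N u0))
      + 2 * (J N + G N))
      \<longlonglongrightarrow> inner u0 (R u0) + 2 * ((LBINT s:{0..t}. inner (R (u s)) ((\<lambda>_. 0) (u s))) + (LBINT s:{0..t}. inner (R (u s)) (g s)))"
      by (intro tendsto_add tendsto_mult_left tendsto_inner trunc_tendsto bounded_linear.tendsto[OF R] L2 L3)
  qed (use ineq in auto)
  then show ?thesis by (simp add: power2_norm_eq_inner)
qed

end

section \<open>The diagonal semigroup\<close>

lemma set_integral_singleton: "(LBINT s:{x::real}. g s) = 0"
  for g :: "real \<Rightarrow> 'a::{banach, second_countable_topology}"
  unfolding set_lebesgue_integral_def
  by (rule integral_eq_zero_AE) (use AE_lborel_singleton[of x] in \<open>eventually_elim, auto simp: indicator_def\<close>)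

context shell_model
begin

text \<open>
  The square of the radius \<open>\<kappa>\<close> in the definition of \<open>\<Sigma>\<^sub>\<kappa>\<close> is used as parameter, which avoids
  square roots in all estimates.
\<close>
definition energy_le :: "real \<Rightarrow> (real \<Rightarrow> ell2) \<Rightarrow> bool" where
  "energy_le c u \<longleftrightarrow> (\<forall>t\<ge>0. (norm (u t))\<^sup>2 \<le> c) \<and> (\<integral>\<^sup>+ s. V_sq (u s) \<partial>half_line) \<le> ennreal c"

text \<open>
  The semigroup generated by \<open>-\<nu>A\<close>, extended by the identity to negative times so that it is bounded
  for every real argument.
\<close>
definition heat_sg :: "real \<Rightarrow> ell2 \<Rightarrow> ell2" where
  "heat_sg t x = Abs_ell2 (\<lambda>n. of_real (exp (- (\<nu> * (k n)\<^sup>2 * max t 0))) * coord x n)"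

lemma coord_heat_sg: "coord (heat_sg t x) n = of_real (exp (- (\<nu> * (k n)\<^sup>2 * max t 0))) * coord x n"
proof -
  have "(\<lambda>n. of_real (exp (- (\<nu> * (k n)\<^sup>2 * max t 0))) * coord x n) \<in> ell2_seqs"
    by (rule ell2_seqs_dominated[where C=1 and y=x]) (use nu in \<open>auto simp: norm_mult intro!: mult_left_le_one_le mult_nonneg_nonneg\<close>)
  then show ?thesis unfolding heat_sg_def by (simp add: Abs_ell2_inverse)
qed

lemma cmod_heat_sg_le: "cmod (coord (heat_sg t x) n) \<le> cmod (coord x n)"
  using nu by (auto simp: coord_heat_sg norm_mult intro!: mult_left_le_one_le mult_nonneg_nonneg)

lemma norm_heat_sg_le: "norm (heat_sg t x) \<le> norm x"
  using norm_ell2_dominated[of 1 "heat_sg t x" x] cmod_heat_sg_le by simp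

lemma bounded_linear_heat_sg: "bounded_linear (heat_sg t)"
proof (rule bounded_linear_intro[where K=1])
  show "norm (heat_sg t x) \<le> norm x * 1" for x using norm_heat_sg_le by simp
qed (auto intro!: ell2_eqI simp: coord_heat_sg algebra_simps scaleR_conv_of_real)

lemma heat_sg_tendsto:
  assumes "X \<longlonglongrightarrow> t"
  shows "(\<lambda>j. heat_sg (X j) x) \<longlonglongrightarrow> heat_sg t x"
proof (rule ell2_tendsto_dominated[where y=x])
  show "(\<lambda>j. coord (heat_sg (X j) x) n) \<longlonglongrightarrow> coord (heat_sg t x) n" for n
    unfolding coord_heat_sg by (intro tendsto_intros assms)
qed (rule cmod_heat_sg_le)

lemma set_integrable_heat_sg:
  assumes h: "set_integrable lborel {0..t} h"
  shows "set_integrable lborel {0..t} (\<lambda>s. heat_sg (t' - s) (h s))"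
proof (rule set_integrable_bound[OF h])
  have mh: "(\<lambda>s. indicator {0..t} s *\<^sub>R h s) \<in> borel_measurable lborel"
    using h unfolding set_integrable_def by (rule borel_measurable_integrable)
  have "(\<lambda>s. heat_sg (t' - s) (indicator {0..t} s *\<^sub>R h s)) \<in> borel_measurable lborel"
  proof (rule borel_measurable_ell2_coord)
    fix n
    have [measurable]: "(\<lambda>s. coord (indicator {0..t} s *\<^sub>R h s) n) \<in> borel_measurable lborel"
      by (rule measurable_compose[OF mh measurable_coord])
    show "(\<lambda>s. coord (heat_sg (t' - s) (indicator {0..t} s *\<^sub>R h s)) n) \<in> borel_measurable lborel"
      unfolding coord_heat_sg by measurable
  qed
  then show "set_borel_measurable lborel {0..t} (\<lambda>s. heat_sg (t' - s) (h s))"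
    unfolding set_borel_measurable_def
    by (simp add: linear_simps(5)[OF bounded_linear_heat_sg])
qed (use norm_heat_sg_le in auto)

definition duhamel :: "ell2 \<Rightarrow> (real \<Rightarrow> ell2) \<Rightarrow> real \<Rightarrow> ell2" where
  "duhamel u0 h t = heat_sg t u0 + (LBINT s:{0..t}. heat_sg (t - s) (h s))"

lemma continuous_on_duhamel:
  assumes h: "\<And>t. 0 \<le> t \<Longrightarrow> set_integrable lborel {0..t} h"
  shows "continuous_on {0..} (duhamel u0 h)"
  unfolding continuous_on_sequentially comp_def
proof (intro ballI allI impI, elim conjE)
  fix X :: "nat \<Rightarrow> real" and t
  assume t: "t \<in> {0..}" and X: "\<forall>n. X n \<in> {0..}" and lim: "X \<longlonglongrightarrow> t"
  obtain T where T: "\<And>n. X n \<le> T"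
    using convergent_imp_bounded[OF lim] unfolding bounded_iff by (auto dest!: abs_le_D1)
  have tT: "t \<le> T" by (rule LIMSEQ_le_const2[OF lim]) (use T in auto)
  have T0: "0 \<le> T" using t tT by simp
  have "(\<lambda>j. LBINT s:{0..X j}. heat_sg (X j - s) (h s)) \<longlonglongrightarrow> (LBINT s:{0..t}. heat_sg (t - s) (h s))"
    unfolding set_lebesgue_integral_def
  proof (rule integral_dominated_convergence[where w="\<lambda>s. indicator {0..T} s *\<^sub>R norm (h s)"])
    show "(\<lambda>s. indicator {0..t} s *\<^sub>R heat_sg (t - s) (h s)) \<in> borel_measurable lborel"
      using set_integrable_heat_sg[OF h] t unfolding set_integrable_def by (auto dest: borel_measurable_integrable)
    show "(\<lambda>s. indicator {0..X j} s *\<^sub>R heat_sg (X j - s) (h s)) \<in> borel_measurable lborel" for j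
      using set_integrable_heat_sg[OF h] X unfolding set_integrable_def by (auto dest: borel_measurable_integrable)
    show "integrable lborel (\<lambda>s. indicator {0..T} s *\<^sub>R norm (h s))"
      using set_integrable_norm[OF h[OF T0]] unfolding set_integrable_def .
    show "AE s in lborel. norm (indicator {0..X j} s *\<^sub>R heat_sg (X j - s) (h s)) \<le> indicator {0..T} s *\<^sub>R norm (h s)" for j
      using T[of j] norm_heat_sg_le by (intro AE_I2) (auto simp: indicator_def)
    show "AE s in lborel. (\<lambda>j. indicator {0..X j} s *\<^sub>R heat_sg (X j - s) (h s)) \<longlonglongrightarrow> indicator {0..t} s *\<^sub>R heat_sg (t - s) (h s)"
      using AE_lborel_singleton[of t]
    proof eventually_elim
      case (elim s)
      have "eventually (\<lambda>j. indicator {0..X j} s = (indicator {0..t} s :: real)) sequentially"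
      proof (cases "s < t")
        case True
        from order_tendstoD(1)[OF lim this] show ?thesis
          by eventually_elim (use True in \<open>auto simp: indicator_def\<close>)
      next
        case False
        with elim have "t < s" by simp
        from order_tendstoD(2)[OF lim this] show ?thesis
          by eventually_elim (use \<open>t < s\<close> in \<open>auto simp: indicator_def\<close>)
      qed
      then have "(\<lambda>j. indicator {0..X j} s :: real) \<longlonglongrightarrow> indicator {0..t} s"
        by (rule tendsto_eventually)
      then show ?case by (intro tendsto_scaleR heat_sg_tendsto tendsto_diff lim tendsto_const)
    qed
  qed
  then show "(\<lambda>j. duhamel u0 h (X j)) \<longlonglongrightarrow> duhamel u0 h t"
    unfolding duhamel_def by (intro tendsto_add heat_sg_tendsto lim)
qed

text \<open>
  In one component, \<open>duhamel\<close> is the product of \<open>e\<^bsup>-mt\<^esup>\<close> and a primitive of \<open>e\<^bsup>ms\<^esup>h\<^sub>n(s)\<close>, and the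
  product rule gives the integrated differential equation.
\<close>
lemma coord_duhamel:
  assumes h: "\<And>t. 0 \<le> t \<Longrightarrow> set_integrable lborel {0..t} h" and t: "0 \<le> t"
  shows "coord (duhamel u0 h t) n
     = coord u0 n + (LBINT s:{0..t}. coord (h s) n - \<nu> *\<^sub>R ((k n)\<^sup>2 *\<^sub>R coord (duhamel u0 h s) n))"
proof -
  define m where "m = \<nu> * (k n)\<^sup>2"
  define F where "F s = exp (- (m * s))" for s
  define f where "f s = - m * exp (- (m * s))" for s
  define g where "g s = exp (m * s) *\<^sub>R coord (h s) n" for s
  define G where "G s = coord u0 n + (LBINT r:{0..s}. g r)" for s
  have hn: "set_integrable lborel {0..s} (\<lambda>r. coord (h r) n)" if "0 \<le> s" for s
    by (rule set_integrable_bounded_linear[OF bounded_linear_coord h[OF that]])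
  have ig: "set_integrable lborel {0..s} g" if "0 \<le> s" for s
    unfolding g_def
    by (rule set_integrable_bilinear_continuous[OF bounded_bilinear_scaleR _ hn[OF that]]) (intro continuous_intros)
  have if': "set_integrable lborel {0..s} f" for s
    unfolding f_def by (intro borel_integrable_atLeastAtMost' continuous_intros)
  have FF: "F s = F 0 + (LBINT r:{0..s}. f r)" if "0 \<le> s" for s
  proof -
    have "(LBINT r:{0..s}. f r) = F s - F 0"
      unfolding set_lebesgue_integral_def
      by (rule integral_FTC_atLeastAtMost[OF that])
        (auto simp: F_def f_def intro!: derivative_eq_intros continuous_intros
          simp flip: has_real_derivative_iff_has_vector_derivative)
    then show ?thesis by simp
  qed
  have cD: "coord (duhamel u0 h s) n = F s *\<^sub>R G s" if s: "0 \<le> s" for s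
  proof -
    have "coord (duhamel u0 h s) n = coord (heat_sg s u0) n + (LBINT r:{0..s}. coord (heat_sg (s - r) (h r)) n)"
      unfolding duhamel_def coord_simps
      using set_integral_bounded_linear[OF bounded_linear_coord set_integrable_heat_sg[OF h[OF s]]] by simp
    also have "(LBINT r:{0..s}. coord (heat_sg (s - r) (h r)) n) = (LBINT r:{0..s}. F s *\<^sub>R g r)"
    proof (rule set_lebesgue_integral_cong)
      show "\<forall>r. r \<in> {0..s} \<longrightarrow> coord (heat_sg (s - r) (h r)) n = F s *\<^sub>R g r"
      proof (intro allI impI)
        fix r assume r: "r \<in> {0..s}"
        have "exp (- (m * (s - r))) = exp (- (m * s)) * exp (m * r)"
          by (simp add: exp_add[symmetric] algebra_simps)
        moreover have "max (s - r) 0 = s - r" using r by simp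
        ultimately show "coord (heat_sg (s - r) (h r)) n = F s *\<^sub>R g r"
          by (simp add: coord_heat_sg F_def g_def m_def[symmetric] scaleR_conv_of_real)
      qed
    qed simp
    also have "\<dots> = F s *\<^sub>R (LBINT r:{0..s}. g r)" by simp
    also have "coord (heat_sg s u0) n = F s *\<^sub>R coord u0 n"
      using s by (simp add: coord_heat_sg F_def m_def scaleR_conv_of_real max_def)
    finally show ?thesis by (simp add: G_def scaleR_add_right)
  qed
  have GG: "G s = G 0 + (LBINT r:{0..s}. g r)" for s
    by (simp add: G_def set_integral_singleton)
  have "F t *\<^sub>R G t = F 0 *\<^sub>R G 0 + (LBINT s:{0..t}. f s *\<^sub>R G s + F s *\<^sub>R g s)"
    by (rule bilinear_integral_product_rule(2)[OF bounded_bilinear_scaleR t if' ig[OF t] FF GG])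
  also have "F 0 *\<^sub>R G 0 = coord u0 n"
    using cD[of 0] GG[of 0] by (simp add: F_def G_def)
  also have "(LBINT s:{0..t}. f s *\<^sub>R G s + F s *\<^sub>R g s)
      = (LBINT s:{0..t}. coord (h s) n - \<nu> *\<^sub>R ((k n)\<^sup>2 *\<^sub>R coord (duhamel u0 h s) n))"
  proof (rule set_lebesgue_integral_cong)
    show "\<forall>s. s \<in> {0..t} \<longrightarrow> f s *\<^sub>R G s + F s *\<^sub>R g s = coord (h s) n - \<nu> *\<^sub>R ((k n)\<^sup>2 *\<^sub>R coord (duhamel u0 h s) n)"
      by (auto simp: cD f_def F_def g_def m_def exp_minus)
  qed simp
  finally show ?thesis using cD[OF t] by simp
qed

lemma duhamel_solution:
  assumes h: "\<And>t. 0 \<le> t \<Longrightarrow> set_integrable lborel {0..t} h"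
  shows "diffusion_solution h u0 (duhamel u0 h)"
  unfolding diffusion_solution_def
proof (intro conjI allI impI h)
  show c: "continuous_on {0..} (duhamel u0 h)" by (rule continuous_on_duhamel[OF h])
  show "duhamel u0 h 0 = u0"
    by (rule ell2_eqI) (simp add: coord_duhamel[OF h] set_integral_singleton)
  fix N and t :: real assume t: "0 \<le> t"
  show "trunc N (duhamel u0 h t) = trunc N u0
      + (LBINT s:{0..t}. trunc N (h s) - \<nu> *\<^sub>R A_op k (trunc N (duhamel u0 h s)))"
  proof (rule ell2_eqI)
    fix n
    have "coord (LBINT s:{0..t}. trunc N (h s) - \<nu> *\<^sub>R A_op k (trunc N (duhamel u0 h s))) n
        = (LBINT s:{0..t}. coord (trunc N (h s) - \<nu> *\<^sub>R A_op k (trunc N (duhamel u0 h s))) n)"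
      by (rule set_integral_bounded_linear[OF bounded_linear_coord set_integrable_diffusion_terms(3)[OF c h[OF t]], symmetric])
    also have "\<dots> = (LBINT s:{0..t}. if n < N then coord (h s) n - \<nu> *\<^sub>R ((k n)\<^sup>2 *\<^sub>R coord (duhamel u0 h s) n) else 0)"
      by (intro set_lebesgue_integral_cong) (auto simp: coord_A_op trunc_in_dom_A scaleR_conv_of_real)
    finally show "coord (trunc N (duhamel u0 h t)) n = coord (trunc N u0
      + (LBINT s:{0..t}. trunc N (h s) - \<nu> *\<^sub>R A_op k (trunc N (duhamel u0 h s)))) n"
      using coord_duhamel[OF h t, of u0 n] by simp
  qed
qed

lemma norm_duhamel_le:
  assumes h: "set_integrable lborel {0..t} h" and t: "0 \<le> t"
  shows "norm (duhamel u0 h t) \<le> norm u0 + (LBINT s:{0..t}. norm (h s))"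
    and "set_integrable lborel {0..t} h' \<Longrightarrow>
      norm (duhamel u0 h t - duhamel u0 h' t) \<le> (LBINT s:{0..t}. norm (h s - h' s))"
proof -
  have *: "norm (LBINT s:{0..t}. heat_sg (t - s) (f s)) \<le> (LBINT s:{0..t}. norm (f s))"
    if f: "set_integrable lborel {0..t} f" for f
  proof -
    have "norm (LBINT s:{0..t}. heat_sg (t - s) (f s)) \<le> (LBINT s:{0..t}. norm (heat_sg (t - s) (f s)))"
      by (rule set_integral_norm_bound[OF set_integrable_heat_sg[OF f]])
    also have "\<dots> \<le> (LBINT s:{0..t}. norm (f s))"
      by (intro set_integral_mono set_integrable_norm set_integrable_heat_sg f norm_heat_sg_le)
    finally show ?thesis .
  qed
  show "norm (duhamel u0 h t) \<le> norm u0 + (LBINT s:{0..t}. norm (h s))"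
    unfolding duhamel_def by (intro norm_triangle_le add_mono norm_heat_sg_le *[OF h])
  assume h': "set_integrable lborel {0..t} h'"
  have "duhamel u0 h t - duhamel u0 h' t = (LBINT s:{0..t}. heat_sg (t - s) (h s - h' s))"
    unfolding duhamel_def
    by (simp add: linear_diff[OF bounded_linear.linear[OF bounded_linear_heat_sg]]
      set_integral_diff(2)[OF set_integrable_heat_sg[OF h] set_integrable_heat_sg[OF h']])
  then show "norm (duhamel u0 h t - duhamel u0 h' t) \<le> (LBINT s:{0..t}. norm (h s - h' s))"
    using *[OF set_integral_diff(1)[OF h h']] by simp
qed

end

section \<open>The linear closed loop equation\<close>

lemma norm_le_one_plus_square: "norm x \<le> 1 + (norm x)\<^sup>2"
proof -
  have "0 \<le> (norm x - 1)\<^sup>2" by simp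
  then have "2 * norm x \<le> 1 + (norm x)\<^sup>2" by (simp add: power2_diff)
  with norm_ge_zero[of x] show ?thesis by linarith
qed

context shell_model
begin

text \<open>
  Fixed point of \<open>u \<mapsto> duhamel u0 (g - Mu)\<close>. In terms of \<open>\<phi>(t) = e\<^bsup>-wt\<^esup>u(t)\<close> the perturbation \<open>M\<close> has
  Lipschitz constant at most \<open>K/w\<close> in the supremum norm over the half line, where \<open>K\<close> bounds \<open>M\<close>.
\<close>
lemma linear_existence:
  assumes M: "bounded_linear M"
    and g: "\<And>t. 0 \<le> t \<Longrightarrow> set_integrable lborel {0..t} g"
    and growth: "\<And>t. 0 \<le> t \<Longrightarrow> (LBINT s:{0..t}. norm (g s)) \<le> A + t"
  shows "\<exists>u. diffusion_solution (\<lambda>s. g s - M (u s)) u0 u"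
proof -
  obtain K where K: "\<And>x. norm (M x) \<le> norm x * K" "0 \<le> K"
    using bounded_linear.nonneg_bounded[OF M] by blast
  (* With this weight the contraction factor K / w is below 1/2. *)
  define w where "w = 2 * K + 1"
  have w: "w > 0" "1 \<le> w" using K(2) by (auto simp: w_def)
  define h where "h \<phi> s = g s - M (exp (w * s) *\<^sub>R \<phi> s)" for \<phi> :: "real \<Rightarrow> ell2" and s
  have iM: "set_integrable lborel {0..t} (\<lambda>s. M (exp (w * s) *\<^sub>R \<phi> s))" if "continuous_on UNIV \<phi>" for \<phi> t
    by (intro borel_integrable_atLeastAtMost' bounded_linear.continuous_on[OF M] continuous_intros
        continuous_on_subset[OF that]) auto
  have h: "set_integrable lborel {0..t} (h \<phi>)" if "continuous_on UNIV \<phi>" "0 \<le> t" for \<phi> t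
    unfolding h_def by (intro set_integral_diff(1) g that iM)
  have expint: "set_integrable lborel {0..t} (\<lambda>s. c * exp (w * s))"
    "0 \<le> t \<Longrightarrow> 0 \<le> c \<Longrightarrow> (LBINT s:{0..t}. c * exp (w * s)) \<le> c / w * exp (w * t)" for c t
  proof -
    show "set_integrable lborel {0..t} (\<lambda>s. c * exp (w * s))"
      by (intro borel_integrable_atLeastAtMost' continuous_intros)
    assume t: "0 \<le> t" and c: "0 \<le> c"
    have "(LBINT s:{0..t}. c * exp (w * s)) = c / w * exp (w * t) - c / w * exp (w * 0)"
      unfolding set_lebesgue_integral_def
      by (rule integral_FTC_atLeastAtMost[OF t])
        (use w in \<open>auto intro!: derivative_eq_intros continuous_intros
          simp flip: has_real_derivative_iff_has_vector_derivative\<close>)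
    then show "(LBINT s:{0..t}. c * exp (w * s)) \<le> c / w * exp (w * t)" using c w by simp
  qed
  have Mle: "norm (M (exp (w * s) *\<^sub>R x)) \<le> (K * B) * exp (w * s)" if "norm x \<le> B" for s x B
  proof -
    have "norm (M (exp (w * s) *\<^sub>R x)) \<le> norm (exp (w * s) *\<^sub>R x) * K" by (rule K)
    also have "\<dots> \<le> (exp (w * s) * B) * K" using that K(2) by (intro mult_right_mono) auto
    finally show ?thesis by (simp add: mult_ac)
  qed
  (* Bounded continuous functions live on the whole line: negative times get the value at 0. *)
  define \<Psi> where "\<Psi> \<phi> t = exp (- (w * max t 0)) *\<^sub>R duhamel u0 (h \<phi>) (max t 0)" for \<phi> t
  have \<Psi>_in: "\<Psi> (apply_bcontfun \<phi>) \<in> bcontfun" for \<phi> :: "real \<Rightarrow>\<^sub>C ell2"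
  proof -
    have cd: "continuous_on {0..} (duhamel u0 (h \<phi>))"
      by (intro continuous_on_duhamel h) auto
    have cm: "continuous_on UNIV (\<lambda>t::real. duhamel u0 (h \<phi>) (max t 0))"
      by (rule continuous_on_compose2[OF cd]) (auto intro!: continuous_intros)
    have c: "continuous_on UNIV (\<Psi> \<phi>)"
      unfolding \<Psi>_def by (intro continuous_intros cm)
    obtain B where B: "\<And>s. norm (\<phi> s) \<le> B"
      using bounded_apply_bcontfun[of \<phi>] unfolding bounded_iff by auto
    have B0: "0 \<le> B" using B[of 0] norm_ge_zero[of "\<phi> 0"] by linarith
    have "norm (\<Psi> \<phi> t) \<le> norm u0 + \<bar>A\<bar> + 1 + K * B / w" for t
    proof -
      define \<tau> where "\<tau> = max t 0"
      have \<tau>: "0 \<le> \<tau>" by (simp add: \<tau>_def)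
      have "norm (duhamel u0 (h \<phi>) \<tau>) \<le> norm u0 + (LBINT s:{0..\<tau>}. norm (h \<phi> s))"
        by (intro norm_duhamel_le(1) h \<tau>) auto
      also have "(LBINT s:{0..\<tau>}. norm (h \<phi> s)) \<le> (LBINT s:{0..\<tau>}. norm (g s) + (K * B) * exp (w * s))"
      proof (intro set_integral_mono set_integrable_norm h \<tau> set_integral_add(1) g expint)
        fix s
        show "norm (h \<phi> s) \<le> norm (g s) + K * B * exp (w * s)"
          unfolding h_def by (intro norm_triangle_le_diff add_mono Mle B order_refl)
      qed auto
      also have "\<dots> = (LBINT s:{0..\<tau>}. norm (g s)) + (LBINT s:{0..\<tau>}. (K * B) * exp (w * s))"
        by (intro set_integral_add(2) set_integrable_norm g \<tau> expint)
      also have "\<dots> \<le> (A + \<tau>) + (K * B) / w * exp (w * \<tau>)"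
        using K(2) B0 by (intro add_mono growth \<tau> expint) auto
      finally have d: "norm (duhamel u0 (h \<phi>) \<tau>) \<le> norm u0 + ((A + \<tau>) + (K * B) / w * exp (w * \<tau>))" by simp
      have e1: "exp (w * \<tau>) \<ge> 1" using w \<tau> by simp
      have e2: "\<tau> \<le> exp (w * \<tau>)"
        using exp_ge_add_one_self[of "w * \<tau>"] mult_right_mono[OF w(2) \<tau>] by linarith
      have e3: "x \<le> x * exp (w * \<tau>)" if "0 \<le> x" for x
        using mult_left_mono[OF e1 that] by simp
      have "norm u0 + ((A + \<tau>) + (K * B) / w * exp (w * \<tau>)) \<le> (norm u0 + \<bar>A\<bar> + 1 + K * B / w) * exp (w * \<tau>)"
        using e3[of "norm u0"] e3[of "\<bar>A\<bar>"] e2 by (simp add: distrib_right)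
      with d have "norm (duhamel u0 (h \<phi>) \<tau>) \<le> (norm u0 + \<bar>A\<bar> + 1 + K * B / w) * exp (w * \<tau>)" by linarith
      then have "exp (- (w * \<tau>)) * norm (duhamel u0 (h \<phi>) \<tau>) \<le> norm u0 + \<bar>A\<bar> + 1 + K * B / w"
        by (simp add: exp_minus field_simps)
      then show ?thesis by (simp add: \<Psi>_def \<tau>_def)
    qed
    then have "bounded (range (\<Psi> \<phi>))" unfolding bounded_iff by blast
    with c show ?thesis by (simp add: bcontfun_def)
  qed
  define F where "F \<phi> = Bcontfun (\<Psi> (apply_bcontfun \<phi>))" for \<phi> :: "real \<Rightarrow>\<^sub>C ell2"
  have F: "apply_bcontfun (F \<phi>) = \<Psi> \<phi>" for \<phi>
    unfolding F_def by (rule Bcontfun_inverse[OF \<Psi>_in])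
  have lip: "dist (F \<phi>) (F \<psi>) \<le> 1/2 * dist \<phi> \<psi>" for \<phi> \<psi>
  proof (rule dist_bound)
    fix t :: real
    define \<tau> where "\<tau> = max t 0"
    have \<tau>: "0 \<le> \<tau>" by (simp add: \<tau>_def)
    have "norm (duhamel u0 (h \<phi>) \<tau> - duhamel u0 (h \<psi>) \<tau>) \<le> (LBINT s:{0..\<tau>}. norm (h \<phi> s - h \<psi> s))"
      by (intro norm_duhamel_le(2) h \<tau>) auto
    also have "\<dots> \<le> (LBINT s:{0..\<tau>}. (K * dist \<phi> \<psi>) * exp (w * s))"
    proof (intro set_integral_mono set_integrable_norm set_integral_diff(1) h \<tau> expint)
      fix s
      have "h \<phi> s - h \<psi> s = M (exp (w * s) *\<^sub>R (\<psi> s - \<phi> s))"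
        unfolding h_def scaleR_right_diff_distrib linear_diff[OF bounded_linear.linear[OF M]] by simp
      moreover have "norm (\<psi> s - \<phi> s) \<le> dist \<phi> \<psi>"
        using dist_bounded[of \<phi> s \<psi>] by (simp add: dist_norm norm_minus_commute)
      ultimately show "norm (h \<phi> s - h \<psi> s) \<le> K * dist \<phi> \<psi> * exp (w * s)" by (simp add: Mle)
    qed auto
    also have "\<dots> \<le> (K * dist \<phi> \<psi>) / w * exp (w * \<tau>)"
      using K(2) by (intro expint(2) \<tau>) auto
    finally have "exp (- (w * \<tau>)) * norm (duhamel u0 (h \<phi>) \<tau> - duhamel u0 (h \<psi>) \<tau>) \<le> (K * dist \<phi> \<psi>) / w"
      by (simp add: exp_minus field_simps)
    also have "\<dots> \<le> 1/2 * dist \<phi> \<psi>"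
      using w zero_le_dist[of \<phi> \<psi>] by (simp add: w_def field_simps)
    finally show "dist (F \<phi> t) (F \<psi> t) \<le> 1/2 * dist \<phi> \<psi>"
      by (simp add: F \<Psi>_def \<tau>_def dist_norm flip: scaleR_right_diff_distrib)
  qed
  obtain \<phi> where \<phi>: "F \<phi> = \<phi>"
    using banach_fix_type[of "1/2" F] lip by auto
  define u where "u t = exp (w * t) *\<^sub>R \<phi> t" for t
  have hu: "h \<phi> = (\<lambda>s. g s - M (u s))" by (auto simp: h_def u_def)
  have "u t = duhamel u0 (h \<phi>) t" if "0 \<le> t" for t
  proof -
    have "\<phi> t = exp (- (w * t)) *\<^sub>R duhamel u0 (h \<phi>) t"
      using fun_cong[OF F[of \<phi>], of t] that unfolding \<phi> \<Psi>_def by (simp add: max_def)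
    then show ?thesis by (simp add: u_def flip: exp_add)
  qed
  moreover have hi: "set_integrable lborel {0..t} (h \<phi>)" if "0 \<le> t" for t by (rule h[OF _ that]) auto
  ultimately have "diffusion_solution (h \<phi>) u0 u"
    by (intro diffusion_solution_cong[OF duhamel_solution[OF hi]]) auto
  then show ?thesis unfolding hu by blast
qed

lemma linear_existence_L2:
  assumes M: "bounded_linear M"
    and g: "\<And>t. 0 \<le> t \<Longrightarrow> set_integrable lborel {0..t} g"
    and G: "0 \<le> G" "sq_int g \<le> ennreal G"
  shows "\<exists>u. diffusion_solution (\<lambda>s. g s - M (u s)) u0 u"
proof (rule linear_existence[OF M g])
  fix t :: real assume t: "0 \<le> t"
  note sq = square_integrable_Icc[OF g[OF t] G]
  have c1: "set_integrable lborel {0..t} (\<lambda>s. 1::real)"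
    by (intro borel_integrable_atLeastAtMost' continuous_intros)
  have "(LBINT s:{0..t}. norm (g s)) \<le> (LBINT s:{0..t}. 1 + (norm (g s))\<^sup>2)"
    by (intro set_integral_mono set_integrable_norm g t set_integral_add(1) sq(1) c1 norm_le_one_plus_square)
  also have "\<dots> = (LBINT s:{0..t}. (1::real)) + (LBINT s:{0..t}. (norm (g s))\<^sup>2)"
    by (intro set_integral_add(2) sq(1) c1)
  also have "(LBINT s:{0..t}. (1::real)) = t"
    using t by (simp add: set_lebesgue_integral_def)
  finally show "(LBINT s:{0..t}. norm (g s)) \<le> G + t" using sq(2) by simp
qed

end

context lyapunov_shell_model
begin

text \<open>
  The constant is independent of the data and of \<open>u\<close>, because it determines the radius of the ball in
  which the nonlinear equation is solved.
\<close>
definition energy_constant :: "real \<Rightarrow> bool" where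
  "energy_constant C \<longleftrightarrow> 1 \<le> C \<and> (\<forall>g u0 u G. diffusion_solution (\<lambda>s. g s - M (u s)) u0 u \<longrightarrow> 0 \<le> G
      \<longrightarrow> sq_int g \<le> ennreal G \<longrightarrow> energy_le (C * ((norm u0)\<^sup>2 + G)) u)"

text \<open>
  The Lyapunov functional controls \<open>\<integral>|u|\<^sup>2\<close> after the term \<open>2(Ru,g)\<close> is split by Young's inequality.
  Then the bounded operator \<open>M\<close> is harmless in the energy identity, which controls the rest.
\<close>
lemma linear_estimate: "\<exists>C. energy_constant C"
proof -
  obtain Km where Km: "\<And>x. norm (M x) \<le> norm x * Km" "0 \<le> Km"
    using bounded_linear.nonneg_bounded[OF M] by blast
  obtain Kr where Kr: "\<And>x. norm (R x) \<le> norm x * Kr" "0 \<le> Kr"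
    using bounded_linear.nonneg_bounded[OF R] by blast
  (* I below is the integral of the square of u; it is at most 2 Kr |u0|^2 + 4 Kr^2 G, and enters the
     energy identity with the factor 1 + 2 Km. *)
  define C1 where "C1 = 1 + (1 + 2 * Km) * (2 * Kr + 4 * Kr\<^sup>2)"
  have C1: "1 \<le> C1" using Km(2) Kr(2) by (simp add: C1_def)
  define C where "C = C1 * (1 + 1 / (2 * \<nu>))"
  have CC1: "C1 \<le> C" "C1 / (2 * \<nu>) \<le> C" using nu C1 by (auto simp: C_def algebra_simps)
  have C: "1 \<le> C" using C1 CC1 by linarith
  have main: "energy_le (C * ((norm u0)\<^sup>2 + G)) u"
    if sol: "diffusion_solution (\<lambda>s. g s - M (u s)) u0 u" and G: "0 \<le> G"
      and le: "sq_int g \<le> ennreal G" for g u0 u G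
  proof -
    note u = diffusion_solutionD[OF sol]
    note uc = continuous_on_Icc_of_Ici[OF u(1)]
    have iu: "set_integrable lborel {0..t} u" for t
      by (rule borel_integrable_atLeastAtMost'[OF uc])
    have g: "set_integrable lborel {0..t} g" if "0 \<le> t" for t
      using set_integral_add(1)[OF u(3)[OF that] set_integrable_bounded_linear[OF M iu]] by simp
    have i2: "set_integrable lborel {0..t} (\<lambda>s. (norm (u s))\<^sup>2)" for t
      by (intro borel_integrable_atLeastAtMost' continuous_intros uc)
    have key: "(norm u0)\<^sup>2 + 2 * (LBINT s:{0..t}. inner (u s) (g s - M (u s))) \<le> C1 * ((norm u0)\<^sup>2 + G)"
      if t: "0 \<le> t" for t
    proof -
      note sq = square_integrable_Icc[OF g[OF t] G le]
      define I where "I = (LBINT s:{0..t}. (norm (u s))\<^sup>2)"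
      have ig: "set_integrable lborel {0..t} (\<lambda>s. inner (R (u s)) (g s))"
        by (rule set_integrable_bilinear_continuous[OF bounded_bilinear_inner bounded_linear.continuous_on[OF R uc] g[OF t]])
      have "(LBINT s:{0..t}. inner (R (u s)) (g s)) \<le> (LBINT s:{0..t}. (1/4) * (norm (u s))\<^sup>2 + Kr\<^sup>2 * (norm (g s))\<^sup>2)"
      proof (intro set_integral_mono ig set_integral_add(1) set_integrable_mult_right i2 sq(1))
        fix s
        have "inner (R (u s)) (g s) \<le> norm (R (u s)) * norm (g s)" by (rule norm_cauchy_schwarz)
        also have "\<dots> \<le> (norm (u s) * Kr) * norm (g s)" by (intro mult_right_mono Kr) auto
        also have "\<dots> \<le> (1/4) * (norm (u s))\<^sup>2 + Kr\<^sup>2 * (norm (g s))\<^sup>2"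
          using zero_le_power2[of "norm (u s) / 2 - Kr * norm (g s)"]
          by (simp add: power2_diff power_divide power_mult_distrib mult_ac)
        finally show "inner (R (u s)) (g s) \<le> (1/4) * (norm (u s))\<^sup>2 + Kr\<^sup>2 * (norm (g s))\<^sup>2" .
      qed
      also have "\<dots> = (1/4) * I + Kr\<^sup>2 * (LBINT s:{0..t}. (norm (g s))\<^sup>2)"
        unfolding I_def using i2 sq(1) by (subst set_integral_add(2)) auto
      also have "\<dots> \<le> (1/4) * I + Kr\<^sup>2 * G"
        by (intro add_left_mono mult_left_mono sq(2)) auto
      finally have 1: "(LBINT s:{0..t}. inner (R (u s)) (g s)) \<le> (1/4) * I + Kr\<^sup>2 * G" .
      have "inner u0 (R u0) \<le> norm u0 * norm (R u0)" by (rule norm_cauchy_schwarz)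
      also have "\<dots> \<le> norm u0 * (norm u0 * Kr)" by (intro mult_left_mono Kr) auto
      finally have 2: "inner u0 (R u0) \<le> Kr * (norm u0)\<^sup>2" by (simp add: power2_eq_square mult_ac)
      define Z where "Z = 2 * Kr * (norm u0)\<^sup>2 + 4 * Kr\<^sup>2 * G"
      have I: "I \<le> Z"
        using lyapunov_integral[OF sol t] 1 2 unfolding I_def Z_def by linarith
      have "(LBINT s:{0..t}. inner (u s) (g s - M (u s))) \<le> (LBINT s:{0..t}. (1/2 + Km) * (norm (u s))\<^sup>2 + (1/2) * (norm (g s))\<^sup>2)"
      proof (intro set_integral_mono set_integral_add(1) set_integrable_mult_right i2 sq(1)
          set_integrable_bilinear_continuous[OF bounded_bilinear_inner uc u(3)[OF t]])
        fix s
        have "- inner (u s) (M (u s)) \<le> norm (u s) * norm (M (u s))"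
          using norm_cauchy_schwarz[of "u s" "- M (u s)"] by simp
        also have "\<dots> \<le> norm (u s) * (norm (u s) * Km)" by (intro mult_left_mono Km) auto
        finally have a: "- inner (u s) (M (u s)) \<le> Km * (norm (u s))\<^sup>2" by (simp add: power2_eq_square mult_ac)
        have "inner (u s) (g s) \<le> norm (u s) * norm (g s)" by (rule norm_cauchy_schwarz)
        also have "\<dots> \<le> (1/2) * (norm (u s))\<^sup>2 + (1/2) * (norm (g s))\<^sup>2"
          using zero_le_power2[of "norm (u s) - norm (g s)"] by (simp add: power2_diff)
        finally show "inner (u s) (g s - M (u s)) \<le> (1/2 + Km) * (norm (u s))\<^sup>2 + (1/2) * (norm (g s))\<^sup>2"
          using a by (simp add: inner_diff_right distrib_right)
      qed
      also have "\<dots> = (1/2 + Km) * I + (1/2) * (LBINT s:{0..t}. (norm (g s))\<^sup>2)"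
        unfolding I_def using i2 sq(1) by (subst set_integral_add(2)) auto
      also have "\<dots> \<le> (1/2 + Km) * Z + (1/2) * G"
        using Km(2) by (intro add_mono mult_left_mono I sq(2)) auto
      finally have 3: "(LBINT s:{0..t}. inner (u s) (g s - M (u s))) \<le> (1/2 + Km) * Z + (1/2) * G" .
      have "Z \<le> (2 * Kr + 4 * Kr\<^sup>2) * ((norm u0)\<^sup>2 + G)"
        using Kr(2) G by (simp add: Z_def algebra_simps)
      then have "(1 + 2 * Km) * Z \<le> (1 + 2 * Km) * ((2 * Kr + 4 * Kr\<^sup>2) * ((norm u0)\<^sup>2 + G))"
        using Km(2) by (intro mult_left_mono) auto
      moreover have "C1 * ((norm u0)\<^sup>2 + G) = (norm u0)\<^sup>2 + G + (1 + 2 * Km) * ((2 * Kr + 4 * Kr\<^sup>2) * ((norm u0)\<^sup>2 + G))"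
        by (simp add: C1_def distrib_right mult.assoc)
      moreover have "2 * ((1/2 + Km) * z + (1/2) * G) = G + (1 + 2 * Km) * z" for z
        by (simp add: algebra_simps)
      note this[of "Z"]
      moreover have "2 * (LBINT s:{0..t}. inner (u s) (g s - M (u s))) \<le> 2 * ((1/2 + Km) * Z + (1/2) * G)"
        using 3 by (intro mult_left_mono) auto
      ultimately show ?thesis by argo
    qed
    have X: "0 \<le> (norm u0)\<^sup>2 + G" using G by simp
    show ?thesis
      unfolding energy_le_def
    proof (intro conjI allI impI)
      fix t :: real assume t: "0 \<le> t"
      have "(norm (u t))\<^sup>2 \<le> C1 * ((norm u0)\<^sup>2 + G)"
        using energy_identity(1)[OF sol t] key[OF t] by linarith
      also have "\<dots> \<le> C * ((norm u0)\<^sup>2 + G)" by (intro mult_right_mono CC1 X)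
      finally show "(norm (u t))\<^sup>2 \<le> C * ((norm u0)\<^sup>2 + G)" .
    next
      have "(\<integral>\<^sup>+ s\<in>{0..t}. V_sq (u s) \<partial>lborel) \<le> ennreal (C * ((norm u0)\<^sup>2 + G))" if t: "0 \<le> t" for t
        unfolding energy_identity(2)[OF sol t]
      proof (rule ennreal_leI)
        have "((norm u0)\<^sup>2 - (norm (u t))\<^sup>2 + 2 * (LBINT s:{0..t}. inner (u s) (g s - M (u s)))) / (2 * \<nu>)
          \<le> (C1 * ((norm u0)\<^sup>2 + G)) / (2 * \<nu>)"
          using key[OF t] zero_le_power2[of "norm (u t)"] nu by (intro divide_right_mono) linarith+
        also have "\<dots> = (C1 / (2 * \<nu>)) * ((norm u0)\<^sup>2 + G)" by simp
        also have "\<dots> \<le> C * ((norm u0)\<^sup>2 + G)" by (intro mult_right_mono CC1 X)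
        finally show "((norm u0)\<^sup>2 - (norm (u t))\<^sup>2 + 2 * (LBINT s:{0..t}. inner (u s) (g s - M (u s)))) / (2 * \<nu>)
          \<le> C * ((norm u0)\<^sup>2 + G)" .
      qed
      then show "(\<integral>\<^sup>+ s. V_sq (u s) \<partial>half_line) \<le> ennreal (C * ((norm u0)\<^sup>2 + G))"
        by (intro nn_integral_half_line_le measurable_compose[OF measurable_half_line_continuous[OF u(1)]]) measurable
    qed
  qed
  with C have "energy_constant C" unfolding energy_constant_def by blast
  then show ?thesis by blast
qed

end

section \<open>The energy space and the quadratic term in it\<close>

context shell_model
begin

abbreviation B :: "ell2 \<Rightarrow> ell2 \<Rightarrow> ell2" where "B \<equiv> B_op k a b"

lemma V_sq_eq_norm_sqrtA: "x \<in> V_space k \<Longrightarrow> V_sq x = ennreal ((norm (sqrtA_op k x))\<^sup>2)"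
  and V_sq_finite_iff: "V_sq x \<noteq> \<infinity> \<longleftrightarrow> x \<in> V_space k"
proof -
  have eq: "(cmod (sqrtA_seq k x n))\<^sup>2 = (k n * cmod (coord x n))\<^sup>2" for n
    using k_pos[of n] by (simp add: sqrtA_seq_def norm_mult)
  show "V_sq x \<noteq> \<infinity> \<longleftrightarrow> x \<in> V_space k"
    unfolding V_sq_def V_space_def mem_Collect_eq ell2_seqs_iff_suminf eq by (simp add: sqrtA_seq_def)
  assume x: "x \<in> V_space k"
  have c: "(cmod (coord (sqrtA_op k x) n))\<^sup>2 = (k n * cmod (coord x n))\<^sup>2" for n
    using k_pos[of n] by (simp add: coord_sqrtA_op[OF x] norm_mult)
  show "V_sq x = ennreal ((norm (sqrtA_op k x))\<^sup>2)"
    unfolding V_sq_def c[symmetric] norm_ell2_sq by (rule suminf_ennreal2[OF zero_le_power2 summable_coord])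
qed

lemma borel_measurable_B:
  assumes f: "f \<in> borel_measurable N" and g: "g \<in> borel_measurable N"
  shows "(\<lambda>s. B (f s) (g s)) \<in> borel_measurable N"
  unfolding B_op_def
proof (rule borel_measurable_to_ell2)
  have [measurable]: "(\<lambda>s. coord (f s) n) \<in> borel_measurable N" "(\<lambda>s. coord (g s) n) \<in> borel_measurable N" for n
    by (rule measurable_compose[OF f measurable_coord] measurable_compose[OF g measurable_coord])+
  have cnj: "cnj \<in> borel_measurable borel"
    by (intro borel_measurable_continuous_onI continuous_intros)
  have [measurable]: "(\<lambda>s. cnj (coord (f s) n)) \<in> borel_measurable N" for n
    by (rule measurable_compose[OF measurable_compose[OF f measurable_coord] cnj])
  show "(\<lambda>s. B_seq k a b (f s) (g s) n) \<in> borel_measurable N" for n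
    by (cases "n = 0") (simp_all add: B_seq_def)
qed (simp add: B_seq_def)

lemma B_sq_bound:
  "ennreal ((norm (B x y))\<^sup>2) \<le> ennreal (cB\<^sup>2 * (norm x)\<^sup>2) * V_sq y"
  "ennreal ((norm (B y x))\<^sup>2) \<le> ennreal (cB\<^sup>2 * (norm x)\<^sup>2) * V_sq y"
  if "y \<in> V_space k"
proof -
  have "(norm (B x y))\<^sup>2 \<le> (cB\<^sup>2 * (norm x)\<^sup>2) * (norm (sqrtA_op k y))\<^sup>2"
    using power_mono[OF B_op_bound_right(2)[OF that, of x] norm_ge_zero, of 2] by (simp add: power_mult_distrib)
  then show "ennreal ((norm (B x y))\<^sup>2) \<le> ennreal (cB\<^sup>2 * (norm x)\<^sup>2) * V_sq y"
    unfolding V_sq_eq_norm_sqrtA[OF that] by (subst ennreal_mult[symmetric]) (auto intro: ennreal_leI)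
  have "(norm (B y x))\<^sup>2 \<le> (cB\<^sup>2 * (norm x)\<^sup>2) * (norm (sqrtA_op k y))\<^sup>2"
    using power_mono[OF B_op_bound_left(2)[OF that, of x] norm_ge_zero, of 2] by (simp add: power_mult_distrib mult_ac)
  then show "ennreal ((norm (B y x))\<^sup>2) \<le> ennreal (cB\<^sup>2 * (norm x)\<^sup>2) * V_sq y"
    unfolding V_sq_eq_norm_sqrtA[OF that] by (subst ennreal_mult[symmetric]) (auto intro: ennreal_leI)
qed

lemma energy_le_nonneg: "energy_le c u \<Longrightarrow> 0 \<le> c"
  unfolding energy_le_def using zero_le_power2[of "norm (u 0)"] by (meson order_refl order_trans)

lemma energy_le_mono: "energy_le c u \<Longrightarrow> c \<le> c' \<Longrightarrow> energy_le c' u"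
  unfolding energy_le_def using ennreal_leI by (meson order_trans)

lemma measurable_V_sq_half_line:
  "continuous_on {0..} u \<Longrightarrow> (\<lambda>s. V_sq (u s)) \<in> borel_measurable half_line"
  by (intro measurable_compose[OF measurable_half_line_continuous]) auto

lemma AE_V_space:
  assumes "continuous_on {0..} u" "energy_le c u"
  shows "AE s in half_line. u s \<in> V_space k"
proof -
  have "AE s in half_line. V_sq (u s) \<noteq> \<infinity>"
    using assms by (intro nn_integral_PInf_AE measurable_V_sq_half_line)
      (auto simp: energy_le_def top_unique)
  then show ?thesis unfolding V_sq_finite_iff .
qed

text \<open>
  One argument of \<open>B\<close> is measured in \<open>L\<^sup>2(0,\<infinity>;V)\<close>, the other one uniformly in \<open>H\<close>.
\<close>
lemma nn_integral_B_le:
  assumes u: "continuous_on {0..} u" "energy_le c u" and v: "\<And>t. 0 \<le> t \<Longrightarrow> (norm (v t))\<^sup>2 \<le> d" and d: "0 \<le> d"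
  shows "sq_int (\<lambda>s. B (v s) (u s)) \<le> ennreal (cB\<^sup>2 * d * c)"
    and "sq_int (\<lambda>s. B (u s) (v s)) \<le> ennreal (cB\<^sup>2 * d * c)"
proof -
  note c0 = energy_le_nonneg[OF u(2)]
  have pt: "ennreal ((norm (B (v s) (u s)))\<^sup>2) \<le> ennreal (cB\<^sup>2 * d) * V_sq (u s)"
    "ennreal ((norm (B (u s) (v s)))\<^sup>2) \<le> ennreal (cB\<^sup>2 * d) * V_sq (u s)"
    if "0 \<le> s" "u s \<in> V_space k" for s
  proof -
    have "ennreal (cB\<^sup>2 * (norm (v s))\<^sup>2) * V_sq (u s) \<le> ennreal (cB\<^sup>2 * d) * V_sq (u s)"
      by (intro mult_right_mono ennreal_leI mult_left_mono v that) auto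
    with B_sq_bound[OF that(2), of "v s"] show "ennreal ((norm (B (v s) (u s)))\<^sup>2) \<le> ennreal (cB\<^sup>2 * d) * V_sq (u s)"
      "ennreal ((norm (B (u s) (v s)))\<^sup>2) \<le> ennreal (cB\<^sup>2 * d) * V_sq (u s)"
      by (meson order_trans)+
  qed
  have AE0: "AE s in half_line. 0 \<le> s"
    by (rule AE_I2) (simp add: space_restrict_space)
  have c1: "(\<integral>\<^sup>+ s. ennreal (cB\<^sup>2 * d) * V_sq (u s) \<partial>half_line) \<le> ennreal (cB\<^sup>2 * d * c)"
  proof -
    have "(\<integral>\<^sup>+ s. ennreal (cB\<^sup>2 * d) * V_sq (u s) \<partial>half_line) = ennreal (cB\<^sup>2 * d) * (\<integral>\<^sup>+ s. V_sq (u s) \<partial>half_line)"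
      by (rule nn_integral_cmult[OF measurable_V_sq_half_line[OF u(1)]])
    also have "\<dots> \<le> ennreal (cB\<^sup>2 * d) * ennreal c"
      using u(2) by (intro mult_left_mono) (auto simp: energy_le_def)
    also have "\<dots> = ennreal (cB\<^sup>2 * d * c)" using c0 d by (simp add: ennreal_mult)
    finally show ?thesis .
  qed
  have "sq_int (\<lambda>s. B (v s) (u s)) \<le> (\<integral>\<^sup>+ s. ennreal (cB\<^sup>2 * d) * V_sq (u s) \<partial>half_line)"
    by (rule nn_integral_mono_AE, use AE_V_space[OF u] AE0 in eventually_elim) (rule pt(1))
  with c1 show "sq_int (\<lambda>s. B (v s) (u s)) \<le> ennreal (cB\<^sup>2 * d * c)" by (rule order_trans[rotated])
  have "sq_int (\<lambda>s. B (u s) (v s)) \<le> (\<integral>\<^sup>+ s. ennreal (cB\<^sup>2 * d) * V_sq (u s) \<partial>half_line)"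
    by (rule nn_integral_mono_AE, use AE_V_space[OF u] AE0 in eventually_elim) (rule pt(2))
  with c1 show "sq_int (\<lambda>s. B (u s) (v s)) \<le> ennreal (cB\<^sup>2 * d * c)" by (rule order_trans[rotated])
qed

lemma nn_integral_square_add_le:
  fixes f g :: "real \<Rightarrow> ell2"
  assumes fg: "AE s in half_line. norm (h s) \<le> norm (f s) + norm (g s)"
    and m: "f \<in> borel_measurable half_line" "g \<in> borel_measurable half_line"
    and F: "sq_int f \<le> ennreal F" "0 \<le> F"
    and G: "sq_int g \<le> ennreal G" "0 \<le> G"
  shows "sq_int h \<le> ennreal (2 * F + 2 * G)"
proof -
  have mf: "(\<lambda>s. ennreal ((norm (f s))\<^sup>2)) \<in> borel_measurable half_line"
    and mg: "(\<lambda>s. ennreal ((norm (g s))\<^sup>2)) \<in> borel_measurable half_line"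
    using m by measurable
  have "sq_int h
      \<le> (\<integral>\<^sup>+ s. 2 * ennreal ((norm (f s))\<^sup>2) + 2 * ennreal ((norm (g s))\<^sup>2) \<partial>half_line)"
    using fg
  proof (intro nn_integral_mono_AE, eventually_elim)
    case (elim s)
    have "(norm (h s))\<^sup>2 \<le> (norm (f s) + norm (g s))\<^sup>2" using elim by (intro power_mono) auto
    also have "\<dots> \<le> 2 * (norm (f s))\<^sup>2 + 2 * (norm (g s))\<^sup>2"
      using zero_le_power2[of "norm (f s) - norm (g s)"] by (simp add: power2_sum power2_diff)
    finally have "ennreal ((norm (h s))\<^sup>2) \<le> ennreal (2 * (norm (f s))\<^sup>2 + 2 * (norm (g s))\<^sup>2)"
      by (rule ennreal_leI)
    also have "\<dots> = 2 * ennreal ((norm (f s))\<^sup>2) + 2 * ennreal ((norm (g s))\<^sup>2)"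
      by (subst ennreal_plus) (simp_all add: ennreal_mult)
    finally show ?case .
  qed
  also have "\<dots> = 2 * sq_int f + 2 * sq_int g"
    using mf mg by (simp add: nn_integral_add nn_integral_cmult)
  also have "\<dots> \<le> 2 * ennreal F + 2 * ennreal G"
    by (intro add_mono mult_left_mono F G) auto
  also have "\<dots> = ennreal (2 * F + 2 * G)"
    using F(2) G(2) by (subst ennreal_plus) (simp_all add: ennreal_mult)
  finally show ?thesis .
qed

lemma V_sq_add_le: "V_sq (x + y) \<le> 2 * V_sq x + 2 * V_sq y"
proof -
  have p: "ennreal ((k n * cmod (coord (x + y) n))\<^sup>2) \<le> 2 * ennreal ((k n * cmod (coord x n))\<^sup>2) + 2 * ennreal ((k n * cmod (coord y n))\<^sup>2)" for n
  proof -
    have "(k n * cmod (coord (x + y) n))\<^sup>2 \<le> 2 * (k n * cmod (coord x n))\<^sup>2 + 2 * (k n * cmod (coord y n))\<^sup>2"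
      using mult_left_mono[OF cmod_add_sq_le[of "coord x n" "coord y n"], of "(k n)\<^sup>2"]
      by (simp add: power_mult_distrib algebra_simps)
    then have "ennreal ((k n * cmod (coord (x + y) n))\<^sup>2) \<le> ennreal (2 * (k n * cmod (coord x n))\<^sup>2 + 2 * (k n * cmod (coord y n))\<^sup>2)"
      by (rule ennreal_leI)
    also have "\<dots> = 2 * ennreal ((k n * cmod (coord x n))\<^sup>2) + 2 * ennreal ((k n * cmod (coord y n))\<^sup>2)"
      by (subst ennreal_plus) (simp_all add: ennreal_mult del: coord_simps)
    finally show ?thesis .
  qed
  have "V_sq (x + y) \<le> (\<Sum>n. 2 * ennreal ((k n * cmod (coord x n))\<^sup>2) + 2 * ennreal ((k n * cmod (coord y n))\<^sup>2))"
    unfolding V_sq_def by (intro suminf_le p) auto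
  also have "\<dots> = 2 * V_sq x + 2 * V_sq y"
    unfolding V_sq_def by (simp add: suminf_add[symmetric] ennreal_suminf_cmult)
  finally show ?thesis .
qed

lemma energy_le_add:
  assumes "continuous_on {0..} u" "continuous_on {0..} v" "energy_le c u" "energy_le d v"
  shows "energy_le (2 * c + 2 * d) (\<lambda>t. u t + v t)"
  unfolding energy_le_def
proof (intro conjI allI impI)
  note cd = energy_le_nonneg[OF assms(3)] energy_le_nonneg[OF assms(4)]
  fix t :: real assume t: "0 \<le> t"
  have "(norm (u t + v t))\<^sup>2 \<le> (norm (u t) + norm (v t))\<^sup>2"
    by (intro power_mono norm_triangle_ineq) auto
  also have "\<dots> \<le> 2 * (norm (u t))\<^sup>2 + 2 * (norm (v t))\<^sup>2"
    using zero_le_power2[of "norm (u t) - norm (v t)"] by (simp add: power2_sum power2_diff)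
  also have "\<dots> \<le> 2 * c + 2 * d" using assms(3,4) t unfolding energy_le_def by (intro add_mono mult_left_mono) auto
  finally show "(norm (u t + v t))\<^sup>2 \<le> 2 * c + 2 * d" .
next
  note cd = energy_le_nonneg[OF assms(3)] energy_le_nonneg[OF assms(4)]
  have "(\<integral>\<^sup>+ s. V_sq (u s + v s) \<partial>half_line) \<le> (\<integral>\<^sup>+ s. 2 * V_sq (u s) + 2 * V_sq (v s) \<partial>half_line)"
    by (intro nn_integral_mono V_sq_add_le)
  also have "\<dots> = 2 * (\<integral>\<^sup>+ s. V_sq (u s) \<partial>half_line) + 2 * (\<integral>\<^sup>+ s. V_sq (v s) \<partial>half_line)"
    using measurable_V_sq_half_line[OF assms(1)] measurable_V_sq_half_line[OF assms(2)]
    by (simp add: nn_integral_add nn_integral_cmult)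
  also have "\<dots> \<le> 2 * ennreal c + 2 * ennreal d"
    using assms(3,4) by (intro add_mono mult_left_mono) (auto simp: energy_le_def)
  also have "\<dots> = ennreal (2 * c + 2 * d)"
    using cd by (subst ennreal_plus) (simp_all add: ennreal_mult)
  finally show "(\<integral>\<^sup>+ s. V_sq (u s + v s) \<partial>half_line) \<le> ennreal (2 * c + 2 * d)" .
qed

lemma V_sq_le_liminf:
  assumes "X \<longlonglongrightarrow> x"
  shows "V_sq x \<le> liminf (\<lambda>j. V_sq (X j))"
proof (rule LIMSEQ_le_const2[OF V_sq_tendsto], intro exI[of _ 0] allI impI)
  fix N
  have "(\<lambda>j. \<Sum>n<N. (k n * cmod (coord (X j) n))\<^sup>2) \<longlonglongrightarrow> (\<Sum>n<N. (k n * cmod (coord x n))\<^sup>2)"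
    by (intro tendsto_intros bounded_linear.tendsto[OF bounded_linear_coord] assms)
  then have "(\<lambda>j. ennreal (\<Sum>n<N. (k n * cmod (coord (X j) n))\<^sup>2)) \<longlonglongrightarrow> ennreal (\<Sum>n<N. (k n * cmod (coord x n))\<^sup>2)"
    by (rule tendsto_ennrealI)
  then have "ennreal (\<Sum>n<N. (k n * cmod (coord x n))\<^sup>2) = liminf (\<lambda>j. ennreal (\<Sum>n<N. (k n * cmod (coord (X j) n))\<^sup>2))"
    by (simp add: lim_imp_Liminf)
  also have "\<dots> \<le> liminf (\<lambda>j. V_sq (X j))"
    by (intro Liminf_mono always_eventually allI V_sq_partial)
  finally show "ennreal (\<Sum>n<N. (k n * cmod (coord x n))\<^sup>2) \<le> liminf (\<lambda>j. V_sq (X j))" .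
qed

text \<open>
  The set of functions with \<open>energy_le c\<close> is closed under pointwise limits, by Fatou's lemma. The
  iteration below therefore needs to converge uniformly in \<open>H\<close> only.
\<close>
lemma energy_le_limit:
  assumes c: "\<And>j. continuous_on {0..} (U j)" and lim: "\<And>t. 0 \<le> t \<Longrightarrow> (\<lambda>j. U j t) \<longlonglongrightarrow> u t"
    and b: "\<And>j. energy_le c (U j)"
  shows "energy_le c u"
  unfolding energy_le_def
proof (intro conjI allI impI)
  fix t :: real assume t: "0 \<le> t"
  show "(norm (u t))\<^sup>2 \<le> c"
    by (rule LIMSEQ_le_const2[OF tendsto_power[OF tendsto_norm[OF lim[OF t]]]]) (use b t in \<open>auto simp: energy_le_def\<close>)
next
  have "(\<integral>\<^sup>+ s. V_sq (u s) \<partial>half_line) \<le> (\<integral>\<^sup>+ s. liminf (\<lambda>j. V_sq (U j s)) \<partial>half_line)"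
    by (intro nn_integral_mono V_sq_le_liminf lim) (simp add: space_restrict_space)
  also have "\<dots> \<le> liminf (\<lambda>j. \<integral>\<^sup>+ s. V_sq (U j s) \<partial>half_line)"
    by (intro nn_integral_liminf measurable_V_sq_half_line c)
  also have "\<dots> \<le> liminf (\<lambda>j. ennreal c)"
    using b by (intro Liminf_mono always_eventually allI) (auto simp: energy_le_def)
  also have "\<dots> = ennreal c" by (simp add: Liminf_const)
  finally show "(\<integral>\<^sup>+ s. V_sq (u s) \<partial>half_line) \<le> ennreal c" .
qed

end

section \<open>Contraction for small data\<close>

lemma set_integrable_of_L2:
  fixes f :: "real \<Rightarrow> 'a::{banach, second_countable_topology}"
  assumes m: "f \<in> borel_measurable half_line"
    and F: "sq_int f < \<infinity>"
  shows "set_integrable lborel {0..t} f"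
proof -
  have m0: "(\<lambda>s. indicator {0..} s *\<^sub>R f s) \<in> borel_measurable lborel"
    using m by (simp add: borel_measurable_restrict_space_iff)
  have "(\<lambda>s. indicator {0..t} s *\<^sub>R (indicator {0..} s *\<^sub>R f s)) \<in> borel_measurable lborel"
    using m0 by measurable
  moreover have "(\<lambda>s. indicator {0..t} s *\<^sub>R (indicator {0..} s *\<^sub>R f s)) = (\<lambda>s. indicator {0..t} s *\<^sub>R f s)"
    by (auto simp: indicator_def)
  ultimately have m1: "(\<lambda>s. indicator {0..t} s *\<^sub>R f s) \<in> borel_measurable lborel" by simp
  have pt: "ennreal (norm (indicator {0..t} s *\<^sub>R f s))
      \<le> indicator {0..t} s + ennreal ((norm (f s))\<^sup>2) * indicator {0..} s" for s
  proof (cases "s \<in> {0..t}")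
    case True
    have "ennreal (norm (f s)) \<le> ennreal (1 + (norm (f s))\<^sup>2)"
      by (rule ennreal_leI[OF norm_le_one_plus_square])
    also have "\<dots> = 1 + ennreal ((norm (f s))\<^sup>2)" by (subst ennreal_plus) simp_all
    finally show ?thesis using True by (simp add: indicator_def)
  qed simp
  have mf: "(\<lambda>s. ennreal ((norm (f s))\<^sup>2) * indicator {0..} s) \<in> borel_measurable lborel"
  proof -
    have "(\<lambda>s. ennreal ((norm (f s))\<^sup>2)) \<in> borel_measurable half_line" using m by measurable
    then show ?thesis
      by (rule borel_measurable_restrict_space_iff_ennreal[THEN iffD1, rotated]) simp
  qed
  have "(\<integral>\<^sup>+ s. ennreal (norm (indicator {0..t} s *\<^sub>R f s)) \<partial>lborel)
      \<le> (\<integral>\<^sup>+ s. indicator {0..t} s + ennreal ((norm (f s))\<^sup>2) * indicator {0..} s \<partial>lborel)"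
    by (rule nn_integral_mono[OF pt])
  also have "\<dots> = emeasure lborel {0..t} + sq_int f"
    using mf by (simp add: nn_integral_add nn_integral_restrict_space)
  also have "\<dots> < \<infinity>" using F by (simp add: emeasure_lborel_Icc_eq)
  finally show ?thesis unfolding set_integrable_def by (rule integrableI_bounded[OF m1])
qed

context lyapunov_shell_model
begin

text \<open>
  Picard iteration for \<open>u \<mapsto> S u\<close>, the solution of the linear closed loop equation with right-hand
  side \<open>p - B(u)\<close>. The condition \<open>C (|u0|\<^sup>2 + 2W + 2cB\<^sup>2K\<^sup>2) \<le> K\<close> keeps the iterates in the ball; the
  condition \<open>16 C cB\<^sup>2 K \<le> 1\<close> makes \<open>S\<close> reduce squared distances by the factor \<open>4\<close>.
\<close>
lemma small_data_existence:
  assumes EC: "energy_constant C"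
    and p: "p \<in> borel_measurable half_line" "sq_int p \<le> ennreal W" "0 \<le> W"
    and K: "0 < K" "C * ((norm u0)\<^sup>2 + (2 * W + 2 * (cB\<^sup>2 * K * K))) \<le> K" "16 * (C * cB\<^sup>2) * K \<le> 1"
  shows "\<exists>u. energy_le K u \<and> diffusion_solution (\<lambda>s. (p s - B (u s) (u s)) - M (u s)) u0 u"
proof -
  have C: "energy_le (C * ((norm u0)\<^sup>2 + G)) u" if "diffusion_solution (\<lambda>s. g s - M (u s)) u0 u" "0 \<le> G"
      "sq_int g \<le> ennreal G" for g u0 u G
    using EC that unfolding energy_constant_def by blast
  define X where "X = {u. continuous_on {0..} u \<and> energy_le K u}"
  define force where "force u s = p s - B (u s) (u s)" for u s
  have Xm: "u \<in> borel_measurable half_line" if "u \<in> X" for u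
    using that by (auto simp: X_def intro: measurable_half_line_continuous)
  have BXm: "(\<lambda>s. B (u s) (v s)) \<in> borel_measurable half_line" if "continuous_on {0..} u" "continuous_on {0..} v" for u v
    by (rule borel_measurable_B[OF that[THEN measurable_half_line_continuous]])
  have fm: "force u \<in> borel_measurable half_line" if "u \<in> X" for u
    unfolding force_def[abs_def]
    using borel_measurable_diff[OF p(1) BXm[of u u]] that by (simp add: X_def)
  have fL2: "sq_int (\<lambda>s. force u s) \<le> ennreal (2 * W + 2 * (cB\<^sup>2 * K * K))" if "u \<in> X" for u
  proof (rule nn_integral_square_add_le[OF _ p(1) _ p(2,3)])
    have u: "continuous_on {0..} u" "energy_le K u" using that by (auto simp: X_def)
    show "AE s in half_line. norm (force u s) \<le> norm (p s) + norm (B (u s) (u s))"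
      by (intro AE_I2) (simp add: force_def norm_triangle_ineq4)
    show "(\<lambda>s. B (u s) (u s)) \<in> borel_measurable half_line" by (rule BXm[OF u(1) u(1)])
    show "sq_int (\<lambda>s. B (u s) (u s)) \<le> ennreal (cB\<^sup>2 * K * K)"
      by (rule nn_integral_B_le(1)[OF u]) (use u(2) K(1) in \<open>auto simp: energy_le_def\<close>)
  qed (use K(1) in auto)
  have G0: "0 \<le> 2 * W + 2 * (cB\<^sup>2 * K * K)" using p(3) K(1) by simp
  have fi: "set_integrable lborel {0..t} (force u)" if "u \<in> X" for u t
    by (rule set_integrable_of_L2[OF fm[OF that] le_less_trans[OF fL2[OF that]]]) simp
  define S where "S u = (SOME v. diffusion_solution (\<lambda>s. force u s - M (v s)) u0 v)" for u
  have S: "diffusion_solution (\<lambda>s. force u s - M (S u s)) u0 (S u)" if "u \<in> X" for u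
    unfolding S_def
    by (rule someI_ex[OF linear_existence_L2[OF M fi[OF that] G0 fL2[OF that]]])
  have SX: "S u \<in> X" if "u \<in> X" for u
    using diffusion_solutionD(1)[OF S[OF that]] energy_le_mono[OF C[OF S[OF that] G0 fL2[OF that]] K(2)]
    by (simp add: X_def)
  have contr: "energy_le (c / 4) (\<lambda>s. S u s - S v s)" if u: "u \<in> X" and v: "v \<in> X" and c: "energy_le c (\<lambda>s. u s - v s)" for u v c
  proof -
    have u': "continuous_on {0..} u" "energy_le K u" and v': "continuous_on {0..} v" "energy_le K v"
      using u v by (auto simp: X_def)
    have d': "continuous_on {0..} (\<lambda>s. u s - v s)" by (intro continuous_intros u' v')
    note c0 = energy_le_nonneg[OF c]
    have "diffusion_solution (\<lambda>s. (force u s - M (S u s)) - (force v s - M (S v s))) (u0 - u0) (\<lambda>s. S u s - S v s)"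
      by (rule diffusion_solution_diff[OF S[OF u] S[OF v]])
    also have "(\<lambda>s. (force u s - M (S u s)) - (force v s - M (S v s))) = (\<lambda>s. (force u s - force v s) - M (S u s - S v s))"
      by (simp add: linear_diff[OF bounded_linear.linear[OF M]] algebra_simps)
    finally have sol: "diffusion_solution (\<lambda>s. (force u s - force v s) - M (S u s - S v s)) 0 (\<lambda>s. S u s - S v s)" by simp
    have L2: "sq_int (\<lambda>s. force u s - force v s) \<le> ennreal (2 * (cB\<^sup>2 * c * K) + 2 * (cB\<^sup>2 * K * c))"
    proof (rule nn_integral_square_add_le)
      show "AE s in half_line. norm (force u s - force v s) \<le> norm (B (u s - v s) (u s)) + norm (B (v s) (u s - v s))"
        using AE_V_space[OF u'] AE_V_space[OF v']
      proof eventually_elim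
        case (elim s)
        have "force u s - force v s = - (B (u s) (u s) - B (v s) (v s))" by (simp add: force_def)
        also have "\<dots> = - (B (u s - v s) (u s) + B (v s) (u s - v s))"
          by (simp only: B_op_diff_quadratic[OF elim])
        finally show ?case by (metis norm_minus_cancel norm_triangle_ineq)
      qed
      show "(\<lambda>s. B (u s - v s) (u s)) \<in> borel_measurable half_line" by (rule BXm[OF d' u'(1)])
      show "(\<lambda>s. B (v s) (u s - v s)) \<in> borel_measurable half_line" by (rule BXm[OF v'(1) d'])
      show "sq_int (\<lambda>s. B (u s - v s) (u s)) \<le> ennreal (cB\<^sup>2 * c * K)"
        by (rule nn_integral_B_le(1)[OF u']) (use c c0 in \<open>auto simp: energy_le_def\<close>)
      show "sq_int (\<lambda>s. B (v s) (u s - v s)) \<le> ennreal (cB\<^sup>2 * K * c)"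
        by (rule nn_integral_B_le(1)[OF d' c]) (use v'(2) K(1) in \<open>auto simp: energy_le_def\<close>)
    qed (use c0 K(1) in auto)
    have "energy_le (C * ((norm (0::ell2))\<^sup>2 + (2 * (cB\<^sup>2 * c * K) + 2 * (cB\<^sup>2 * K * c)))) (\<lambda>s. S u s - S v s)"
      by (rule C[OF sol _ L2]) (use c0 K(1) in auto)
    moreover have "C * ((norm (0::ell2))\<^sup>2 + (2 * (cB\<^sup>2 * c * K) + 2 * (cB\<^sup>2 * K * c))) \<le> c / 4"
      using mult_right_mono[OF K(3) c0] by (simp add: algebra_simps)
    ultimately show ?thesis by (rule energy_le_mono)
  qed
  define U where "U m = (S ^^ m) (\<lambda>_. 0)" for m
  have z: "energy_le 0 (\<lambda>_. 0)" by (simp add: energy_le_def V_sq_def)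
  have UX: "U m \<in> X" for m
  proof (induction m)
    case 0
    show ?case using energy_le_mono[OF z, of K] K(1) by (simp add: U_def X_def)
  qed (simp add: U_def SX)
  have U0: "U 0 = (\<lambda>_. 0)" and US: "U (Suc m) = S (U m)" for m by (auto simp: U_def)
  have Uc: "continuous_on {0..} (U m)" and Ub: "energy_le K (U m)" for m using UX by (auto simp: X_def)
  (* Squared distances of consecutive iterates. As (x + y)^2 <= 2 x^2 + 2 y^2 and
     2 * (4 * d (m + 1)) + 2 * d m = 4 * d m, all later iterates stay within 4 * d m of U m. *)
  define d where "d m = K / 4 ^ m" for m :: nat
  have d: "0 \<le> d m" "d (Suc m) = d m / 4" for m using K(1) by (auto simp: d_def)
  have inc: "energy_le (d m) (\<lambda>s. U (Suc m) s - U m s)" for m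
  proof (induction m)
    case 0
    show ?case using Ub[of 1] by (simp add: d_def U0)
  next
    case (Suc m)
    show ?case using contr[OF UX UX Suc] by (simp add: US d)
  qed
  have far: "energy_le (4 * d m) (\<lambda>s. U (m + i) s - U m s)" for m i
  proof (induction i arbitrary: m)
    case 0
    show ?case using energy_le_mono[OF z, of "4 * d m"] d(1)[of m] by simp
  next
    case (Suc i)
    have "energy_le (2 * (4 * d (Suc m)) + 2 * d m) (\<lambda>s. (U (Suc m + i) s - U (Suc m) s) + (U (Suc m) s - U m s))"
      by (intro energy_le_add continuous_intros Uc Suc inc)
    then show ?case by (simp add: d)
  qed
  have d_lim: "d \<longlonglongrightarrow> 0"
  proof -
    have "(\<lambda>m. K * (1/4) ^ m) \<longlonglongrightarrow> K * 0"
      by (intro tendsto_intros LIMSEQ_power_zero) simp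
    then show ?thesis by (simp add: d_def[abs_def] power_divide)
  qed
  have sq: "norm x < e" if "(norm x)\<^sup>2 \<le> 4 * d m" "d m < e\<^sup>2 / 4" "0 < e" for x :: ell2 and e m
    using that by (intro power2_less_imp_less[of "norm x" e]) auto
  have small: "\<exists>N. \<forall>m\<ge>N. d m < e\<^sup>2 / 4" if "0 < e" for e :: real
    using order_tendstoD(2)[OF d_lim, of "e\<^sup>2 / 4"] that by (simp add: eventually_sequentially)
  have "Cauchy (\<lambda>m. U m t)" if t: "0 \<le> t" for t
  proof (rule metric_CauchyI)
    fix e :: real assume e: "0 < e"
    then obtain N where N: "\<And>m. m \<ge> N \<Longrightarrow> d m < (e/2)\<^sup>2 / 4" using small[of "e/2"] by auto
    have *: "norm (U (N + i) t - U N t) < e / 2" for i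
      using far[of N i] t e N[of N] by (intro sq[of _ N]) (auto simp: energy_le_def)
    show "\<exists>N. \<forall>m\<ge>N. \<forall>n\<ge>N. dist (U m t) (U n t) < e"
    proof (intro exI allI impI)
      fix m n assume "N \<le> m" "N \<le> n"
      then show "dist (U m t) (U n t) < e"
        using *[of "m - N"] *[of "n - N"] dist_triangle_half_l[of "U m t" "U N t" e "U n t"]
        by (simp add: dist_norm)
    qed
  qed
  then have "\<exists>l. (\<lambda>m. U m t) \<longlonglongrightarrow> l" if "0 \<le> t" for t
    using that Cauchy_convergent_iff convergent_def by blast
  then obtain u where u: "\<And>t. 0 \<le> t \<Longrightarrow> (\<lambda>m. U m t) \<longlonglongrightarrow> u t" by metis
  have Ku: "energy_le K u" by (rule energy_le_limit[OF Uc u Ub])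
  have near: "energy_le (4 * d m) (\<lambda>s. u s - U m s)" for m
  proof (rule energy_le_limit[where U="\<lambda>i s. U (m + i) s - U m s"])
    show "continuous_on {0..} (\<lambda>s. U (m + i) s - U m s)" for i by (intro continuous_intros Uc)
    show "energy_le (4 * d m) (\<lambda>s. U (m + i) s - U m s)" for i by (rule far)
    show "(\<lambda>i. U (m + i) t - U m t) \<longlonglongrightarrow> u t - U m t" if "0 \<le> t" for t
      using LIMSEQ_ignore_initial_segment[OF u[OF that], of m] by (intro tendsto_intros) (simp add: add.commute)
  qed
  have ul: "uniform_limit {0..} U u sequentially"
  proof (rule uniform_limitI)
    fix e :: real assume e: "0 < e"
    then obtain N where N: "\<And>m. m \<ge> N \<Longrightarrow> d m < e\<^sup>2 / 4" using small[of e] by auto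
    have "dist (U m t) (u t) < e" if "N \<le> m" "0 \<le> t" for m t
    proof -
      have "(norm (u t - U m t))\<^sup>2 \<le> 4 * d m" using near[of m] that by (simp add: energy_le_def)
      from sq[OF this N[OF that(1)] e] show ?thesis by (simp add: dist_norm norm_minus_commute)
    qed
    then show "\<forall>\<^sub>F m in sequentially. \<forall>t\<in>{0..}. dist (U m t) (u t) < e"
      by (auto simp: eventually_sequentially)
  qed
  have uc: "continuous_on {0..} u"
    by (rule uniform_limit_theorem[OF _ ul]) (simp_all add: Uc)
  have uX: "u \<in> X" using uc Ku by (simp add: X_def)
  have fixpt: "S u t = u t" if t: "0 \<le> t" for t
  proof (rule LIMSEQ_unique[OF _ LIMSEQ_Suc[OF u[OF t]]])
    show "(\<lambda>m. U (Suc m) t) \<longlonglongrightarrow> S u t"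
    proof (rule LIMSEQ_I)
      fix e :: real assume e: "0 < e"
      then obtain N where N: "\<And>m. m \<ge> N \<Longrightarrow> d m < e\<^sup>2 / 4" using small[of e] by auto
      have "norm (U (Suc m) t - S u t) < e" if "N \<le> m" for m
      proof -
        have "energy_le (4 * d m / 4) (\<lambda>s. S u s - S (U m) s)" by (rule contr[OF uX UX near])
        then have "(norm (S u t - U (Suc m) t))\<^sup>2 \<le> 4 * d m"
          using t d(1)[of m] by (auto simp: energy_le_def US dest!: spec[of _ t])
        from sq[OF this N[OF that] e] show ?thesis by (simp add: norm_minus_commute)
      qed
      then show "\<exists>N. \<forall>m\<ge>N. norm (U (Suc m) t - S u t) < e" by blast
    qed
  qed
  have "diffusion_solution (\<lambda>s. force u s - M (u s)) u0 u"
  proof (rule diffusion_solution_cong[OF S[OF uX]])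
    show "set_integrable lborel {0..t} (\<lambda>s. force u s - M (u s))" for t
      by (intro set_integral_diff(1) fi uX set_integrable_bounded_linear[OF M]
          borel_integrable_atLeastAtMost' continuous_on_Icc_of_Ici uc)
    show "AE s in lborel. 0 \<le> s \<longrightarrow> force u s - M (u s) = force u s - M (S u s)"
      by (intro AE_I2) (simp add: fixpt)
  qed (simp add: fixpt)
  with Ku show ?thesis unfolding force_def by blast
qed

end

section \<open>Decay at infinity and uniqueness\<close>

lemma exists_limit_at_top_of_mono_bounded:
  fixes Y :: "real \<Rightarrow> real"
  assumes mono: "\<And>s t. 0 \<le> s \<Longrightarrow> s \<le> t \<Longrightarrow> Y s \<le> Y t" and bd: "\<And>t. 0 \<le> t \<Longrightarrow> Y t \<le> c"
  shows "\<exists>l. (Y \<longlongrightarrow> l) at_top"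
proof -
  have bdd: "bdd_above (Y ` {0..})" using bd by (intro bdd_aboveI[of _ c]) auto
  have "(Y \<longlongrightarrow> (SUP t\<in>{0..}. Y t)) at_top"
  proof (rule increasing_tendsto)
    show "\<forall>\<^sub>F t in at_top. Y t \<le> (SUP t\<in>{0..}. Y t)"
      using eventually_ge_at_top[of "0::real"] by eventually_elim (auto intro!: cSUP_upper bdd)
    fix x assume "x < (SUP t\<in>{0..}. Y t)"
    then obtain t0 where t0: "0 \<le> t0" "x < Y t0" by (subst (asm) less_cSUP_iff[OF _ bdd]) auto
    show "\<forall>\<^sub>F t in at_top. x < Y t"
      using eventually_ge_at_top[of t0] by eventually_elim (use mono[OF t0(1)] t0(2) in \<open>auto intro: less_le_trans\<close>)
  qed
  then show ?thesis by blast
qed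

lemma set_integral_Icc_tendsto_at_top:
  fixes f :: "real \<Rightarrow> real"
  assumes "set_integrable lborel {0..} f"
  shows "\<exists>l. ((\<lambda>t. LBINT s:{0..t}. f s) \<longlongrightarrow> l) at_top"
proof -
  have "((\<lambda>t. LINT s|lborel. indicator {..t} s *\<^sub>R (indicator {0..} s *\<^sub>R f s)) \<longlongrightarrow> (LINT s|lborel. indicator {0..} s *\<^sub>R f s)) at_top"
    using assms unfolding set_integrable_def by (intro tendsto_integral_at_top) auto
  moreover have "(\<lambda>t. LINT s|lborel. indicator {..t} s *\<^sub>R (indicator {0..} s *\<^sub>R f s)) = (\<lambda>t. LBINT s:{0..t}. f s)"
    unfolding set_lebesgue_integral_def
    by (intro ext Bochner_Integration.integral_cong) (auto simp: indicator_def)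
  ultimately show ?thesis by auto
qed

lemma limit_eq_0_of_nn_integral_finite:
  fixes f :: "real \<Rightarrow> real"
  assumes lim: "(f \<longlongrightarrow> l) at_top" and nn: "\<And>t. 0 \<le> t \<Longrightarrow> 0 \<le> f t"
    and fin: "(\<integral>\<^sup>+ s. ennreal (f s) \<partial>half_line) \<le> ennreal c" and c: "0 \<le> c"
  shows "l = 0"
proof (rule ccontr)
  have "\<forall>\<^sub>F t in at_top. 0 \<le> f t" using eventually_ge_at_top[of 0] by eventually_elim (rule nn)
  from tendsto_lowerbound[OF lim this] have "0 \<le> l" by simp
  moreover assume "l \<noteq> 0"
  ultimately have l: "0 < l" by simp
  have "eventually (\<lambda>t. l / 2 < f t) at_top" by (rule order_tendstoD(1)[OF lim]) (use l in simp)
  then obtain T0 where T0: "\<And>t. T0 \<le> t \<Longrightarrow> l / 2 < f t" by (auto simp: eventually_at_top_linorder)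
  define T where "T = max T0 0"
  obtain n :: nat where n: "c / (l / 2) < real n" using reals_Archimedean2 by blast
  have "ennreal (l / 2 * real n) = ennreal (l / 2) * emeasure lborel {T..T + real n}"
    using l ennreal_mult[of "l / 2" "real n"] by simp
  also have "\<dots> = (\<integral>\<^sup>+ s. ennreal (l / 2) * indicator {T..T + real n} s \<partial>lborel)"
    by (rule nn_integral_cmult_indicator[symmetric]) simp
  also have "\<dots> \<le> (\<integral>\<^sup>+ s. ennreal (f s) * indicator {0..} s \<partial>lborel)"
    by (intro nn_integral_mono) (auto simp: indicator_def T_def intro!: ennreal_leI less_imp_le[OF T0])
  also have "\<dots> = (\<integral>\<^sup>+ s. ennreal (f s) \<partial>half_line)" by (simp add: nn_integral_restrict_space)
  also have "\<dots> \<le> ennreal c" by (rule fin)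
  finally have "l / 2 * real n \<le> c" using c by (simp add: ennreal_le_iff)
  with n l show False by (simp add: field_simps)
qed

text \<open>
  The weight is only integrable, so the interval is divided into pieces on which its integral is at
  most \<open>1/2\<close>; the maximum of \<open>\<phi>\<close> over such a piece is then at most half of itself.
\<close>
lemma gronwall_zero:
  fixes \<phi> \<gamma> :: "real \<Rightarrow> real"
  assumes \<phi>: "continuous_on {0..} \<phi>" "\<And>t. 0 \<le> t \<Longrightarrow> 0 \<le> \<phi> t"
    and \<gamma>: "\<And>t. 0 \<le> t \<Longrightarrow> set_integrable lborel {0..t} \<gamma>" "\<And>t. 0 \<le> \<gamma> t"
    and le: "\<And>t. 0 \<le> t \<Longrightarrow> \<phi> t \<le> (LBINT s:{0..t}. \<gamma> s * \<phi> s)"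
    and T: "0 \<le> T"
  shows "\<phi> T = 0"
proof -
  define \<Gamma> where "\<Gamma> t = (LBINT s:{0..t}. \<gamma> s)" for t
  have "continuous_on {0..T} (\<lambda>t. integral {0..t} \<gamma>)"
    by (rule indefinite_integral_continuous_1[OF set_borel_integral_eq_integral(1)[OF \<gamma>(1)[OF T]]])
  then have "continuous_on {0..T} \<Gamma>"
    by (rule continuous_on_eq) (simp add: \<Gamma>_def set_borel_integral_eq_integral(2)[OF \<gamma>(1)])
  from compact_uniformly_continuous[OF this compact_Icc]
  obtain \<delta> where \<delta>: "\<delta> > 0" "\<And>s t. s \<in> {0..T} \<Longrightarrow> t \<in> {0..T} \<Longrightarrow> dist t s < \<delta> \<Longrightarrow> dist (\<Gamma> t) (\<Gamma> s) < 1/2"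
    unfolding uniformly_continuous_on_def by (meson half_gt_zero zero_less_one)
  have step: "\<phi> s = 0" if "s \<in> {0..T}" "s \<le> real n * (\<delta> / 2)" for n s
    using that
  proof (induction n arbitrary: s)
    case 0
    then have "s = 0" by simp
    then show ?case using le[of 0] \<phi>(2)[of 0] by (simp add: set_integral_singleton)
  next
    case (Suc n)
    define x where "x = min T (real n * (\<delta> / 2))"
    define y where "y = min T (real (Suc n) * (\<delta> / 2))"
    have xy: "0 \<le> x" "x \<le> y" "y \<le> T" "y - x < \<delta>"
      using T \<delta>(1) by (auto simp: x_def y_def min_def algebra_simps)
    have zero: "\<phi> r = 0" if "0 \<le> r" "r \<le> x" for r
      using Suc.IH[of r] that by (simp add: x_def)
    have "\<exists>z\<in>{x..y}. \<forall>r\<in>{x..y}. \<phi> r \<le> \<phi> z"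
      using xy \<phi>(1) by (intro continuous_attains_sup continuous_on_subset[OF \<phi>(1)]) auto
    then obtain z where z: "x \<le> z" "z \<le> y" and zmax: "\<And>r. x \<le> r \<Longrightarrow> r \<le> y \<Longrightarrow> \<phi> r \<le> \<phi> z" by auto
    have z0: "0 \<le> z" using xy z by simp
    have i1: "set_integrable lborel {x..z} \<gamma>"
      by (rule set_integrable_subset[OF \<gamma>(1)[OF z0]]) (use xy in auto)
    have ip: "set_integrable lborel {0..z} (\<lambda>s. \<gamma> s * \<phi> s)"
      using set_integrable_bilinear_continuous[OF bounded_bilinear_mult continuous_on_subset[OF \<phi>(1)] \<gamma>(1)[OF z0]]
      by (auto simp: mult.commute)
    have "\<phi> z \<le> (LBINT s:{0..z}. \<gamma> s * \<phi> s)" by (rule le[OF z0])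
    also have "\<dots> = (LBINT s:{x..z}. \<gamma> s * \<phi> s)"
      unfolding set_lebesgue_integral_def
      by (rule Bochner_Integration.integral_cong) (use xy zero in \<open>auto simp: indicator_def\<close>)
    also have "\<dots> \<le> (LBINT s:{x..z}. \<gamma> s * \<phi> z)"
      using zmax z xy \<gamma>(2)
      by (intro set_integral_mono set_integrable_subset[OF ip] set_integrable_mult_left i1 mult_left_mono) auto
    also have "\<dots> = (LBINT s:{x..z}. \<gamma> s) * \<phi> z" by simp
    also have "(LBINT s:{x..z}. \<gamma> s) = \<Gamma> z - \<Gamma> x"
    proof -
      have "\<Gamma> z = (LBINT s:{0..x}. \<gamma> s) + (LBINT s:{x..z}. \<gamma> s)"
      proof -
        have "\<Gamma> z = (LBINT s:{0..x} \<union> {x..z}. \<gamma> s)"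
          unfolding \<Gamma>_def using xy z by (simp add: ivl_disj_un_two_touch)
        also have "\<dots> = (LBINT s:{0..x}. \<gamma> s) + (LBINT s:{x..z}. \<gamma> s)"
        proof (rule set_integral_Un_AE)
          show "AE s in lborel. \<not> (s \<in> {0..x} \<and> s \<in> {x..z})"
            using AE_lborel_singleton[of x] by eventually_elim auto
        qed (use \<gamma>(1)[OF xy(1)] i1 in auto)
        finally show ?thesis .
      qed
      then show ?thesis by (simp add: \<Gamma>_def)
    qed
    also have "\<Gamma> z - \<Gamma> x \<le> 1/2"
    proof -
      have "\<bar>\<Gamma> z - \<Gamma> x\<bar> < 1/2" using \<delta>(2)[of x z] xy z by (simp add: dist_real_def)
      then show ?thesis by linarith
    qed
    finally have "\<phi> z \<le> 1/2 * \<phi> z"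
      using \<phi>(2)[OF z0] by (meson mult_right_mono order_trans)
    then have "\<phi> z \<le> 0" by simp
    then have "\<phi> r \<le> 0" if "x \<le> r" "r \<le> y" for r using zmax[OF that] by simp
    moreover have "s \<le> y" "0 \<le> s" using Suc.prems by (auto simp: y_def)
    ultimately show ?case using zero[of s] \<phi>(2)[of s] by (cases "s \<le> x") (auto intro: antisym)
  qed
  obtain n where "T / (\<delta> / 2) \<le> real n" using real_arch_simple by blast
  then have "T \<le> real n * (\<delta> / 2)" using \<delta>(1) by (simp add: field_simps)
  then show ?thesis using step[of T n] T by simp
qed

context shell_model
begin

lemma norm_sq_le_V_sq: "ennreal (k0\<^sup>2 * (norm x)\<^sup>2) \<le> V_sq x"
proof (rule LIMSEQ_le[OF _ V_sq_tendsto])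
  have "(\<lambda>N. \<Sum>n<N. (cmod (coord x n))\<^sup>2) \<longlonglongrightarrow> (norm x)\<^sup>2"
    unfolding norm_ell2_sq by (rule summable_LIMSEQ[OF summable_coord])
  then show "(\<lambda>N. ennreal (k0\<^sup>2 * (\<Sum>n<N. (cmod (coord x n))\<^sup>2))) \<longlonglongrightarrow> ennreal (k0\<^sup>2 * (norm x)\<^sup>2)"
    by (intro tendsto_ennrealI tendsto_mult_left)
  have "k0\<^sup>2 * (cmod (coord x n))\<^sup>2 \<le> (k n * cmod (coord x n))\<^sup>2" for n
    using power_mono[OF k0_le[of n], of 2] k0 by (simp add: power_mult_distrib mult_right_mono)
  then show "\<exists>N. \<forall>n\<ge>N. ennreal (k0\<^sup>2 * (\<Sum>n<n. (cmod (coord x n))\<^sup>2)) \<le> ennreal (\<Sum>n<n. (k n * cmod (coord x n))\<^sup>2)"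
    by (intro exI[of _ 0] allI impI ennreal_leI) (simp add: sum_distrib_left sum_mono)
qed

lemma energy_le_imp_L2:
  assumes u: "continuous_on {0..} u" and b: "energy_le c u"
  shows "sq_int u \<le> ennreal (c / k0\<^sup>2)"
proof -
  have "ennreal ((norm (u s))\<^sup>2) \<le> ennreal (1 / k0\<^sup>2) * V_sq (u s)" for s
  proof -
    have "ennreal ((norm (u s))\<^sup>2) = ennreal (1 / k0\<^sup>2) * ennreal (k0\<^sup>2 * (norm (u s))\<^sup>2)"
      using k0 by (subst ennreal_mult[symmetric]) auto
    also have "\<dots> \<le> ennreal (1 / k0\<^sup>2) * V_sq (u s)" by (intro mult_left_mono norm_sq_le_V_sq) auto
    finally show ?thesis .
  qed
  then have "sq_int u \<le> (\<integral>\<^sup>+ s. ennreal (1 / k0\<^sup>2) * V_sq (u s) \<partial>half_line)"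
    by (intro nn_integral_mono)
  also have "\<dots> = ennreal (1 / k0\<^sup>2) * (\<integral>\<^sup>+ s. V_sq (u s) \<partial>half_line)"
    by (rule nn_integral_cmult[OF measurable_V_sq_half_line[OF u]])
  also have "\<dots> \<le> ennreal (1 / k0\<^sup>2) * ennreal c"
    using b by (intro mult_left_mono) (auto simp: energy_le_def)
  also have "\<dots> = ennreal (c / k0\<^sup>2)"
    using energy_le_nonneg[OF b] by (subst ennreal_mult[symmetric]) auto
  finally show ?thesis .
qed

text \<open>
  In the energy identity both the dissipation integral and the integral of \<open>(u,h)\<close> converge as
  \<open>t\<close> tends to infinity, so \<open>|u(t)|\<^sup>2\<close> converges; its limit is \<open>0\<close> because \<open>|u|\<^sup>2\<close> is integrable.
\<close>
lemma diffusion_solution_tendsto_0: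
  assumes sol: "diffusion_solution h u0 u" and u: "energy_le c u"
    and hm: "h \<in> borel_measurable half_line" and h: "sq_int h < \<infinity>"
  shows "(u \<longlongrightarrow> 0) at_top"
proof -
  note uu = diffusion_solutionD[OF sol]
  have um: "u \<in> borel_measurable half_line" by (rule measurable_half_line_continuous[OF uu(1)])
  define Y where "Y t = ((norm u0)\<^sup>2 - (norm (u t))\<^sup>2 + 2 * (LBINT s:{0..t}. inner (u s) (h s))) / (2 * \<nu>)" for t
  have Y0: "0 \<le> Y t" if "0 \<le> t" for t
    using energy_identity(1)[OF sol that] nu by (simp add: Y_def)
  have YV: "ennreal (Y t) = (\<integral>\<^sup>+ s\<in>{0..t}. V_sq (u s) \<partial>lborel)" if "0 \<le> t" for t
    unfolding Y_def by (rule energy_identity(2)[OF sol that, symmetric])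
  have "Y s \<le> Y t" if "0 \<le> s" "s \<le> t" for s t
  proof -
    have "ennreal (Y s) \<le> ennreal (Y t)"
      unfolding YV[OF that(1)] YV[OF order_trans[OF that]] using that
      by (intro nn_integral_mono) (auto simp: indicator_def)
    then show ?thesis using Y0[OF order_trans[OF that]] by (simp add: ennreal_le_iff)
  qed
  moreover have "Y t \<le> c" if "0 \<le> t" for t
  proof -
    have "ennreal (Y t) \<le> ennreal c"
      unfolding YV[OF that] using nn_integral_Icc_le_half_line[of "\<lambda>s. V_sq (u s)" t] u
      by (auto simp: energy_le_def intro: order_trans)
    then show ?thesis using energy_le_nonneg[OF u] by (simp add: ennreal_le_iff)
  qed
  ultimately obtain y where y: "(Y \<longlongrightarrow> y) at_top"
    using exists_limit_at_top_of_mono_bounded[of Y c] by blast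
  have "set_integrable lborel {0..} (\<lambda>s. inner (u s) (h s))"
  proof -
    have m: "(\<lambda>s. inner (u s) (h s)) \<in> borel_measurable half_line" using um hm by measurable
    have pt: "ennreal (norm (inner (u s) (h s))) \<le> ennreal ((norm (u s))\<^sup>2) + ennreal ((norm (h s))\<^sup>2)" for s
    proof -
      have "norm (inner (u s) (h s)) \<le> norm (u s) * norm (h s)" using Cauchy_Schwarz_ineq2 by simp
      also have "\<dots> \<le> (norm (u s))\<^sup>2 + (norm (h s))\<^sup>2"
        using sum_squares_bound[of "norm (u s)" "norm (h s)"] mult_nonneg_nonneg[OF norm_ge_zero[of "u s"] norm_ge_zero[of "h s"]] by linarith
      finally have "ennreal (norm (inner (u s) (h s))) \<le> ennreal ((norm (u s))\<^sup>2 + (norm (h s))\<^sup>2)" by (rule ennreal_leI)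
      then show ?thesis by (subst (asm) ennreal_plus) simp_all
    qed
    have mu2: "(\<lambda>s. ennreal ((norm (u s))\<^sup>2)) \<in> borel_measurable half_line" using um by measurable
    have mh2: "(\<lambda>s. ennreal ((norm (h s))\<^sup>2)) \<in> borel_measurable half_line" using hm by measurable
    have "(\<integral>\<^sup>+ s. ennreal (norm (inner (u s) (h s))) \<partial>half_line)
        \<le> (\<integral>\<^sup>+ s. ennreal ((norm (u s))\<^sup>2) + ennreal ((norm (h s))\<^sup>2) \<partial>half_line)"
      by (rule nn_integral_mono[OF pt])
    also have "\<dots> = sq_int u + sq_int h"
      by (rule nn_integral_add[OF mu2 mh2])
    also have "\<dots> < \<infinity>" using h le_less_trans[OF energy_le_imp_L2[OF uu(1) u] ennreal_less_top] by simp
    finally have "integrable half_line (\<lambda>s. inner (u s) (h s))" by (rule integrableI_bounded[OF m])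
    then show ?thesis by (simp add: set_integrable_restrict_space integrable_restrict_space set_integrable_def)
  qed
  from set_integral_Icc_tendsto_at_top[OF this]
  obtain I where I: "((\<lambda>t. LBINT s:{0..t}. inner (u s) (h s)) \<longlongrightarrow> I) at_top" by blast
  have "((\<lambda>t. (norm u0)\<^sup>2 + 2 * (LBINT s:{0..t}. inner (u s) (h s)) - 2 * \<nu> * Y t) \<longlongrightarrow> (norm u0)\<^sup>2 + 2 * I - 2 * \<nu> * y) at_top"
    by (intro tendsto_intros I y)
  moreover have "(\<lambda>t. (norm u0)\<^sup>2 + 2 * (LBINT s:{0..t}. inner (u s) (h s)) - 2 * \<nu> * Y t) = (\<lambda>t. (norm (u t))\<^sup>2)"
    using nu by (simp add: Y_def field_simps)
  ultimately have L: "((\<lambda>t. (norm (u t))\<^sup>2) \<longlongrightarrow> (norm u0)\<^sup>2 + 2 * I - 2 * \<nu> * y) at_top" by simp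
  have "(norm u0)\<^sup>2 + 2 * I - 2 * \<nu> * y = 0"
    by (rule limit_eq_0_of_nn_integral_finite[OF L _ energy_le_imp_L2[OF uu(1) u]]) (use energy_le_nonneg[OF u] in auto)
  with L have "((\<lambda>t. sqrt ((norm (u t))\<^sup>2)) \<longlongrightarrow> sqrt 0) at_top" by (intro tendsto_real_sqrt) simp
  then show ?thesis by (simp add: tendsto_norm_zero_iff)
qed

lemma borel_measurable_sqrtA_op: "sqrtA_op k \<in> borel_measurable borel"
  unfolding sqrtA_op_def[abs_def]
proof (rule borel_measurable_to_ell2)
  note [measurable] = measurable_coord
  show "(\<lambda>x. sqrtA_seq k x n) \<in> borel_measurable borel" for n
    unfolding sqrtA_seq_def by measurable
qed (simp add: sqrtA_seq_def)

lemma L2_V_V_sq: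
  assumes "AE s in half_line. u s \<in> V_space k"
  shows "(\<integral>\<^sup>+ s. V_sq (u s) \<partial>half_line) = sq_int (\<lambda>s. sqrtA_op k (u s))"
  by (rule nn_integral_cong_AE, use assms in eventually_elim) (rule V_sq_eq_norm_sqrtA)

text \<open>
  The difference \<open>d\<close> solves a linear equation with right-hand side \<open>-Md - B(d,u1) - B(u2,d)\<close>, whose norm
  is at most \<open>|d|\<close> times \<open>K + cB (|A\<^bsup>1/2\<^esup>u1| + |A\<^bsup>1/2\<^esup>u2|)\<close>. This weight is integrable on bounded intervals.
\<close>
lemma nonlinear_uniqueness:
  assumes M: "bounded_linear M"
    and s1: "diffusion_solution (\<lambda>s. (p s - B (u1 s) (u1 s)) - M (u1 s)) u0 u1"
    and s2: "diffusion_solution (\<lambda>s. (p s - B (u2 s) (u2 s)) - M (u2 s)) u0 u2"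
    and V1: "AE s in half_line. u1 s \<in> V_space k" "(\<integral>\<^sup>+ s. V_sq (u1 s) \<partial>half_line) < \<infinity>"
    and V2: "AE s in half_line. u2 s \<in> V_space k" "(\<integral>\<^sup>+ s. V_sq (u2 s) \<partial>half_line) < \<infinity>"
    and t: "0 \<le> t"
  shows "u1 t = u2 t"
proof -
  obtain K where K: "\<And>x. norm (M x) \<le> norm x * K" "0 \<le> K"
    using bounded_linear.nonneg_bounded[OF M] by blast
  define d where "d s = u1 s - u2 s" for s
  define h where "h s = ((p s - B (u1 s) (u1 s)) - M (u1 s)) - ((p s - B (u2 s) (u2 s)) - M (u2 s))" for s
  have sol: "diffusion_solution h 0 d"
    using diffusion_solution_diff[OF s1 s2] by (simp add: h_def[abs_def] d_def[abs_def])
  note dd = diffusion_solutionD[OF sol]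
  define q1 where "q1 s = norm (sqrtA_op k (u1 s))" for s
  define q2 where "q2 s = norm (sqrtA_op k (u2 s))" for s
  have iq: "set_integrable lborel {0..t} (\<lambda>s. norm (sqrtA_op k (u s)))"
    if "continuous_on {0..} u" "AE s in half_line. u s \<in> V_space k" "(\<integral>\<^sup>+ s. V_sq (u s) \<partial>half_line) < \<infinity>" for u t
  proof (rule set_integrable_norm[OF set_integrable_of_L2])
    show "(\<lambda>s. sqrtA_op k (u s)) \<in> borel_measurable half_line"
      by (rule measurable_compose[OF measurable_half_line_continuous[OF that(1)] borel_measurable_sqrtA_op])
    show "sq_int (\<lambda>s. sqrtA_op k (u s)) < \<infinity>"
      using that(3) by (simp only: L2_V_V_sq[OF that(2)])
  qed
  define \<gamma> where "\<gamma> s = 2 * (K + cB * q1 s + cB * q2 s)" for s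
  have i\<gamma>: "set_integrable lborel {0..t} \<gamma>" for t
    unfolding \<gamma>_def q1_def q2_def
    by (intro set_integrable_mult_right set_integral_add(1) iq[OF diffusion_solutionD(1)[OF s1] V1]
        iq[OF diffusion_solutionD(1)[OF s2] V2]) (intro borel_integrable_atLeastAtMost' continuous_intros)
  have pos: "0 \<le> \<gamma> s" for s using K(2) cB_nonneg by (simp add: \<gamma>_def q1_def q2_def)
  have pt: "2 * inner (d s) (h s) \<le> \<gamma> s * (norm (d s))\<^sup>2" if "u1 s \<in> V_space k" "u2 s \<in> V_space k" for s
  proof -
    have "h s = - M (d s) - (B (d s) (u1 s) + B (u2 s) (d s))"
      using B_op_diff_quadratic[OF that] by (simp add: h_def d_def linear_diff[OF bounded_linear.linear[OF M]] algebra_simps)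
    then have "norm (h s) \<le> norm (M (d s)) + norm (B (d s) (u1 s) + B (u2 s) (d s))"
      by (metis norm_minus_cancel norm_triangle_ineq4)
    also have "\<dots> \<le> norm (M (d s)) + (norm (B (d s) (u1 s)) + norm (B (u2 s) (d s)))"
      by (intro add_left_mono norm_triangle_ineq)
    also have "\<dots> \<le> norm (d s) * K + (cB * norm (d s) * q1 s + cB * q2 s * norm (d s))"
      unfolding q1_def q2_def by (intro add_mono K B_op_bound_right(2) B_op_bound_left(2) that)
    finally have hs: "norm (h s) \<le> norm (d s) * K + (cB * norm (d s) * q1 s + cB * q2 s * norm (d s))" .
    have "2 * inner (d s) (h s) \<le> 2 * (norm (d s) * norm (h s))" using norm_cauchy_schwarz[of "d s" "h s"] by simp
    also have "\<dots> \<le> 2 * (norm (d s) * (norm (d s) * K + (cB * norm (d s) * q1 s + cB * q2 s * norm (d s))))"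
      by (intro mult_left_mono hs) auto
    also have "\<dots> = \<gamma> s * (norm (d s))\<^sup>2" by (simp add: \<gamma>_def power2_eq_square algebra_simps)
    finally show ?thesis .
  qed
  have "(norm (d t))\<^sup>2 = 0"
  proof (rule gronwall_zero[of "\<lambda>t. (norm (d t))\<^sup>2" \<gamma>])
    show "continuous_on {0..} (\<lambda>t. (norm (d t))\<^sup>2)" by (intro continuous_intros dd)
    fix t :: real assume t: "0 \<le> t"
    show "set_integrable lborel {0..t} \<gamma>" by (rule i\<gamma>)
    have i1: "set_integrable lborel {0..t} (\<lambda>s. inner (d s) (h s))"
      by (rule set_integrable_bilinear_continuous[OF bounded_bilinear_inner continuous_on_Icc_of_Ici[OF dd(1)] dd(3)[OF t]])
    have i2: "set_integrable lborel {0..t} (\<lambda>s. \<gamma> s * (norm (d s))\<^sup>2)"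
    proof -
      have "continuous_on {0..t} (\<lambda>s. (norm (d s))\<^sup>2)" by (intro continuous_intros continuous_on_Icc_of_Ici dd)
      from set_integrable_bilinear_continuous[OF bounded_bilinear_mult this i\<gamma>] show ?thesis by (simp add: mult.commute)
    qed
    have ae: "AE s in lborel. s \<in> {0..t} \<longrightarrow> 2 * inner (d s) (h s) \<le> \<gamma> s * (norm (d s))\<^sup>2"
    proof -
      have "AE s in half_line. 2 * inner (d s) (h s) \<le> \<gamma> s * (norm (d s))\<^sup>2"
        using V1(1) V2(1) by eventually_elim (rule pt)
      then have "AE s in lborel. s \<in> {0..} \<longrightarrow> 2 * inner (d s) (h s) \<le> \<gamma> s * (norm (d s))\<^sup>2"
        by (subst (asm) AE_restrict_space_iff) simp_all
      then show ?thesis by eventually_elim simp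
    qed
    have "(norm (d t))\<^sup>2 \<le> 2 * (LBINT s:{0..t}. inner (d s) (h s))"
      using energy_identity(1)[OF sol t] by simp
    also have "\<dots> = (LBINT s:{0..t}. 2 * inner (d s) (h s))" by simp
    also have "\<dots> \<le> (LBINT s:{0..t}. \<gamma> s * (norm (d s))\<^sup>2)"
      by (rule set_integral_mono_AE[OF set_integrable_mult_right[OF i1] i2 ae])
    finally show "(norm (d t))\<^sup>2 \<le> (LBINT s:{0..t}. \<gamma> s * (norm (d s))\<^sup>2)" .
  qed (use pos t in auto)
  then show ?thesis by (simp add: d_def)
qed

end

section \<open>From the Riccati equation to the closed loop system\<close>

lemma L2_H_nn_integral:
  assumes "w \<in> L2_H"
  shows "sq_int w = ennreal ((L2_norm w)\<^sup>2)"
proof -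
  have i: "integrable half_line (\<lambda>t. (norm (w t))\<^sup>2)" using assms by (simp add: L2_H_def)
  have "sq_int w = ennreal (\<integral>t. (norm (w t))\<^sup>2 \<partial>half_line)"
    by (rule nn_integral_eq_integral[OF i]) (rule AE_I2, rule zero_le_power2)
  also have "(\<integral>t. (norm (w t))\<^sup>2 \<partial>half_line) = (L2_norm w)\<^sup>2"
    unfolding L2_norm_def by (rule real_sqrt_pow2[symmetric]) (rule Bochner_Integration.integral_nonneg, rule zero_le_power2)
  finally show ?thesis .
qed

lemma L2_HI:
  assumes m: "f \<in> borel_measurable half_line"
    and le: "sq_int f \<le> ennreal c" and c: "0 \<le> c"
  shows "f \<in> L2_H" "(L2_norm f)\<^sup>2 \<le> c"
proof -
  have m2: "(\<lambda>s. (norm (f s))\<^sup>2) \<in> borel_measurable half_line" using m by measurable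
  have "integrable half_line (\<lambda>t. (norm (f t))\<^sup>2)"
    by (rule integrableI_nonneg[OF m2 _ le_less_trans[OF le ennreal_less_top, folded infinity_ennreal_def]])
      (rule AE_I2, rule zero_le_power2)
  with m show f: "f \<in> L2_H" by (simp add: L2_H_def)
  show "(L2_norm f)\<^sup>2 \<le> c" using le c unfolding L2_H_nn_integral[OF f] by (simp only: ennreal_le_iff)
qed

lemma nn_integral_bounded_linear_square_le:
  fixes T :: "ell2 \<Rightarrow> ell2"
  assumes T: "\<And>x. norm (T x) \<le> norm x * L" and f: "f \<in> borel_measurable half_line"
    and F: "sq_int f \<le> ennreal F" "0 \<le> F"
  shows "sq_int (\<lambda>s. T (f s)) \<le> ennreal (L\<^sup>2 * F)"
proof -
  have mf: "(\<lambda>s. ennreal ((norm (f s))\<^sup>2)) \<in> borel_measurable half_line" using f by measurable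
  have "sq_int (\<lambda>s. T (f s)) \<le> (\<integral>\<^sup>+ s. ennreal (L\<^sup>2) * ennreal ((norm (f s))\<^sup>2) \<partial>half_line)"
  proof (rule nn_integral_mono)
    fix s
    have "(norm (T (f s)))\<^sup>2 \<le> L\<^sup>2 * (norm (f s))\<^sup>2"
      using power_mono[OF T[of "f s"] norm_ge_zero, of 2] by (simp add: power_mult_distrib mult.commute)
    then have "ennreal ((norm (T (f s)))\<^sup>2) \<le> ennreal (L\<^sup>2 * (norm (f s))\<^sup>2)" by (rule ennreal_leI)
    then show "ennreal ((norm (T (f s)))\<^sup>2) \<le> ennreal (L\<^sup>2) * ennreal ((norm (f s))\<^sup>2)"
      by (subst (asm) ennreal_mult) simp_all
  qed
  also have "\<dots> = ennreal (L\<^sup>2) * sq_int f"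
    by (rule nn_integral_cmult[OF mf])
  also have "\<dots> \<le> ennreal (L\<^sup>2) * ennreal F" by (rule mult_left_mono[OF F(1)]) simp
  also have "\<dots> = ennreal (L\<^sup>2 * F)" by (rule ennreal_mult[symmetric]) (use F(2) in auto)
  finally show ?thesis .
qed

lemma borel_measurable_bounded_linear_comp:
  fixes T :: "ell2 \<Rightarrow> ell2"
  assumes T: "bounded_linear T" and f: "f \<in> borel_measurable N"
  shows "(\<lambda>s. T (f s)) \<in> borel_measurable N"
  by (rule measurable_compose[OF f borel_measurable_continuous_onI[OF linear_continuous_on[OF T]]])

context shell_model
begin

text \<open>
  Pairing the Riccati equation with \<open>x\<close> turns \<open>\<A>\<^sup>*R + R\<A>\<close> into \<open>2(Rx,\<A>x)\<close>. The feedback contributes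
  \<open>2|B\<^sub>1\<^sup>*Rx|\<^sup>2\<close>, of which the Riccati equation cancels one half; the terms that remain beside \<open>|x|\<^sup>2\<close> are
  nonnegative.
\<close>
lemma riccati_imp_lyapunov:
  assumes ue: "ue \<in> V_space k" and B1: "bounded_linear B1" and B2: "bounded_linear B2" and \<gamma>: "0 < \<gamma>"
    and ric: "riccati_feedback (dom_A k) (lin_op k \<nu> a b ue) B1 B2 \<gamma> R"
  shows "lyapunov_shell_model lam k0 \<nu> k (\<lambda>x. linearized_B ue x + B1 (adjoint B1 (R x))) R"
proof -
  have R: "bounded_linear R" and sym: "\<And>x y. inner (R x) y = inner x (R y)" and nn: "\<And>x. 0 \<le> inner x (R x)"
    and dom: "\<And>x. x \<in> dom_A k \<Longrightarrow> R x \<in> adj_dom (dom_A k) (lin_op k \<nu> a b ue)"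
    and eq: "\<And>x. x \<in> dom_A k \<Longrightarrow> adj_op (dom_A k) (lin_op k \<nu> a b ue) (R x) + R (lin_op k \<nu> a b ue x)
        + R (B1 (adjoint B1 (R x))) - (1/\<gamma>) *\<^sub>R R (B2 (adjoint B2 (R x))) - x = 0"
    using ric unfolding riccati_feedback_def by auto
  show ?thesis
    unfolding lyapunov_shell_model_def lyapunov_shell_model_axioms_def
  proof (intro conjI allI impI)
    show "bounded_linear (\<lambda>x. linearized_B ue x + B1 (adjoint B1 (R x)))"
      by (intro bounded_linear_add bounded_linear_linearized_B ue bounded_linear_compose[OF B1]
          bounded_linear_compose[OF bounded_linear_adjoint_ell2[OF B1]] R)
    fix x assume x: "x \<in> dom_A k"
    let ?T = "lin_op k \<nu> a b ue"
    have 0: "inner x (adj_op (dom_A k) ?T (R x)) + inner x (R (?T x)) + inner x (R (B1 (adjoint B1 (R x))))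
        - (1/\<gamma>) * inner x (R (B2 (adjoint B2 (R x)))) - inner x x = 0"
      using arg_cong[OF eq[OF x], of "inner x"] by (simp add: inner_add_right inner_diff_right)
    have 1: "inner x (adj_op (dom_A k) ?T (R x)) = inner (R x) (?T x)"
      using adj_op_dom_A[OF dom[OF x] x] by (simp add: inner_commute)
    have 2: "inner (R x) (B1 (adjoint B1 (R x))) = (norm (adjoint B1 (R x)))\<^sup>2"
      using inner_adjoint_ell2[OF B1, of "adjoint B1 (R x)" "R x"] by (simp add: inner_commute power2_norm_eq_inner)
    have 3: "inner (R x) (B2 (adjoint B2 (R x))) = (norm (adjoint B2 (R x)))\<^sup>2"
      using inner_adjoint_ell2[OF B2, of "adjoint B2 (R x)" "R x"] by (simp add: inner_commute power2_norm_eq_inner)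
    have T: "\<nu> *\<^sub>R A_op k x + (linearized_B ue x + B1 (adjoint B1 (R x))) = ?T x + B1 (adjoint B1 (R x))"
      using closed_loop_eq(3)[OF ue x] by simp
    have 4: "2 * inner (R x) (?T x) + (norm (adjoint B1 (R x)))\<^sup>2
        = (norm x)\<^sup>2 + (1/\<gamma>) * (norm (adjoint B2 (R x)))\<^sup>2"
      using 0 unfolding 1 sym[symmetric] 2 3 power2_norm_eq_inner[of x] by linarith
    have "0 \<le> (norm (adjoint B1 (R x)))\<^sup>2" "0 \<le> (1/\<gamma>) * (norm (adjoint B2 (R x)))\<^sup>2" using \<gamma> by auto
    then show "(norm x)\<^sup>2 \<le> 2 * inner (R x) (\<nu> *\<^sub>R A_op k x + (linearized_B ue x + B1 (adjoint B1 (R x))))"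
      using 4 unfolding T inner_add_right 2 by argo
  qed (fact shell_model_axioms R sym nn)+
qed

lemma L2_VI:
  assumes u: "continuous_on {0..} u" and b: "energy_le c u"
  shows "u \<in> L2_V k" "(L2_V_norm k u)\<^sup>2 \<le> c"
proof -
  note V = AE_V_space[OF u b]
  have m: "(\<lambda>s. sqrtA_op k (u s)) \<in> borel_measurable half_line"
    by (rule measurable_compose[OF measurable_half_line_continuous[OF u] borel_measurable_sqrtA_op])
  have le: "sq_int (\<lambda>s. sqrtA_op k (u s)) \<le> ennreal c"
    using b unfolding energy_le_def L2_V_V_sq[OF V] by simp
  show "u \<in> L2_V k" using L2_HI(1)[OF m le energy_le_nonneg[OF b]] V measurable_half_line_continuous[OF u]
    by (simp add: L2_V_def)
  show "(L2_V_norm k u)\<^sup>2 \<le> c" unfolding L2_V_norm_def by (rule L2_HI(2)[OF m le energy_le_nonneg[OF b]])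
qed

lemma energy_le_imp_Sigma_set:
  assumes u: "continuous_on {0..} u" and b: "energy_le (\<kappa>\<^sup>2) u" and \<kappa>: "0 \<le> \<kappa>"
  shows "u \<in> Sigma_set k \<kappa>"
proof -
  have m: "u \<in> borel_measurable half_line" by (rule measurable_half_line_continuous[OF u])
  have "norm (u s) \<le> \<kappa>" if "0 \<le> s" for s
    using b that \<kappa> by (intro power2_le_imp_le[of "norm (u s)" \<kappa>]) (auto simp: energy_le_def)
  then have inf: "Linf_norm u \<le> ereal \<kappa>"
    unfolding Linf_norm_def using m by (intro esssup_I) (auto intro!: AE_I2 simp: space_restrict_space)
  then have "u \<in> Linf_H" using m by (auto simp: Linf_H_def intro: le_less_trans)
  moreover have "L2_V_norm k u \<le> \<kappa>"
    using L2_VI(2)[OF u b] \<kappa> by (intro power2_le_imp_le[of "L2_V_norm k u" \<kappa>]) auto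
  ultimately show ?thesis using L2_VI(1)[OF u b] inf by (simp add: Sigma_set_def)
qed

lemma L2_V_imp_V_sq:
  assumes "u \<in> L2_V k"
  shows "AE s in half_line. u s \<in> V_space k" "(\<integral>\<^sup>+ s. V_sq (u s) \<partial>half_line) < \<infinity>"
proof -
  show V: "AE s in half_line. u s \<in> V_space k" using assms by (simp add: L2_V_def)
  have "(\<lambda>t. sqrtA_op k (u t)) \<in> L2_H" using assms by (simp add: L2_V_def)
  from L2_H_nn_integral[OF this] show "(\<integral>\<^sup>+ s. V_sq (u s) \<partial>half_line) < \<infinity>"
    unfolding L2_V_V_sq[OF V] by (simp only: ennreal_less_top infinity_ennreal_def)
qed

lemma nonlinear_solution_iff:
  assumes ue: "ue \<in> V_space k" and M: "bounded_linear (\<lambda>x. linearized_B ue x + B1 (adjoint B1 (R x)))"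
    and int: "\<And>t. 0 \<le> t \<Longrightarrow> set_integrable lborel {0..t} (\<lambda>s. B2 (w s) - B (u s) (u s))"
  shows "nonlinear_solution k \<nu> a b ue B1 B2 R u0 w u \<longleftrightarrow> u \<in> C_H \<inter> L2_V k \<and>
    diffusion_solution (\<lambda>s. (B2 (w s) - B (u s) (u s)) - (linearized_B ue (u s) + B1 (adjoint B1 (R (u s))))) u0 u"
  unfolding nonlinear_solution_def Let_def closed_loop_eq(1)[OF ue]
  using evolution_solution_iff_diffusion[where M="\<lambda>x. linearized_B ue x + B1 (adjoint B1 (R x))"
      and T="closed_loop_op k \<nu> a b ue (\<lambda>x. B1 (adjoint B1 (R x)))", OF M closed_loop_eq(2)[OF ue] int] by simp

end

context lyapunov_shell_model
begin

lemma small_data_solution: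
  assumes EC: "energy_constant C"
    and p: "p \<in> borel_measurable half_line" "sq_int p \<le> ennreal W" "0 \<le> W"
    and \<kappa>: "0 < \<kappa>" "C * ((norm u0)\<^sup>2 + (2 * W + 2 * (cB\<^sup>2 * \<kappa>\<^sup>2 * \<kappa>\<^sup>2))) \<le> \<kappa>\<^sup>2" "16 * (C * cB\<^sup>2) * \<kappa>\<^sup>2 \<le> 1"
  shows "\<exists>u. u \<in> C_H \<and> u \<in> L2_V k \<and> u \<in> Sigma_set k \<kappa>
    \<and> (\<forall>t. set_integrable lborel {0..t} (\<lambda>s. p s - B (u s) (u s)))
    \<and> diffusion_solution (\<lambda>s. (p s - B (u s) (u s)) - M (u s)) u0 u"
proof -
  have K0: "0 < \<kappa>\<^sup>2" using \<kappa>(1) by simp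
  obtain u where b: "energy_le (\<kappa>\<^sup>2) u" and sol: "diffusion_solution (\<lambda>s. (p s - B (u s) (u s)) - M (u s)) u0 u"
    using small_data_existence[OF EC p K0 \<kappa>(2,3)] by blast
  note u = diffusion_solutionD(1)[OF sol]
  note um = measurable_half_line_continuous[OF u]
  obtain L where L: "\<And>x. norm (M x) \<le> norm x * L" "0 \<le> L"
    using bounded_linear.nonneg_bounded[OF M] by blast
  have Bm: "(\<lambda>s. B (u s) (u s)) \<in> borel_measurable half_line" by (rule borel_measurable_B[OF um um])
  have B2: "sq_int (\<lambda>s. B (u s) (u s)) \<le> ennreal (cB\<^sup>2 * \<kappa>\<^sup>2 * \<kappa>\<^sup>2)"
    by (rule nn_integral_B_le(1)[OF u b]) (use b in \<open>auto simp: energy_le_def\<close>)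
  have fm: "(\<lambda>s. p s - B (u s) (u s)) \<in> borel_measurable half_line" by (rule borel_measurable_diff[OF p(1) Bm])
  have f2: "sq_int (\<lambda>s. p s - B (u s) (u s)) \<le> ennreal (2 * W + 2 * (cB\<^sup>2 * \<kappa>\<^sup>2 * \<kappa>\<^sup>2))"
    by (rule nn_integral_square_add_le[OF _ p(1) Bm p(2,3) B2]) (auto intro!: AE_I2 norm_triangle_ineq4)
  have Mm: "(\<lambda>s. M (u s)) \<in> borel_measurable half_line" by (rule borel_measurable_bounded_linear_comp[OF M um])
  have c0: "0 \<le> \<kappa>\<^sup>2 / k0\<^sup>2" by simp
  have M2: "sq_int (\<lambda>s. M (u s)) \<le> ennreal (L\<^sup>2 * (\<kappa>\<^sup>2 / k0\<^sup>2))"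
    by (rule nn_integral_bounded_linear_square_le[OF L(1) um energy_le_imp_L2[OF u b] c0])
  have "sq_int (\<lambda>s. (p s - B (u s) (u s)) - M (u s))
      \<le> ennreal (2 * (2 * W + 2 * (cB\<^sup>2 * \<kappa>\<^sup>2 * \<kappa>\<^sup>2)) + 2 * (L\<^sup>2 * (\<kappa>\<^sup>2 / k0\<^sup>2)))"
    by (rule nn_integral_square_add_le[OF _ fm Mm f2 _ M2])
      (use p(3) in \<open>auto intro!: AE_I2 norm_triangle_ineq4\<close>)
  from le_less_trans[OF this ennreal_less_top, folded infinity_ennreal_def]
  have "(u \<longlongrightarrow> 0) at_top"
    by (rule diffusion_solution_tendsto_0[OF sol b borel_measurable_diff[OF fm Mm]])
  then have "u \<in> C_H" using u by (auto simp: C_H_def)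
  moreover have "set_integrable lborel {0..t} (\<lambda>s. p s - B (u s) (u s))" for t
    by (rule set_integrable_of_L2[OF fm le_less_trans[OF f2 ennreal_less_top, folded infinity_ennreal_def]])
  ultimately show ?thesis
    using sol L2_VI(1)[OF u b] energy_le_imp_Sigma_set[OF u b] \<kappa>(1) by (intro exI[of _ u]) auto
qed

end

theorem theorem4p21:
  fixes lam k0 \<nu> a b c \<gamma> \<gamma>\<^sub>0 :: real and k :: "nat \<Rightarrow> real"
    and ue f :: ell2 and B1 B2 R :: "ell2 \<Rightarrow> ell2"
  assumes "lam > 1" and "k0 > 0" and "\<And>n. k n = k0 * lam ^ n" and "\<nu> > 0"
    and "a + b + c = 0"
    and "ue \<in> dom_A k" and "\<nu> *\<^sub>R A_op k ue + B_op k a b ue ue = f"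
    and "bounded_linear B1" and "bounded_linear B2"
    and "game_threshold (dom_A k) (lin_op k \<nu> a b ue) B1 B2 \<gamma>\<^sub>0"
    and "\<gamma> > \<gamma>\<^sub>0"
    and "riccati_feedback (dom_A k) (lin_op k \<nu> a b ue) B1 B2 \<gamma> R"
  shows "\<exists>\<kappa>\<^sub>0>0. \<exists>\<pi> :: real \<Rightarrow> real.
           mono_on {0<..} \<pi> \<and> (\<forall>x>0. \<pi> x > 0) \<and>
           (\<forall>\<kappa> u0 w. 0 < \<kappa> \<and> \<kappa> < \<kappa>\<^sub>0 \<and> w \<in> L2_H \<and> norm u0 + L2_norm w \<le> \<pi> \<kappa> \<longrightarrow>
              (\<exists>u. nonlinear_solution k \<nu> a b ue B1 B2 R u0 w u \<and> u \<in> Sigma_set k \<kappa> \<and>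
                 (\<forall>u'. nonlinear_solution k \<nu> a b ue B1 B2 R u0 w u' \<longrightarrow>
                    (\<forall>t\<ge>0. u' t = u t))))"
proof -
  interpret S: shell_model lam k0 \<nu> a b k by unfold_locales (use assms in auto)
  have ue: "ue \<in> V_space k" using assms(6) S.dom_A_subset_V by blast
  have \<gamma>: "0 < \<gamma>" using assms(10,11) by (simp add: game_threshold_def)
  define M where "M x = S.linearized_B ue x + B1 (adjoint B1 (R x))" for x
  interpret L: lyapunov_shell_model lam k0 \<nu> a b k M R
    unfolding M_def[abs_def] by (rule S.riccati_imp_lyapunov[OF ue assms(8,9) \<gamma> assms(12)])
  note M = L.M[unfolded M_def[abs_def]]
  obtain C where EC: "L.energy_constant C" using L.linear_estimate by blast
  then have C: "1 \<le> C" by (simp add: L.energy_constant_def)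
  obtain \<beta> where \<beta>: "\<And>x. norm (B2 x) \<le> norm x * \<beta>" "0 \<le> \<beta>"
    using bounded_linear.nonneg_bounded[OF assms(9)] by blast
  (* kappa0 makes 16 C cB^2 kappa^2 at most 1, so that the quadratic term uses up less than half of the
     admissible energy kappa^2. The slope q of pi is chosen such that the data use up at most the other half. *)
  define \<kappa>0 where "\<kappa>0 = 1 / (4 * sqrt C * (S.cB + 1))"
  define q where "q = 1 / sqrt (2 * C * (1 + 2 * \<beta>\<^sup>2))"
  have cB: "0 \<le> S.cB" by (rule S.cB_nonneg)
  have \<kappa>0: "0 < \<kappa>0" using C cB by (simp add: \<kappa>0_def)
  have q: "0 < q" "q\<^sup>2 = 1 / (2 * C * (1 + 2 * \<beta>\<^sup>2))"
    using mult_pos_pos[of C "1 + 2 * \<beta>\<^sup>2"] C add_pos_nonneg[of 1 "2 * \<beta>\<^sup>2"]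
    by (auto simp: q_def power_divide)
  have main: "\<exists>u. nonlinear_solution k \<nu> a b ue B1 B2 R u0 w u \<and> u \<in> Sigma_set k \<kappa> \<and>
                 (\<forall>u'. nonlinear_solution k \<nu> a b ue B1 B2 R u0 w u' \<longrightarrow> (\<forall>t\<ge>0. u' t = u t))"
    if \<kappa>: "0 < \<kappa>" "\<kappa> < \<kappa>0" and w: "w \<in> L2_H" and small: "norm u0 + L2_norm w \<le> q * \<kappa>" for \<kappa> u0 w
  proof -
    define W where "W = \<beta>\<^sup>2 * (L2_norm w)\<^sup>2"
    have W0: "0 \<le> W" by (simp add: W_def)
    have wm: "w \<in> borel_measurable half_line" using w by (simp add: L2_H_def)
    have pm: "(\<lambda>s. B2 (w s)) \<in> borel_measurable half_line"
      by (rule borel_measurable_bounded_linear_comp[OF assms(9) wm])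
    have pW: "sq_int (\<lambda>s. B2 (w s)) \<le> ennreal W"
      unfolding W_def
      by (rule nn_integral_bounded_linear_square_le[OF \<beta>(1) wm]) (simp_all add: L2_H_nn_integral[OF w])
    have w0: "0 \<le> L2_norm w" by (simp add: L2_norm_def)
    have K: "16 * (C * S.cB\<^sup>2) * \<kappa>\<^sup>2 \<le> 1"
    proof -
      have "\<kappa>\<^sup>2 \<le> \<kappa>0\<^sup>2" using \<kappa> by (intro power_mono) auto
      also have "\<kappa>0\<^sup>2 = 1 / (16 * C * (S.cB + 1)\<^sup>2)"
        using C by (simp add: \<kappa>0_def power_divide power_mult_distrib)
      finally have "16 * (C * S.cB\<^sup>2) * \<kappa>\<^sup>2 \<le> 16 * (C * S.cB\<^sup>2) * (1 / (16 * C * (S.cB + 1)\<^sup>2))"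
        using C by (intro mult_left_mono) auto
      also have "\<dots> = S.cB\<^sup>2 / (S.cB + 1)\<^sup>2" using C by simp
      also have "\<dots> \<le> 1" using cB by (simp add: divide_le_eq_1 power_mono)
      finally show ?thesis .
    qed
    have "(norm u0)\<^sup>2 \<le> (q * \<kappa>)\<^sup>2" "(L2_norm w)\<^sup>2 \<le> (q * \<kappa>)\<^sup>2"
      using small w0 norm_ge_zero[of u0] by (auto intro!: power_mono simp del: norm_ge_zero)
    then have "(norm u0)\<^sup>2 + 2 * W \<le> (q * \<kappa>)\<^sup>2 + 2 * (\<beta>\<^sup>2 * (q * \<kappa>)\<^sup>2)"
      unfolding W_def by (intro add_mono mult_left_mono) auto
    also have "\<dots> = (1 + 2 * \<beta>\<^sup>2) * q\<^sup>2 * \<kappa>\<^sup>2" by (simp add: power_mult_distrib algebra_simps)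
    finally have "C * ((norm u0)\<^sup>2 + 2 * W) \<le> C * ((1 + 2 * \<beta>\<^sup>2) * q\<^sup>2 * \<kappa>\<^sup>2)"
      using C by (intro mult_left_mono) auto
    also have "\<dots> = \<kappa>\<^sup>2 / 2"
    proof -
      have "C * (x * (1 / (2 * C * x)) * \<kappa>\<^sup>2) = \<kappa>\<^sup>2 / 2" if "0 < x" for x
        using that C by simp
      from this[of "1 + 2 * \<beta>\<^sup>2"] show ?thesis unfolding q(2) by (simp only: add_pos_nonneg zero_less_one zero_le_power2 mult_nonneg_nonneg zero_le_numeral)
    qed
    finally have 1: "C * ((norm u0)\<^sup>2 + 2 * W) \<le> \<kappa>\<^sup>2 / 2" .
    have 2: "C * (2 * (S.cB\<^sup>2 * \<kappa>\<^sup>2 * \<kappa>\<^sup>2)) \<le> \<kappa>\<^sup>2 / 2"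
    proof -
      have "(16 * (C * S.cB\<^sup>2) * \<kappa>\<^sup>2) * \<kappa>\<^sup>2 \<le> 1 * \<kappa>\<^sup>2" by (rule mult_right_mono[OF K]) simp
      moreover have "0 \<le> \<kappa>\<^sup>2" by simp
      moreover have "(16 * (C * S.cB\<^sup>2) * \<kappa>\<^sup>2) * \<kappa>\<^sup>2 = 8 * (C * (2 * (S.cB\<^sup>2 * \<kappa>\<^sup>2 * \<kappa>\<^sup>2)))" by simp
      ultimately show ?thesis by linarith
    qed
    have "C * ((norm u0)\<^sup>2 + (2 * W + 2 * (S.cB\<^sup>2 * \<kappa>\<^sup>2 * \<kappa>\<^sup>2))) = C * ((norm u0)\<^sup>2 + 2 * W) + C * (2 * (S.cB\<^sup>2 * \<kappa>\<^sup>2 * \<kappa>\<^sup>2))"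
      by (simp add: algebra_simps)
    with 1 2 have 3: "C * ((norm u0)\<^sup>2 + (2 * W + 2 * (S.cB\<^sup>2 * \<kappa>\<^sup>2 * \<kappa>\<^sup>2))) \<le> \<kappa>\<^sup>2" by linarith
    obtain u where u: "u \<in> C_H" "u \<in> L2_V k" "u \<in> Sigma_set k \<kappa>"
      and ui: "\<And>t. set_integrable lborel {0..t} (\<lambda>s. B2 (w s) - S.B (u s) (u s))"
      and sol: "S.diffusion_solution (\<lambda>s. (B2 (w s) - S.B (u s) (u s)) - M (u s)) u0 u"
      using L.small_data_solution[OF EC pm pW W0 \<kappa>(1) 3 K] by blast
    have "nonlinear_solution k \<nu> a b ue B1 B2 R u0 w u"
      unfolding S.nonlinear_solution_iff[where ?B2.0=B2 and w=w and u=u, OF ue M ui] using u sol by (simp add: M_def)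
    moreover have "u' t = u t" if u': "nonlinear_solution k \<nu> a b ue B1 B2 R u0 w u'" and t: "0 \<le> t" for u' t
    proof -
      have i': "set_integrable lborel {0..t} (\<lambda>s. B2 (w s) - S.B (u' s) (u' s))" if "0 \<le> t" for t
        using u' that by (simp add: nonlinear_solution_def evolution_solution_def Let_def)
      have V': "u' \<in> L2_V k"
        and sol': "S.diffusion_solution (\<lambda>s. (B2 (w s) - S.B (u' s) (u' s)) - M (u' s)) u0 u'"
        using iffD1[OF S.nonlinear_solution_iff[where ?B2.0=B2 and w=w and u=u', OF ue M i'] u']
        by (simp_all add: M_def)
      show ?thesis
        by (rule S.nonlinear_uniqueness[OF L.M sol' sol S.L2_V_imp_V_sq[OF V'] S.L2_V_imp_V_sq[OF u(2)] t])
    qed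
    ultimately show ?thesis using u(3) by blast
  qed
  show ?thesis
  proof (intro exI[of _ \<kappa>0] conjI exI[of _ "\<lambda>x. q * x"] allI impI \<kappa>0)
    show "mono_on {0<..} (\<lambda>x. q * x)" using q(1) by (intro mono_onI mult_left_mono) auto
  qed (use q(1) main in auto)
qed

end
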